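(* Let $(M,I,J,K,g_M)$ be a hyperkähler manifold, $(N,g_N)$ a Riemannian manifold, and $F:(M,g_M)\to(N,g_N)$ a h-Lagrangian submersion such that $(I,J,K)$ is a h-Lagrangian basis, i.e. $F$ is a Riemannian submersion with $I(\ker F_* )=(\ker F_* )^{\perp}$, $J(\ker F_* )=\ker F_*$ and $K(\ker F_* )=(\ker F_* )^{\perp}$. Then the following conditions are equivalent: a) $F$ is a totally geodesic map; b) $\mathcal{A}_X IV=0$ and $\mathcal{T}_V IW=0$ for all $V,W\in\Gamma(\ker F_* )$ and $X\in\Gamma((\ker F_* )^{\perp})$; c) $\mathcal{A}_X KV=0$ and $\mathcal{T}_V KW=0$ for all $V,W\in\Gamma(\ker F_* )$ and $X\in\Gamma((\ker F_* )^{\perp})$; d) $\mathcal{A}_X JV=0$ and $\mathcal{T}_V JW=0$ for all $V,W\in\Gamma(\ker F_* )$ and $X\in\Gamma((\ker F_* )^{\perp})$.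
   Context: A hyperkähler manifold $(M,I,J,K,g_M)$ is a $4m$-dimensional Riemannian manifold with endomorphism fields $I,J,K$ of $TM$ satisfying $I^2=J^2=K^2=-\mathrm{id}$, $IJ=-JI=K$, $JK=-KJ=I$, $KI=-IK=J$, $g_M(RX,RY)=g_M(X,Y)$ for $R\in\{I,J,K\}$, and $\nabla I=\nabla J=\nabla K=0$, where $\nabla$ is the Levi-Civita connection of $g_M$. A Riemannian submersion $F:(M,g_M)\to(N,g_N)$ is a smooth surjective submersion such that $(F_* )_p:(\ker (F_* )_p)^{\perp}\to T_{F(p)}N$ is a linear isometry for every $p\in M$. For a vector field $U$ on $M$ write $U=\mathcal{V}U+\mathcal{H}U$ with $\mathcal{V}U\in\Gamma(\ker F_* )$ and $\mathcal{H}U\in\Gamma((\ker F_* )^{\perp})$. The O'Neill tensors are $$\mathcal{A}_U W=\mathcal{H}\nabla_{\mathcal{H}U}\mathcal{V}W+\mathcal{V}\nabla_{\mathcal{H}U}\mathcal{H}W,\qquad \mathcal{T}_U W=\mathcal{H}\nabla_{\mathcal{V}U}\mathcal{V}W+\mathcal{V}\nabla_{\mathcal{V}U}\mathcal{H}W .$$ The second fundamental form of $F$ is $(\nabla F_* )(U,W)=\nabla^F_U F_*W-F_*(\nabla_UW)$ for $U,W\in\Gamma(TM)$, where $\nabla^F$ is the pullback connection along $F$; $F$ is a totally geodesic map if $\nabla F_*=0$. *)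

theory Defs
  imports "HOL-Analysis.Analysis"
begin

section \<open>Smooth maps between Euclidean spaces\<close>

text \<open>These notions are only used on open sets.\<close>

primrec Ck_on :: "nat \<Rightarrow> ('a::euclidean_space \<Rightarrow> 'b::real_normed_vector) \<Rightarrow> 'a set \<Rightarrow> bool" where
  "Ck_on 0 f S \<longleftrightarrow> continuous_on S f"
| "Ck_on (Suc n) f S \<longleftrightarrow>
     (\<forall>x\<in>S. f differentiable (at x)) \<and> (\<forall>v. Ck_on n (\<lambda>x. frechet_derivative f (at x) v) S)"

definition smooth_on :: "('a::euclidean_space \<Rightarrow> 'b::real_normed_vector) \<Rightarrow> 'a set \<Rightarrow> bool" where
  "smooth_on f S \<longleftrightarrow> (\<forall>n. Ck_on n f S)"


section \<open>Smooth manifolds\<close>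

text \<open>
  The underlying space of a manifold is a second countable Hausdorff type, and the model space
  is a Euclidean space \<open>'e\<close>, so that the dimension is \<open>DIM('e)\<close>. A chart is its domain together
  with its coordinate map. The smooth structure is given by an atlas that need not be maximal.
\<close>

type_synonym ('m, 'e) chart = "'m set \<times> ('m \<Rightarrow> 'e)"

definition chart_inv :: "('m, 'e) chart \<Rightarrow> 'e \<Rightarrow> 'm" where
  "chart_inv c = inv_into (fst c) (snd c)"

definition is_chart :: "('m::topological_space, 'e::euclidean_space) chart \<Rightarrow> bool" where
  "is_chart c \<longleftrightarrow> open (fst c) \<and> open (snd c ` fst c) \<and>
     homeomorphism (fst c) (snd c ` fst c) (snd c) (chart_inv c)"

definition smooth_atlas ::
  "('m::{t2_space, second_countable_topology}, 'e::euclidean_space) chart set \<Rightarrow> bool" where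
  "smooth_atlas M \<longleftrightarrow> (\<forall>c\<in>M. is_chart c) \<and> (\<Union>c\<in>M. fst c) = UNIV \<and>
     (\<forall>c\<in>M. \<forall>d\<in>M. smooth_on (snd d \<circ> chart_inv c) (snd c ` (fst c \<inter> fst d)))"

text \<open>
  Tangent spaces: at every point \<open>p\<close> a preferred chart of the atlas is chosen once and for all, and
  the tangent space at \<open>p\<close> is identified with the model space \<open>'e\<close> through this chart. Thus
  \<open>v :: 'e\<close>, regarded as a tangent vector at \<open>p\<close>, is the vector whose components in the preferred
  chart at \<open>p\<close> are \<open>v\<close>; its components in another chart \<open>c\<close> are the differential of the
  coordinate map of \<open>c\<close> at \<open>p\<close> applied to \<open>v\<close>.
\<close>

definition chart_at :: "('m, 'e) chart set \<Rightarrow> 'm \<Rightarrow> ('m, 'e) chart" where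
  "chart_at M p = (SOME c. c \<in> M \<and> p \<in> fst c)"

text \<open>
  The differential at \<open>p\<close> of a map \<open>f\<close> (defined at least near \<open>p\<close>) into a normed space;
  \<open>mderiv M f p v\<close> is the derivative of \<open>f\<close> in the direction of the tangent vector \<open>v\<close> at \<open>p\<close>.
\<close>

definition mderiv ::
  "('m, 'e::euclidean_space) chart set \<Rightarrow> ('m \<Rightarrow> 'b::real_normed_vector) \<Rightarrow> 'm \<Rightarrow> 'e \<Rightarrow> 'b" where
  "mderiv M f p =
     frechet_derivative (f \<circ> chart_inv (chart_at M p)) (at (snd (chart_at M p) p))"

definition smooth_functions ::
  "('m, 'e::euclidean_space) chart set \<Rightarrow> ('m \<Rightarrow> real) set" where
  "smooth_functions M = {f. \<forall>c\<in>M. smooth_on (f \<circ> chart_inv c) (snd c ` fst c)}"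

definition vector_fields :: "('m, 'e::euclidean_space) chart set \<Rightarrow> ('m \<Rightarrow> 'e) set" where
  "vector_fields M = {U. \<forall>c\<in>M.
     smooth_on ((\<lambda>p. mderiv M (snd c) p (U p)) \<circ> chart_inv c) (snd c ` fst c)}"

definition smooth_map ::
  "('m::topological_space, 'e::euclidean_space) chart set \<Rightarrow>
   ('n::topological_space, 'f::euclidean_space) chart set \<Rightarrow> ('m \<Rightarrow> 'n) \<Rightarrow> bool" where
  "smooth_map M N F \<longleftrightarrow> continuous_on UNIV F \<and>
     (\<forall>c\<in>M. \<forall>d\<in>N. smooth_on (snd d \<circ> F \<circ> chart_inv c) (snd c ` (fst c \<inter> F -` fst d)))"

definition pushforward ::
  "('m, 'e::euclidean_space) chart set \<Rightarrow> ('n, 'f::euclidean_space) chart set \<Rightarrow>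
   ('m \<Rightarrow> 'n) \<Rightarrow> 'm \<Rightarrow> 'e \<Rightarrow> 'f" where
  "pushforward M N F p = mderiv M (snd (chart_at N (F p)) \<circ> F) p"

text \<open>Smooth sections of the pullback bundle of \<open>TN\<close> along \<open>F\<close>: \<open>s p\<close> is tangent to \<open>N\<close> at \<open>F p\<close>.\<close>

definition sections_along ::
  "('m, 'e::euclidean_space) chart set \<Rightarrow> ('n, 'f::euclidean_space) chart set \<Rightarrow>
   ('m \<Rightarrow> 'n) \<Rightarrow> ('m \<Rightarrow> 'f) set" where
  "sections_along M N F = {s. \<forall>c\<in>M. \<forall>d\<in>N.
     smooth_on ((\<lambda>p. mderiv N (snd d) (F p) (s p)) \<circ> chart_inv c)
       (snd c ` (fst c \<inter> F -` fst d))}"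

text \<open>
  The bracket is determined by \<open>[U, W] f = U (W f) - W (U f)\<close>. Taking for \<open>f\<close> the coordinate
  functions of the preferred chart at \<open>p\<close> gives its components at \<open>p\<close>.
\<close>

definition lie_bracket ::
  "('m, 'e::euclidean_space) chart set \<Rightarrow> ('m \<Rightarrow> 'e) \<Rightarrow> ('m \<Rightarrow> 'e) \<Rightarrow> 'm \<Rightarrow> 'e" where
  "lie_bracket M U W p = (let x = snd (chart_at M p) in
     mderiv M (\<lambda>q. mderiv M x q (W q)) p (U p) - mderiv M (\<lambda>q. mderiv M x q (U q)) p (W p))"


section \<open>Metrics and connections\<close>

definition riemannian_metric ::
  "('m, 'e::euclidean_space) chart set \<Rightarrow> ('m \<Rightarrow> 'e \<Rightarrow> 'e \<Rightarrow> real) \<Rightarrow> bool" where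
  "riemannian_metric M g \<longleftrightarrow>
     (\<forall>p. bilinear (g p)) \<and> (\<forall>p v w. g p v w = g p w v) \<and> (\<forall>p v. v \<noteq> 0 \<longrightarrow> g p v v > 0) \<and>
     (\<forall>U\<in>vector_fields M. \<forall>W\<in>vector_fields M. (\<lambda>p. g p (U p) (W p)) \<in> smooth_functions M)"

definition affine_connection ::
  "('m, 'e::euclidean_space) chart set \<Rightarrow> (('m \<Rightarrow> 'e) \<Rightarrow> ('m \<Rightarrow> 'e) \<Rightarrow> 'm \<Rightarrow> 'e) \<Rightarrow> bool" where
  "affine_connection M D \<longleftrightarrow>
     (\<forall>U\<in>vector_fields M. \<forall>W\<in>vector_fields M. D U W \<in> vector_fields M) \<and>
     (\<forall>U\<in>vector_fields M. \<forall>U'\<in>vector_fields M. \<forall>W\<in>vector_fields M. \<forall>p.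
        D (\<lambda>q. U q + U' q) W p = D U W p + D U' W p) \<and>
     (\<forall>f\<in>smooth_functions M. \<forall>U\<in>vector_fields M. \<forall>W\<in>vector_fields M. \<forall>p.
        D (\<lambda>q. f q *\<^sub>R U q) W p = f p *\<^sub>R D U W p) \<and>
     (\<forall>U\<in>vector_fields M. \<forall>W\<in>vector_fields M. \<forall>W'\<in>vector_fields M. \<forall>p.
        D U (\<lambda>q. W q + W' q) p = D U W p + D U W' p) \<and>
     (\<forall>f\<in>smooth_functions M. \<forall>U\<in>vector_fields M. \<forall>W\<in>vector_fields M. \<forall>p.
        D U (\<lambda>q. f q *\<^sub>R W q) p = mderiv M f p (U p) *\<^sub>R W p + f p *\<^sub>R D U W p)"

definition levi_civita ::
  "('m, 'e::euclidean_space) chart set \<Rightarrow> ('m \<Rightarrow> 'e \<Rightarrow> 'e \<Rightarrow> real) \<Rightarrow>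
   (('m \<Rightarrow> 'e) \<Rightarrow> ('m \<Rightarrow> 'e) \<Rightarrow> 'm \<Rightarrow> 'e) \<Rightarrow> bool" where
  "levi_civita M g D \<longleftrightarrow> affine_connection M D \<and>
     (\<forall>U\<in>vector_fields M. \<forall>W\<in>vector_fields M. \<forall>Z\<in>vector_fields M. \<forall>p.
        mderiv M (\<lambda>q. g q (W q) (Z q)) p (U p) = g p (D U W p) (Z p) + g p (W p) (D U Z p)) \<and>
     (\<forall>U\<in>vector_fields M. \<forall>W\<in>vector_fields M. \<forall>p.
        D U W p - D W U p = lie_bracket M U W p)"

text \<open>
  The pullback along \<open>F\<close> of a connection \<open>D\<close> on \<open>N\<close> is the connection on the pullback bundle
  that satisfies \<open>DF\<^sub>u (Y \<circ> F) = D\<^bsub>F\<^sub>* u\<^esub> Y\<close> for \<open>Y \<in> \<Gamma>(TN)\<close> and every tangent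
  vector \<open>u\<close> of \<open>M\<close>; the right-hand side is evaluated with any field \<open>Z\<close> extending \<open>F\<^sub>* u\<close>.
\<close>

definition pullback_connection ::
  "('m, 'e::euclidean_space) chart set \<Rightarrow> ('n, 'f::euclidean_space) chart set \<Rightarrow> ('m \<Rightarrow> 'n) \<Rightarrow>
   (('n \<Rightarrow> 'f) \<Rightarrow> ('n \<Rightarrow> 'f) \<Rightarrow> 'n \<Rightarrow> 'f) \<Rightarrow>
   (('m \<Rightarrow> 'e) \<Rightarrow> ('m \<Rightarrow> 'f) \<Rightarrow> 'm \<Rightarrow> 'f) \<Rightarrow> bool" where
  "pullback_connection M N F D DF \<longleftrightarrow>
     (\<forall>U\<in>vector_fields M. \<forall>s\<in>sections_along M N F. DF U s \<in> sections_along M N F) \<and>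
     (\<forall>U\<in>vector_fields M. \<forall>U'\<in>vector_fields M. \<forall>s\<in>sections_along M N F. \<forall>p.
        DF (\<lambda>q. U q + U' q) s p = DF U s p + DF U' s p) \<and>
     (\<forall>f\<in>smooth_functions M. \<forall>U\<in>vector_fields M. \<forall>s\<in>sections_along M N F. \<forall>p.
        DF (\<lambda>q. f q *\<^sub>R U q) s p = f p *\<^sub>R DF U s p) \<and>
     (\<forall>U\<in>vector_fields M. \<forall>s\<in>sections_along M N F. \<forall>s'\<in>sections_along M N F. \<forall>p.
        DF U (\<lambda>q. s q + s' q) p = DF U s p + DF U s' p) \<and>
     (\<forall>f\<in>smooth_functions M. \<forall>U\<in>vector_fields M. \<forall>s\<in>sections_along M N F. \<forall>p.
        DF U (\<lambda>q. f q *\<^sub>R s q) p = mderiv M f p (U p) *\<^sub>R s p + f p *\<^sub>R DF U s p) \<and>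
     (\<forall>U\<in>vector_fields M. \<forall>Y\<in>vector_fields N. \<forall>Z\<in>vector_fields N. \<forall>p.
        Z (F p) = pushforward M N F p (U p) \<longrightarrow> DF U (Y \<circ> F) p = D Z Y (F p))"


section \<open>Hyperkaehler manifolds\<close>

definition endomorphism_field ::
  "('m, 'e::euclidean_space) chart set \<Rightarrow> ('m \<Rightarrow> 'e \<Rightarrow> 'e) \<Rightarrow> bool" where
  "endomorphism_field M R \<longleftrightarrow> (\<forall>p. linear (R p)) \<and>
     (\<forall>U\<in>vector_fields M. (\<lambda>p. R p (U p)) \<in> vector_fields M)"

definition parallel_endomorphism ::
  "('m, 'e::euclidean_space) chart set \<Rightarrow> (('m \<Rightarrow> 'e) \<Rightarrow> ('m \<Rightarrow> 'e) \<Rightarrow> 'm \<Rightarrow> 'e) \<Rightarrow>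
   ('m \<Rightarrow> 'e \<Rightarrow> 'e) \<Rightarrow> bool" where
  "parallel_endomorphism M D R \<longleftrightarrow> (\<forall>U\<in>vector_fields M. \<forall>W\<in>vector_fields M. \<forall>p.
     D U (\<lambda>q. R q (W q)) p - R p (D U W p) = 0)"

text \<open>\<open>D\<close> is the Levi-Civita connection of \<open>g\<close>.\<close>

definition hyperkaehler ::
  "('m::{t2_space, second_countable_topology}, 'e::euclidean_space) chart set \<Rightarrow>
   ('m \<Rightarrow> 'e \<Rightarrow> 'e) \<Rightarrow> ('m \<Rightarrow> 'e \<Rightarrow> 'e) \<Rightarrow> ('m \<Rightarrow> 'e \<Rightarrow> 'e) \<Rightarrow>
   ('m \<Rightarrow> 'e \<Rightarrow> 'e \<Rightarrow> real) \<Rightarrow> (('m \<Rightarrow> 'e) \<Rightarrow> ('m \<Rightarrow> 'e) \<Rightarrow> 'm \<Rightarrow> 'e) \<Rightarrow> bool" where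
  "hyperkaehler M I J K g D \<longleftrightarrow>
     smooth_atlas M \<and> (\<exists>m. DIM('e) = 4 * m) \<and> riemannian_metric M g \<and> levi_civita M g D \<and>
     (\<forall>R\<in>{I, J, K}. endomorphism_field M R \<and> (\<forall>p v. R p (R p v) = - v) \<and>
        (\<forall>p v w. g p (R p v) (R p w) = g p v w) \<and> parallel_endomorphism M D R) \<and>
     (\<forall>p v. I p (J p v) = K p v \<and> J p (I p v) = - K p v) \<and>
     (\<forall>p v. J p (K p v) = I p v \<and> K p (J p v) = - I p v) \<and>
     (\<forall>p v. K p (I p v) = J p v \<and> I p (K p v) = - J p v)"


section \<open>Riemannian submersions\<close>

definition vertical ::
  "('m, 'e::euclidean_space) chart set \<Rightarrow> ('n, 'f::euclidean_space) chart set \<Rightarrow>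
   ('m \<Rightarrow> 'n) \<Rightarrow> 'm \<Rightarrow> 'e set" where
  "vertical M N F p = {v. pushforward M N F p v = 0}"

definition horizontal ::
  "('m, 'e::euclidean_space) chart set \<Rightarrow> ('n, 'f::euclidean_space) chart set \<Rightarrow>
   ('m \<Rightarrow> 'e \<Rightarrow> 'e \<Rightarrow> real) \<Rightarrow> ('m \<Rightarrow> 'n) \<Rightarrow> 'm \<Rightarrow> 'e set" where
  "horizontal M N g F p = {v. \<forall>w\<in>vertical M N F p. g p v w = 0}"

definition riemannian_submersion ::
  "('m::topological_space, 'e::euclidean_space) chart set \<Rightarrow>
   ('n::topological_space, 'f::euclidean_space) chart set \<Rightarrow>
   ('m \<Rightarrow> 'e \<Rightarrow> 'e \<Rightarrow> real) \<Rightarrow> ('n \<Rightarrow> 'f \<Rightarrow> 'f \<Rightarrow> real) \<Rightarrow> ('m \<Rightarrow> 'n) \<Rightarrow> bool" where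
  "riemannian_submersion M N g h F \<longleftrightarrow>
     smooth_map M N F \<and> surj F \<and> (\<forall>p. surj (pushforward M N F p)) \<and>
     (\<forall>p. pushforward M N F p ` horizontal M N g F p = UNIV \<and>
        (\<forall>v\<in>horizontal M N g F p. \<forall>w\<in>horizontal M N g F p.
           h (F p) (pushforward M N F p v) (pushforward M N F p w) = g p v w))"

definition h_lagrangian_submersion ::
  "('m::topological_space, 'e::euclidean_space) chart set \<Rightarrow>
   ('n::topological_space, 'f::euclidean_space) chart set \<Rightarrow>
   ('m \<Rightarrow> 'e \<Rightarrow> 'e) \<Rightarrow> ('m \<Rightarrow> 'e \<Rightarrow> 'e) \<Rightarrow> ('m \<Rightarrow> 'e \<Rightarrow> 'e) \<Rightarrow>
   ('m \<Rightarrow> 'e \<Rightarrow> 'e \<Rightarrow> real) \<Rightarrow> ('n \<Rightarrow> 'f \<Rightarrow> 'f \<Rightarrow> real) \<Rightarrow> ('m \<Rightarrow> 'n) \<Rightarrow> bool" where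
  "h_lagrangian_submersion M N I J K g h F \<longleftrightarrow> riemannian_submersion M N g h F \<and>
     (\<forall>p. I p ` vertical M N F p = horizontal M N g F p \<and>
          J p ` vertical M N F p = vertical M N F p \<and>
          K p ` vertical M N F p = horizontal M N g F p)"

definition vertical_fields ::
  "('m, 'e::euclidean_space) chart set \<Rightarrow> ('n, 'f::euclidean_space) chart set \<Rightarrow>
   ('m \<Rightarrow> 'n) \<Rightarrow> ('m \<Rightarrow> 'e) set" where
  "vertical_fields M N F = {V \<in> vector_fields M. \<forall>p. V p \<in> vertical M N F p}"

definition horizontal_fields ::
  "('m, 'e::euclidean_space) chart set \<Rightarrow> ('n, 'f::euclidean_space) chart set \<Rightarrow>
   ('m \<Rightarrow> 'e \<Rightarrow> 'e \<Rightarrow> real) \<Rightarrow> ('m \<Rightarrow> 'n) \<Rightarrow> ('m \<Rightarrow> 'e) set" where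
  "horizontal_fields M N g F = {X \<in> vector_fields M. \<forall>p. X p \<in> horizontal M N g F p}"

definition ver ::
  "('m, 'e::euclidean_space) chart set \<Rightarrow> ('n, 'f::euclidean_space) chart set \<Rightarrow>
   ('m \<Rightarrow> 'e \<Rightarrow> 'e \<Rightarrow> real) \<Rightarrow> ('m \<Rightarrow> 'n) \<Rightarrow> ('m \<Rightarrow> 'e) \<Rightarrow> 'm \<Rightarrow> 'e" where
  "ver M N g F U p = (THE v. v \<in> vertical M N F p \<and> U p - v \<in> horizontal M N g F p)"

definition hor ::
  "('m, 'e::euclidean_space) chart set \<Rightarrow> ('n, 'f::euclidean_space) chart set \<Rightarrow>
   ('m \<Rightarrow> 'e \<Rightarrow> 'e \<Rightarrow> real) \<Rightarrow> ('m \<Rightarrow> 'n) \<Rightarrow> ('m \<Rightarrow> 'e) \<Rightarrow> 'm \<Rightarrow> 'e" where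
  "hor M N g F U p = U p - ver M N g F U p"

definition oneill_A ::
  "('m, 'e::euclidean_space) chart set \<Rightarrow> ('n, 'f::euclidean_space) chart set \<Rightarrow>
   ('m \<Rightarrow> 'e \<Rightarrow> 'e \<Rightarrow> real) \<Rightarrow> (('m \<Rightarrow> 'e) \<Rightarrow> ('m \<Rightarrow> 'e) \<Rightarrow> 'm \<Rightarrow> 'e) \<Rightarrow>
   ('m \<Rightarrow> 'n) \<Rightarrow> ('m \<Rightarrow> 'e) \<Rightarrow> ('m \<Rightarrow> 'e) \<Rightarrow> 'm \<Rightarrow> 'e" where
  "oneill_A M N g D F U W p =
     hor M N g F (D (hor M N g F U) (ver M N g F W)) p +
     ver M N g F (D (hor M N g F U) (hor M N g F W)) p"

definition oneill_T ::
  "('m, 'e::euclidean_space) chart set \<Rightarrow> ('n, 'f::euclidean_space) chart set \<Rightarrow>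
   ('m \<Rightarrow> 'e \<Rightarrow> 'e \<Rightarrow> real) \<Rightarrow> (('m \<Rightarrow> 'e) \<Rightarrow> ('m \<Rightarrow> 'e) \<Rightarrow> 'm \<Rightarrow> 'e) \<Rightarrow>
   ('m \<Rightarrow> 'n) \<Rightarrow> ('m \<Rightarrow> 'e) \<Rightarrow> ('m \<Rightarrow> 'e) \<Rightarrow> 'm \<Rightarrow> 'e" where
  "oneill_T M N g D F U W p =
     hor M N g F (D (ver M N g F U) (ver M N g F W)) p +
     ver M N g F (D (ver M N g F U) (hor M N g F W)) p"

text \<open>\<open>D\<close> is the connection on \<open>M\<close> and \<open>DF\<close> the pullback connection along \<open>F\<close>.\<close>

definition second_fundamental_form ::
  "('m, 'e::euclidean_space) chart set \<Rightarrow> ('n, 'f::euclidean_space) chart set \<Rightarrow>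
   (('m \<Rightarrow> 'e) \<Rightarrow> ('m \<Rightarrow> 'e) \<Rightarrow> 'm \<Rightarrow> 'e) \<Rightarrow> (('m \<Rightarrow> 'e) \<Rightarrow> ('m \<Rightarrow> 'f) \<Rightarrow> 'm \<Rightarrow> 'f) \<Rightarrow>
   ('m \<Rightarrow> 'n) \<Rightarrow> ('m \<Rightarrow> 'e) \<Rightarrow> ('m \<Rightarrow> 'e) \<Rightarrow> 'm \<Rightarrow> 'f" where
  "second_fundamental_form M N D DF F U W p =
     DF U (\<lambda>q. pushforward M N F q (W q)) p - pushforward M N F p (D U W p)"

definition totally_geodesic ::
  "('m, 'e::euclidean_space) chart set \<Rightarrow> ('n, 'f::euclidean_space) chart set \<Rightarrow>
   (('m \<Rightarrow> 'e) \<Rightarrow> ('m \<Rightarrow> 'e) \<Rightarrow> 'm \<Rightarrow> 'e) \<Rightarrow> (('m \<Rightarrow> 'e) \<Rightarrow> ('m \<Rightarrow> 'f) \<Rightarrow> 'm \<Rightarrow> 'f) \<Rightarrow>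
   ('m \<Rightarrow> 'n) \<Rightarrow> bool" where
  "totally_geodesic M N D DF F \<longleftrightarrow> (\<forall>U\<in>vector_fields M. \<forall>W\<in>vector_fields M. \<forall>p.
     second_fundamental_form M N D DF F U W p = 0)"

end

theory Submission
  imports Defs
begin

text \<open>
  Since \<open>I\<close>, \<open>J\<close>, \<open>K\<close> are parallel and map the vertical distribution onto the vertical or the
  horizontal one, each of the conditions b), c), d) says that the covariant derivatives \<open>D\<^sub>U V\<close> of vertical
  fields \<open>V\<close> are vertical. As \<open>(\<nabla>F\<^sub>*)(U, V) = - F\<^sub>* (D\<^sub>U V)\<close> for vertical \<open>V\<close>, this follows from a).
  For the converse one needs that \<open>\<nabla>F\<^sub>*\<close> is symmetric and vanishes on pairs of horizontal fields. The
  first holds because the pullback connection is torsion-free along \<open>F\<close>; as it is also metric,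
  \<open>h((\<nabla>F\<^sub>*)(X, Y), F\<^sub>* Z)\<close> is symmetric in \<open>X\<close>, \<open>Y\<close> and skew in \<open>Y\<close>, \<open>Z\<close> on horizontal fields, hence zero.
  Both properties of the pullback connection are computed in a local frame of \<open>N\<close> that is extended to
  global fields by bump functions. The horizontal part of a smooth field is smooth, so splitting fields
  into horizontal and vertical parts replaces any appeal to tensoriality.
\<close>

section \<open>Calculus of smooth maps on open sets\<close>

text \<open>The connections are given by axioms about globally defined smooth fields and sections,
  so no local formula is directly available: a computation near a point needs fields on the whole
  manifold that agree there with the coordinate ones, and a cut-off factor is removed through the
  Leibniz rule, since its derivative vanishes where it is locally constant. A second obstacle is the
  encoding of tangent vectors. The preferred chart jumps from point to point, so a constant function
  into the model space need not be a smooth field, and smoothness has to be checked in a fixed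
  chart. The frames on \<open>M\<close> are orthogonal but not normalised; this requires reciprocals
  of smooth functions and no square roots. Finally, the O'Neill tensors reduce to covariant
  derivatives because, for \<open>R\<close> among \<open>I\<close>, \<open>J\<close>,
  \<open>K\<close> and vertical \<open>W\<close>, the field \<open>R W\<close> is wholly vertical or
  wholly horizontal: one of the two summands of each tensor vanishes, and the vanishing of the other
  says that \<open>R (D U W)\<close> lies in the image of the vertical space under
  \<open>R\<close>.\<close>

lemma frechet_derivative_cong_open:
  assumes "open S" "x \<in> S" "\<And>y. y \<in> S \<Longrightarrow> f y = g y"
  shows "frechet_derivative f (at x) = frechet_derivative g (at x)"
proof -
  have "(f has_derivative f') (at x) = (g has_derivative f') (at x)" for f'
    using assms has_derivative_transform_within_open[of f f' x UNIV S g]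
      has_derivative_transform_within_open[of g f' x UNIV S f] by auto
  then show ?thesis
    by (simp add: frechet_derivative_def)
qed

lemma Ck_on_subset: "Ck_on n f S \<Longrightarrow> T \<subseteq> S \<Longrightarrow> Ck_on n f T"
  by (induction n arbitrary: f) (auto intro: continuous_on_subset)

lemma Ck_on_SucD: "Ck_on (Suc n) f S \<Longrightarrow> Ck_on n f S"
proof (induction n arbitrary: f)
  case 0
  then show ?case
    by (auto intro!: continuous_at_imp_continuous_on differentiable_imp_continuous_within)
next
  case (Suc n)
  then show ?case
    by (metis Ck_on.simps(2))
qed

lemma Ck_on_has_derivative:
  "Ck_on (Suc n) f S \<Longrightarrow> x \<in> S \<Longrightarrow> (f has_derivative frechet_derivative f (at x)) (at x)"
  by (simp add: frechet_derivative_works)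

lemma Ck_on_cong:
  assumes "open S" "\<And>x. x \<in> S \<Longrightarrow> f x = g x" "Ck_on n f S"
  shows "Ck_on n g S"
  using assms(2,3)
proof (induction n arbitrary: f g)
  case 0
  then show ?case
    using continuous_on_cong[of S S f g] by auto
next
  case (Suc n)
  have "frechet_derivative f (at x) = frechet_derivative g (at x)" if "x \<in> S" for x
    by (rule frechet_derivative_cong_open[OF assms(1) that]) (rule Suc.prems(1))
  moreover have "g differentiable (at x)" if "x \<in> S" for x
  proof -
    have "f differentiable (at x)"
      using Suc.prems that by auto
    then obtain f' where "(f has_derivative f') (at x)"
      unfolding differentiable_def by blast
    then have "(g has_derivative f') (at x)"
      by (rule has_derivative_transform_within_open[OF _ assms(1) that]) (rule Suc.prems(1))
    then show ?thesis
      unfolding differentiable_def by blast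
  qed
  moreover have "Ck_on n (\<lambda>x. frechet_derivative f (at x) v) S" for v
    using Suc.prems(2) by simp
  ultimately show ?case
    using Suc.IH[of "\<lambda>x. frechet_derivative f (at x) v" "\<lambda>x. frechet_derivative g (at x) v" for v]
    unfolding Ck_on.simps by metis
qed

text \<open>Uniqueness of the derivative allows any explicitly known derivative to replace the
  choice made by \<open>frechet_derivative\<close>; most smoothness inductions below go through this
  rule.\<close>

lemma Ck_on_SucI:
  assumes "open S" "\<And>x. x \<in> S \<Longrightarrow> (f has_derivative f' x) (at x)"
    "\<And>v. Ck_on n (\<lambda>x. f' x v) S"
  shows "Ck_on (Suc n) f S"
proof -
  have "frechet_derivative f (at x) = f' x" if "x \<in> S" for x
    using assms(2)[OF that] frechet_derivative_at by metis
  then show ?thesis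
    using assms Ck_on_cong[OF assms(1) _ assms(3)] by (auto simp: differentiable_def)
qed

lemma Ck_on_local:
  assumes "\<And>x. x \<in> S \<Longrightarrow> \<exists>T. open T \<and> x \<in> T \<and> Ck_on n f T"
  shows "Ck_on n f S"
  using assms
proof (induction n arbitrary: f)
  case 0
  then have "isCont f x" if "x \<in> S" for x
    using that continuous_on_eq_continuous_at by fastforce
  then show ?case
    by (simp add: continuous_at_imp_continuous_on)
next
  case (Suc n)
  then show ?case
    by (metis Ck_on.simps(2))
qed

lemma Ck_on_const: "Ck_on n (\<lambda>x. c) S"
  by (induction n arbitrary: c) simp_all

lemma Ck_on_id:
  assumes "open S"
  shows "Ck_on n (\<lambda>x. x) S"
proof (cases n)
  case (Suc m)
  show ?thesis
    unfolding Suc by (rule Ck_on_SucI[where f' = "\<lambda>x v. v"]) (simp_all add: Ck_on_const assms)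
qed simp

lemma Ck_on_bounded_linear:
  assumes "bounded_linear L" "open S" "Ck_on n f S"
  shows "Ck_on n (\<lambda>x. L (f x)) S"
  using assms(3)
proof (induction n arbitrary: f)
  case 0
  then show ?case
    using assms(1) by (simp add: bounded_linear.continuous_on)
next
  case (Suc n)
  show ?case
  proof (rule Ck_on_SucI[OF assms(2), where f' = "\<lambda>x v. L (frechet_derivative f (at x) v)"])
    show "((\<lambda>x. L (f x)) has_derivative (\<lambda>v. L (frechet_derivative f (at x) v))) (at x)"
      if "x \<in> S" for x
      using bounded_linear.has_derivative[OF assms(1)] Ck_on_has_derivative[OF Suc.prems that] .
  qed (use Suc in simp)
qed

lemma Ck_on_add:
  assumes "open S" "Ck_on n f S" "Ck_on n g S"
  shows "Ck_on n (\<lambda>x. f x + g x) S"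
  using assms(2,3)
proof (induction n arbitrary: f g)
  case 0
  then show ?case
    by (simp add: continuous_on_add)
next
  case (Suc n)
  show ?case
  proof (rule Ck_on_SucI[OF assms(1)])
    show "((\<lambda>x. f x + g x) has_derivative
        (\<lambda>v. frechet_derivative f (at x) v + frechet_derivative g (at x) v)) (at x)" if "x \<in> S" for x
      using has_derivative_add[OF Ck_on_has_derivative[OF Suc.prems(1) that]
          Ck_on_has_derivative[OF Suc.prems(2) that]] .
  qed (use Suc in simp)
qed

lemma Ck_on_sum:
  assumes "open S" "finite A" "\<And>a. a \<in> A \<Longrightarrow> Ck_on n (f a) S"
  shows "Ck_on n (\<lambda>x. \<Sum>a\<in>A. f a x) S"
  using assms(2,3) by (induction A) (simp_all add: Ck_on_const Ck_on_add assms(1))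

lemma Ck_on_bounded_bilinear:
  assumes "bounded_bilinear B" "open S" "Ck_on n f S" "Ck_on n g S"
  shows "Ck_on n (\<lambda>x. B (f x) (g x)) S"
  using assms(3,4)
proof (induction n arbitrary: f g)
  case 0
  then show ?case
    using assms(1) by (simp add: bounded_bilinear.continuous_on)
next
  case (Suc n)
  show ?case
  proof (rule Ck_on_SucI[OF assms(2)])
    show "((\<lambda>x. B (f x) (g x)) has_derivative
        (\<lambda>v. B (f x) (frechet_derivative g (at x) v) + B (frechet_derivative f (at x) v) (g x))) (at x)"
      if "x \<in> S" for x
      using bounded_bilinear.FDERIV[OF assms(1) Ck_on_has_derivative[OF Suc.prems(1) that]
          Ck_on_has_derivative[OF Suc.prems(2) that]] .
    \<comment> \<open>The product rule pairs each derivative with an undifferentiated factor, which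
      therefore is needed at order \<open>n\<close> only.\<close>
    show "Ck_on n (\<lambda>x. B (f x) (frechet_derivative g (at x) v) +
        B (frechet_derivative f (at x) v) (g x)) S" for v
      using Suc.prems Ck_on_SucD[OF Suc.prems(1)] Ck_on_SucD[OF Suc.prems(2)]
      by (simp add: Ck_on_add[OF assms(2)] Suc.IH)
  qed
qed

text \<open>\<open>Ck_on\<close> controls derivatives in constant directions only; expanding
  \<open>u x\<close> in the standard basis reduces a varying direction to these. The separate base
  point \<open>g x\<close> serves the chain rule, and the identity in place of \<open>g\<close>
  serves derivatives of smooth maps.\<close>

lemma Ck_on_frechet_derivative:
  fixes f :: "'a::euclidean_space \<Rightarrow> 'b::real_normed_vector"
  assumes "open S" "open T" "g ` T \<subseteq> S" "\<And>x. x \<in> S \<Longrightarrow> f differentiable (at x)"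
    "\<And>i. Ck_on n (\<lambda>x. frechet_derivative f (at (g x)) i) T" "Ck_on n u T"
  shows "Ck_on n (\<lambda>x. frechet_derivative f (at (g x)) (u x)) T"
proof -
  have "Ck_on n (\<lambda>x. \<Sum>i\<in>Basis. (u x \<bullet> i) *\<^sub>R frechet_derivative f (at (g x)) i) T"
    by (intro Ck_on_sum assms finite_Basis Ck_on_bounded_bilinear[OF bounded_bilinear_scaleR]
        Ck_on_bounded_linear[OF bounded_linear_inner_left])
  moreover have "(\<Sum>i\<in>Basis. (u x \<bullet> i) *\<^sub>R frechet_derivative f (at (g x)) i) =
      frechet_derivative f (at (g x)) (u x)" if "x \<in> T" for x
  proof -
    have "linear (frechet_derivative f (at (g x)))"
      using assms(3,4) that by (auto intro!: linear_frechet_derivative)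
    then have "(\<Sum>i\<in>Basis. (u x \<bullet> i) *\<^sub>R frechet_derivative f (at (g x)) i) =
        frechet_derivative f (at (g x)) (\<Sum>i\<in>Basis. (u x \<bullet> i) *\<^sub>R i)"
      by (simp add: linear_sum linear_scale)
    then show ?thesis
      by (simp add: euclidean_representation)
  qed
  ultimately show ?thesis
    by (rule Ck_on_cong[OF assms(2), rotated]) simp
qed

lemma Ck_on_compose:
  fixes g :: "'c::euclidean_space \<Rightarrow> 'a::euclidean_space"
  assumes "open S" "open T" "g ` T \<subseteq> S" "Ck_on n f S" "Ck_on n g T"
  shows "Ck_on n (\<lambda>x. f (g x)) T"
  using assms(4,5)
proof (induction n arbitrary: f)
  case 0
  then show ?case
    using assms(3) by (auto intro: continuous_on_compose2)
next
  case (Suc n)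
  have Cg: "Ck_on n g T"
    using Ck_on_SucD[OF Suc.prems(2)] .
  show ?case
  proof (rule Ck_on_SucI[OF assms(2)])
    show "((\<lambda>x. f (g x)) has_derivative
        (\<lambda>v. frechet_derivative f (at (g x)) (frechet_derivative g (at x) v))) (at x)" if "x \<in> T" for x
      using has_derivative_compose[OF Ck_on_has_derivative[OF Suc.prems(2) that]
          Ck_on_has_derivative[OF Suc.prems(1), of "g x"]] assms(3) that by blast
    show "Ck_on n (\<lambda>x. frechet_derivative f (at (g x)) (frechet_derivative g (at x) v)) T" for v
    proof (rule Ck_on_frechet_derivative[OF assms(1-3)])
      show "Ck_on n (\<lambda>x. frechet_derivative f (at (g x)) i) T" for i
        using Suc.IH[of "\<lambda>y. frechet_derivative f (at y) i"] Suc.prems(1) Cg by simp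
    qed (use Suc.prems in auto)
  qed
qed

text \<open>The derivative of the reciprocal is a product of reciprocals and the derivative of
  \<open>f\<close>, so regularity of order \<open>n\<close> of the reciprocal yields order
  \<open>n + 1\<close>.\<close>

lemma Ck_on_inverse:
  fixes f :: "'a::euclidean_space \<Rightarrow> real"
  assumes "open S" "\<And>x. x \<in> S \<Longrightarrow> f x \<noteq> 0" "Ck_on n f S"
  shows "Ck_on n (\<lambda>x. inverse (f x)) S"
  using assms(3)
proof (induction n)
  case 0
  then show ?case
    using assms(2) by (auto intro!: continuous_intros)
next
  case (Suc n)
  have C: "Ck_on n (\<lambda>x. inverse (f x)) S"
    using Suc.IH Ck_on_SucD[OF Suc.prems] by blast
  show ?case
  proof (rule Ck_on_SucI[OF assms(1)])
    show "((\<lambda>x. inverse (f x)) has_derivative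
        (\<lambda>v. - (inverse (f x) * frechet_derivative f (at x) v * inverse (f x)))) (at x)" if "x \<in> S" for x
      using Deriv.has_derivative_inverse[OF assms(2)[OF that] Ck_on_has_derivative[OF Suc.prems that]] .
    show "Ck_on n (\<lambda>x. - (inverse (f x) * frechet_derivative f (at x) v * inverse (f x))) S" for v
      using Suc.prems C
      by (intro Ck_on_bounded_linear[OF bounded_linear_minus[OF bounded_linear_ident]]
          Ck_on_bounded_bilinear[OF bounded_bilinear_mult] assms(1)) auto
  qed
qed

lemma smooth_on_subset: "smooth_on f S \<Longrightarrow> T \<subseteq> S \<Longrightarrow> smooth_on f T"
  unfolding smooth_on_def by (intro allI, rule Ck_on_subset[of _ f S]) simp_all

lemma smooth_on_cong:
  "open S \<Longrightarrow> (\<And>x. x \<in> S \<Longrightarrow> f x = g x) \<Longrightarrow> smooth_on f S \<Longrightarrow> smooth_on g S"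
  unfolding smooth_on_def by (intro allI, rule Ck_on_cong[of S f g]) simp_all

lemma smooth_on_local:
  "(\<And>x. x \<in> S \<Longrightarrow> \<exists>T. open T \<and> x \<in> T \<and> smooth_on f T) \<Longrightarrow> smooth_on f S"
  unfolding smooth_on_def by (intro allI Ck_on_local) metis

lemma smooth_on_const: "smooth_on (\<lambda>x. c) S"
  by (simp add: smooth_on_def Ck_on_const)

lemma smooth_on_id: "open S \<Longrightarrow> smooth_on (\<lambda>x. x) S"
  by (simp add: smooth_on_def Ck_on_id)

lemma smooth_on_bounded_linear:
  "bounded_linear L \<Longrightarrow> open S \<Longrightarrow> smooth_on f S \<Longrightarrow> smooth_on (\<lambda>x. L (f x)) S"
  by (simp add: smooth_on_def Ck_on_bounded_linear)

lemma smooth_on_add: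
  "open S \<Longrightarrow> smooth_on f S \<Longrightarrow> smooth_on g S \<Longrightarrow> smooth_on (\<lambda>x. f x + g x) S"
  by (simp add: smooth_on_def Ck_on_add)

lemma smooth_on_bounded_bilinear:
  "bounded_bilinear B \<Longrightarrow> open S \<Longrightarrow> smooth_on f S \<Longrightarrow> smooth_on g S \<Longrightarrow>
    smooth_on (\<lambda>x. B (f x) (g x)) S"
  by (simp add: smooth_on_def Ck_on_bounded_bilinear)

lemma smooth_on_compose:
  fixes g :: "'c::euclidean_space \<Rightarrow> 'a::euclidean_space"
  shows "open S \<Longrightarrow> open T \<Longrightarrow> g ` T \<subseteq> S \<Longrightarrow> smooth_on f S \<Longrightarrow> smooth_on g T \<Longrightarrow>
    smooth_on (\<lambda>x. f (g x)) T"
  by (simp add: smooth_on_def Ck_on_compose)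

lemma smooth_on_inverse:
  fixes f :: "'a::euclidean_space \<Rightarrow> real"
  shows "open S \<Longrightarrow> (\<And>x. x \<in> S \<Longrightarrow> f x \<noteq> 0) \<Longrightarrow> smooth_on f S \<Longrightarrow>
    smooth_on (\<lambda>x. inverse (f x)) S"
  by (simp add: smooth_on_def Ck_on_inverse)

lemma smooth_on_imp_differentiable: "smooth_on f S \<Longrightarrow> x \<in> S \<Longrightarrow> f differentiable (at x)"
  unfolding smooth_on_def by (drule spec[of _ "Suc 0"]) simp

lemma smooth_on_has_derivative:
  "smooth_on f S \<Longrightarrow> x \<in> S \<Longrightarrow> (f has_derivative frechet_derivative f (at x)) (at x)"
  using smooth_on_imp_differentiable frechet_derivative_works by blast

lemma smooth_on_imp_continuous_on: "smooth_on f S \<Longrightarrow> continuous_on S f"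
  unfolding smooth_on_def by (drule spec[of _ 0]) simp

lemma smooth_on_frechet_derivative_const:
  "smooth_on f S \<Longrightarrow> smooth_on (\<lambda>x. frechet_derivative f (at x) v) S"
  unfolding smooth_on_def
proof
  fix n
  assume "\<forall>n. Ck_on n f S"
  then have "Ck_on (Suc n) f S"
    by blast
  then show "Ck_on n (\<lambda>x. frechet_derivative f (at x) v) S"
    by simp
qed

lemma smooth_on_frechet_derivative:
  assumes "open S" "smooth_on f S" "smooth_on u S"
  shows "smooth_on (\<lambda>x. frechet_derivative f (at x) (u x)) S"
  unfolding smooth_on_def
proof
  fix n
  show "Ck_on n (\<lambda>x. frechet_derivative f (at x) (u x)) S"
  proof (rule Ck_on_frechet_derivative[OF assms(1,1)])
    show "Ck_on n (\<lambda>x. frechet_derivative f (at x) i) S" for i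
      using smooth_on_frechet_derivative_const[OF assms(2)] by (simp add: smooth_on_def)
    show "Ck_on n u S"
      using assms(3) by (simp add: smooth_on_def)
  qed (use smooth_on_imp_differentiable[OF assms(2)] in auto)
qed

section \<open>Second derivatives and their symmetry\<close>

lemma frechet_derivative_frechet_derivative:
  assumes "open S" "smooth_on f S" "smooth_on u S" "x \<in> S"
  shows "frechet_derivative (\<lambda>x. frechet_derivative f (at x) (u x)) (at x) w =
    frechet_derivative (\<lambda>y. frechet_derivative f (at y) (u x)) (at x) w +
    frechet_derivative f (at x) (frechet_derivative u (at x) w)"
proof -
  let ?D = "\<lambda>i y. frechet_derivative f (at y) i"
  have lin: "linear (frechet_derivative f (at y))" if "y \<in> S" for y
    using that smooth_on_imp_differentiable[OF assms(2)] by (simp add: linear_frechet_derivative)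
  have eq: "frechet_derivative f (at y) v = (\<Sum>i\<in>Basis. (v \<bullet> i) *\<^sub>R ?D i y)" if "y \<in> S" for y v
  proof -
    have "frechet_derivative f (at y) (\<Sum>i\<in>Basis. (v \<bullet> i) *\<^sub>R i) = (\<Sum>i\<in>Basis. (v \<bullet> i) *\<^sub>R ?D i y)"
      using lin[OF that] by (simp add: linear_sum linear_scale)
    then show ?thesis
      by (simp add: euclidean_representation)
  qed
  have dD: "(?D i has_derivative frechet_derivative (?D i) (at x)) (at x)" for i
    using smooth_on_has_derivative[OF smooth_on_frechet_derivative_const[OF assms(2)] assms(4)] .
  have du: "(u has_derivative frechet_derivative u (at x)) (at x)"
    using smooth_on_has_derivative[OF assms(3,4)] .
  \<comment> \<open>In the basis, the derivative of \<open>f\<close> along \<open>u y\<close> is a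
    finite sum of products of coordinates of \<open>u\<close> with partial derivatives, so the
    ordinary product rule applies without operator-valued derivatives.\<close>
  have "((\<lambda>y. \<Sum>i\<in>Basis. (u y \<bullet> i) *\<^sub>R ?D i y) has_derivative
      (\<lambda>w. \<Sum>i\<in>Basis. (u x \<bullet> i) *\<^sub>R frechet_derivative (?D i) (at x) w +
        (frechet_derivative u (at x) w \<bullet> i) *\<^sub>R ?D i x)) (at x)"
    by (intro has_derivative_sum has_derivative_scaleR dD has_derivative_inner_left du)
  then have "((\<lambda>y. frechet_derivative f (at y) (u y)) has_derivative
      (\<lambda>w. \<Sum>i\<in>Basis. (u x \<bullet> i) *\<^sub>R frechet_derivative (?D i) (at x) w +
        (frechet_derivative u (at x) w \<bullet> i) *\<^sub>R ?D i x)) (at x)"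
    by (rule has_derivative_transform_within_open[OF _ assms(1,4)]) (rule eq[symmetric])
  then have 1: "frechet_derivative (\<lambda>y. frechet_derivative f (at y) (u y)) (at x) =
      (\<lambda>w. \<Sum>i\<in>Basis. (u x \<bullet> i) *\<^sub>R frechet_derivative (?D i) (at x) w +
        (frechet_derivative u (at x) w \<bullet> i) *\<^sub>R ?D i x)"
    by (rule frechet_derivative_at[symmetric])
  have "((\<lambda>y. \<Sum>i\<in>Basis. (u x \<bullet> i) *\<^sub>R ?D i y) has_derivative
      (\<lambda>w. \<Sum>i\<in>Basis. (u x \<bullet> i) *\<^sub>R frechet_derivative (?D i) (at x) w)) (at x)"
    by (intro has_derivative_sum has_derivative_scaleR_right dD)
  then have "((\<lambda>y. frechet_derivative f (at y) (u x)) has_derivative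
      (\<lambda>w. \<Sum>i\<in>Basis. (u x \<bullet> i) *\<^sub>R frechet_derivative (?D i) (at x) w)) (at x)"
    by (rule has_derivative_transform_within_open[OF _ assms(1,4)]) (rule eq[symmetric])
  then have 2: "frechet_derivative (\<lambda>y. frechet_derivative f (at y) (u x)) (at x) =
      (\<lambda>w. \<Sum>i\<in>Basis. (u x \<bullet> i) *\<^sub>R frechet_derivative (?D i) (at x) w)"
    by (rule frechet_derivative_at[symmetric])
  show ?thesis
    unfolding 1 2 eq[OF assms(4), of "frechet_derivative u (at x) w"] by (simp add: sum.distrib)
qed

text \<open>The mean value theorem is applied along \<open>u\<close> and then along
  \<open>v\<close>. The second difference on the left is symmetric in \<open>u\<close> and
  \<open>v\<close>, whereas the right side is a mixed derivative in a fixed order; this tension is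
  what the symmetry of second derivatives exploits.\<close>

lemma second_difference_mean_value:
  fixes f :: "'a::euclidean_space \<Rightarrow> real"
  assumes "open S" "smooth_on f S" "0 < t"
    and S: "\<And>a b. a \<in> {0..t} \<Longrightarrow> b \<in> {0..t} \<Longrightarrow> x + a *\<^sub>R u + b *\<^sub>R v \<in> S"
  obtains a b where "a \<in> {0..t}" "b \<in> {0..t}"
    "f (x + t *\<^sub>R u + t *\<^sub>R v) - f (x + t *\<^sub>R u) - f (x + t *\<^sub>R v) + f x =
     t * t * frechet_derivative (\<lambda>y. frechet_derivative f (at y) u) (at (x + a *\<^sub>R u + b *\<^sub>R v)) v"
proof -
  let ?D = "\<lambda>y. frechet_derivative f (at y) u"
  have sD: "smooth_on ?D S"
    using smooth_on_frechet_derivative_const[OF assms(2)] .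
  have der: "((\<lambda>s. F (p + s *\<^sub>R q)) has_real_derivative frechet_derivative F (at (p + s *\<^sub>R q)) q) (at s)"
    if "smooth_on F S" "p + s *\<^sub>R q \<in> S" for F :: "'a \<Rightarrow> real" and p q s
  proof -
    have F: "(F has_derivative frechet_derivative F (at (p + s *\<^sub>R q))) (at (p + s *\<^sub>R q))"
      using smooth_on_has_derivative that by blast
    have "((\<lambda>s. F (p + s *\<^sub>R q)) has_derivative
        (\<lambda>r. frechet_derivative F (at (p + s *\<^sub>R q)) (r *\<^sub>R q))) (at s)"
      by (rule has_derivative_compose[of "\<lambda>s. p + s *\<^sub>R q" "\<lambda>r. r *\<^sub>R q" s UNIV, OF _ F])
        (auto intro!: derivative_eq_intros)
    moreover have "frechet_derivative F (at (p + s *\<^sub>R q)) (r *\<^sub>R q) =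
        frechet_derivative F (at (p + s *\<^sub>R q)) q * r" for r
      using has_derivative_linear[OF F] by (simp add: linear_scale)
    ultimately show ?thesis
      by (simp add: has_field_derivative_def)
  qed
  \<comment> \<open>The second difference is the increment on the interval from 0 to
    \<open>t\<close> of \<open>f (x + t v + s u) - f (x + s u)\<close> as a function of
    \<open>s\<close>.\<close>
  have "\<exists>a>0. a < t \<and> (f (x + t *\<^sub>R v + t *\<^sub>R u) - f (x + t *\<^sub>R u)) -
      (f (x + t *\<^sub>R v + 0 *\<^sub>R u) - f (x + 0 *\<^sub>R u)) =
      (t - 0) * (?D (x + t *\<^sub>R v + a *\<^sub>R u) - ?D (x + a *\<^sub>R u))"
  proof (rule MVT2[OF assms(3)])
    fix s :: real assume s: "0 \<le> s" "s \<le> t"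
    have "x + t *\<^sub>R v + s *\<^sub>R u \<in> S" "x + s *\<^sub>R u \<in> S"
      using S[of s t] S[of s 0] s by (auto simp: algebra_simps)
    then show "((\<lambda>s. f (x + t *\<^sub>R v + s *\<^sub>R u) - f (x + s *\<^sub>R u)) has_real_derivative
        ?D (x + t *\<^sub>R v + s *\<^sub>R u) - ?D (x + s *\<^sub>R u)) (at s)"
      by (intro DERIV_diff der assms(2))
  qed
  then obtain a where a: "0 < a" "a < t"
    "f (x + t *\<^sub>R u + t *\<^sub>R v) - f (x + t *\<^sub>R u) - f (x + t *\<^sub>R v) + f x =
     t * (?D (x + a *\<^sub>R u + t *\<^sub>R v) - ?D (x + a *\<^sub>R u))"
    by (auto simp: algebra_simps)
  have "\<exists>b>0. b < t \<and> ?D (x + a *\<^sub>R u + t *\<^sub>R v) - ?D (x + a *\<^sub>R u + 0 *\<^sub>R v) =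
      (t - 0) * frechet_derivative ?D (at (x + a *\<^sub>R u + b *\<^sub>R v)) v"
    by (rule MVT2[OF assms(3)]) (use S a in \<open>auto intro!: der sD\<close>)
  then obtain b where "0 < b" "b < t" "?D (x + a *\<^sub>R u + t *\<^sub>R v) - ?D (x + a *\<^sub>R u) =
      t * frechet_derivative ?D (at (x + a *\<^sub>R u + b *\<^sub>R v)) v"
    by auto
  then show ?thesis
    using a that[of a b] by auto
qed

text \<open>Reading one second difference in both orders gives two points near \<open>x\<close>, one
  for each mixed derivative, where these take equal values; continuity transfers the equality to
  \<open>x\<close>.\<close>

lemma frechet_derivative_symmetric:
  fixes f :: "'a::euclidean_space \<Rightarrow> real"
  assumes "open S" "smooth_on f S" "x \<in> S"
  shows "frechet_derivative (\<lambda>y. frechet_derivative f (at y) u) (at x) v =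
    frechet_derivative (\<lambda>y. frechet_derivative f (at y) v) (at x) u" (is "?P x = ?Q x")
proof (rule ccontr)
  let ?P = "\<lambda>x. frechet_derivative (\<lambda>y. frechet_derivative f (at y) u) (at x) v"
  let ?Q = "\<lambda>x. frechet_derivative (\<lambda>y. frechet_derivative f (at y) v) (at x) u"
  assume "?P x \<noteq> ?Q x"
  \<comment> \<open>Half the gap: values closer than \<open>?e\<close> to \<open>?P x\<close> and to
    \<open>?Q x\<close> respectively cannot coincide.\<close>
  then have e: "0 < \<bar>?P x - ?Q x\<bar> / 2" (is "0 < ?e")
    by simp
  have cont: "isCont ?P x" "isCont ?Q x"
    using assms by (auto simp: continuous_on_eq_continuous_at[symmetric]
      intro!: continuous_on_interior[of S] smooth_on_imp_continuous_on
        smooth_on_frechet_derivative_const interior_open[THEN equalityD2, THEN subsetD])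
  obtain d1 where d1: "d1 > 0" "\<And>y. dist y x < d1 \<Longrightarrow> dist (?P y) (?P x) < ?e"
    using cont(1) e unfolding continuous_at_eps_delta by blast
  obtain d2 where d2: "d2 > 0" "\<And>y. dist y x < d2 \<Longrightarrow> dist (?Q y) (?Q x) < ?e"
    using cont(2) e unfolding continuous_at_eps_delta by blast
  obtain d3 where d3: "d3 > 0" "ball x d3 \<subseteq> S"
    using assms(1,3) openE by blast
  define d where "d = min d1 (min d2 d3)"
  \<comment> \<open>The parallelogram spanned by \<open>t u\<close> and \<open>t v\<close> at
    \<open>x\<close> stays within distance \<open>d\<close>; the summand 1 keeps the denominator
    positive when both vectors vanish.\<close>
  define t where "t = d / (norm u + norm v + 1)"
  have pos: "0 < norm u + norm v + 1"
    by (smt (verit) norm_ge_zero)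
  have "d > 0"
    using d1 d2 d3 by (simp add: d_def)
  then have t: "t > 0"
    using pos by (simp add: t_def)
  have near: "dist (x + a *\<^sub>R u + b *\<^sub>R v) x < d" if "a \<in> {0..t}" "b \<in> {0..t}" for a b
  proof -
    have "dist (x + a *\<^sub>R u + b *\<^sub>R v) x \<le> norm (a *\<^sub>R u) + norm (b *\<^sub>R v)"
      using norm_triangle_ineq[of "a *\<^sub>R u" "b *\<^sub>R v"]
      by (simp add: dist_norm add.assoc del: norm_scaleR)
    also have "\<dots> \<le> t * norm u + t * norm v"
      using that by (intro add_mono) (auto intro!: mult_right_mono)
    also have "\<dots> < t * (norm u + norm v + 1)"
      using t by (simp add: algebra_simps)
    also have "\<dots> = d"
      using pos by (simp add: t_def)
    finally show ?thesis .
  qed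
  have nearS: "x + a *\<^sub>R u + b *\<^sub>R v \<in> S" if "a \<in> {0..t}" "b \<in> {0..t}" for a b
    using near[OF that] d3(2) by (auto simp: d_def dist_commute subset_iff)
  obtain a b where ab: "a \<in> {0..t}" "b \<in> {0..t}"
    "f (x + t *\<^sub>R u + t *\<^sub>R v) - f (x + t *\<^sub>R u) - f (x + t *\<^sub>R v) + f x =
     t * t * ?P (x + a *\<^sub>R u + b *\<^sub>R v)"
    by (rule second_difference_mean_value[OF assms(1,2) t nearS])
  have nearS': "x + b *\<^sub>R v + a *\<^sub>R u \<in> S" if "b \<in> {0..t}" "a \<in> {0..t}" for a b
    using nearS[OF that(2,1)] by (simp add: algebra_simps)
  obtain b' a' where ab': "b' \<in> {0..t}" "a' \<in> {0..t}"
    "f (x + t *\<^sub>R v + t *\<^sub>R u) - f (x + t *\<^sub>R v) - f (x + t *\<^sub>R u) + f x =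
     t * t * ?Q (x + b' *\<^sub>R v + a' *\<^sub>R u)"
    by (rule second_difference_mean_value[OF assms(1,2) t nearS'])
  have "t * t * ?P (x + a *\<^sub>R u + b *\<^sub>R v) = t * t * ?Q (x + b' *\<^sub>R v + a' *\<^sub>R u)"
    using ab(3) ab'(3) by (simp add: algebra_simps)
  then have "?P (x + a *\<^sub>R u + b *\<^sub>R v) = ?Q (x + a' *\<^sub>R u + b' *\<^sub>R v)"
    using t by (simp add: algebra_simps)
  moreover have "dist (?P (x + a *\<^sub>R u + b *\<^sub>R v)) (?P x) < ?e"
    using near[OF ab(1,2)] by (intro d1) (simp add: d_def)
  moreover have "dist (?Q (x + a' *\<^sub>R u + b' *\<^sub>R v)) (?Q x) < ?e"
    using near[OF ab'(2,1)] by (intro d2) (simp add: d_def)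
  ultimately show False
    unfolding dist_real_def by argo
qed

subsection \<open>A bump function\<close>

text \<open>With a polynomial factor the family is closed under differentiation, so smoothness is an induction.\<close>

definition flat :: "real poly \<Rightarrow> real \<Rightarrow> real" where
  "flat p t = (if t > 0 then poly p (1 / t) * exp (- (1 / t)) else 0)"

lemma poly_mult_exp_tendsto_0: "((\<lambda>u. poly p u * exp (- u)) \<longlongrightarrow> 0) at_top" for p :: "real poly"
proof -
  have "((\<lambda>u. \<Sum>i\<le>degree p. coeff p i * (u ^ i / exp u)) \<longlongrightarrow> (\<Sum>i\<le>degree p. coeff p i * 0)) at_top"
    by (intro tendsto_sum tendsto_mult tendsto_const tendsto_power_div_exp_0)
  then show ?thesis
    by (simp add: poly_altdef sum_distrib_right exp_minus divide_inverse mult.assoc)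
qed

lemma flat_tendsto_0: "(flat p \<longlongrightarrow> 0) (at 0)"
proof -
  have "((\<lambda>t. poly p (inverse t) * exp (- inverse t)) \<longlongrightarrow> 0) (at_right 0)"
    using filterlim_compose[OF poly_mult_exp_tendsto_0 filterlim_inverse_at_top_right] .
  then have "(flat p \<longlongrightarrow> 0) (at_right 0)"
    by (rule Lim_transform_eventually)
      (auto simp: flat_def eventually_at_right_less inverse_eq_divide intro!: eventually_at_rightI[of 0 1])
  moreover have "(flat p \<longlongrightarrow> 0) (at_left 0)"
    by (rule Lim_transform_eventually[OF tendsto_const])
      (auto simp: flat_def intro!: eventually_at_leftI[of "-1"])
  ultimately show ?thesis
    by (simp add: filterlim_split_at)
qed

text \<open>With \<open>u = 1 / t\<close> one has \<open>du/dt = - u^2\<close>, so the derivative of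
  \<open>p(u) exp (- u)\<close> is \<open>u^2 (p(u) - p'(u)) exp (- u)\<close>; the polynomial
  \<open>[:0, 0, 1:]\<close> is the factor \<open>u^2\<close>.\<close>

lemma flat_has_derivative:
  "(flat p has_real_derivative flat ([:0, 0, 1:] * (p - pderiv p)) t) (at t)"
proof (cases t "0 :: real" rule: linorder_cases)
  case less
  have "(flat p has_real_derivative 0) (at t) \<longleftrightarrow> ((\<lambda>_. 0) has_real_derivative 0) (at t)"
    by (rule DERIV_cong_ev) (use less in \<open>auto simp: flat_def intro!: eventually_nhds_in_open
      eventually_mono[OF eventually_nhds_in_open[of "{..<0}" t]]\<close>)
  then show ?thesis
    using less by (simp add: flat_def)
next
  case equal
  \<comment> \<open>The difference quotient at 0 is again of the form \<open>flat\<close>, the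
    factor \<open>1 / s\<close> being absorbed into the polynomial.\<close>
  have "((\<lambda>s. flat p s / s) \<longlongrightarrow> 0) (at 0)"
  proof (rule Lim_transform_eventually[OF flat_tendsto_0[of "[:0, 1:] * p"]])
    show "\<forall>\<^sub>F x in at 0. flat ([:0, 1:] * p) x = flat p x / x"
      by (auto simp: flat_def eventually_at_filter)
  qed
  then show ?thesis
    using equal by (simp add: has_field_derivative_iff flat_def)
next
  case greater
  have "((\<lambda>t. poly p (1 / t) * exp (- (1 / t))) has_real_derivative
      poly (pderiv p) (1 / t) * (- (1 / (t * t))) * exp (- (1 / t)) +
      poly p (1 / t) * (exp (- (1 / t)) * (1 / (t * t)))) (at t)"
    using greater by (auto intro!: derivative_eq_intros poly_DERIV[THEN DERIV_chain2])
  moreover have "poly (pderiv p) (1 / t) * (- (1 / (t * t))) * exp (- (1 / t)) +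
      poly p (1 / t) * (exp (- (1 / t)) * (1 / (t * t))) = flat ([:0, 0, 1:] * (p - pderiv p)) t"
    using greater by (simp add: flat_def field_simps)
  moreover have "(flat p has_real_derivative D) (at t) \<longleftrightarrow>
      ((\<lambda>t. poly p (1 / t) * exp (- (1 / t))) has_real_derivative D) (at t)" for D
    by (rule DERIV_cong_ev) (use greater in \<open>auto simp: flat_def
      intro!: eventually_mono[OF eventually_nhds_in_open[of "{0<..}" t]]\<close>)
  ultimately show ?thesis
    by simp
qed

lemma smooth_on_flat: "smooth_on (flat p) UNIV"
  unfolding smooth_on_def
proof
  fix n show "Ck_on n (flat p) UNIV"
  proof (induction n arbitrary: p)
    case 0
    have "isCont (flat p) t" for t
      using flat_has_derivative DERIV_isCont by blast
    then show ?case
      by (simp add: continuous_at_imp_continuous_on)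
  next
    case (Suc n)
    show ?case
    proof (rule Ck_on_SucI)
      show "(flat p has_derivative (*) (flat ([:0, 0, 1:] * (p - pderiv p)) t)) (at t)" for t
        using flat_has_derivative by (simp add: has_field_derivative_def)
      show "Ck_on n (\<lambda>t. flat ([:0, 0, 1:] * (p - pderiv p)) t * v) UNIV" for v
        by (intro Ck_on_bounded_bilinear[OF bounded_bilinear_mult] Suc Ck_on_const open_UNIV)
    qed simp
  qed
qed

lemma flat_1_pos: "t > 0 \<Longrightarrow> flat 1 t > 0"
  by (simp add: flat_def)

lemma flat_nonneg: "flat 1 t \<ge> 0"
  by (simp add: flat_def)

text \<open>The function is \<open>A / (A + B)\<close>, where \<open>A\<close> is positive exactly
  inside radius \<open>2 * r\<close> and \<open>B\<close> exactly outside radius \<open>r\<close>,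
  so that they never vanish together.\<close>

lemma smooth_bump_exists:
  fixes x :: "'a::euclidean_space"
  assumes "r > 0"
  obtains b :: "'a \<Rightarrow> real"
  where "smooth_on b UNIV" "\<And>y. dist y x \<le> r \<Longrightarrow> b y = 1" "\<And>y. dist y x \<ge> 2 * r \<Longrightarrow> b y = 0"
proof -
  \<comment> \<open>The squared distance is smooth everywhere, the distance itself fails to be so at
    \<open>x\<close>.\<close>
  define s where "s y = (y - x) \<bullet> (y - x)" for y
  have s: "s y = (dist y x)\<^sup>2" for y
    by (simp add: s_def dist_norm power2_norm_eq_inner)
  define A where "A y = flat 1 (4 * r\<^sup>2 - s y)" for y
  define B where "B y = flat 1 (s y - r\<^sup>2)" for y
  have sm_s: "smooth_on s UNIV"
    unfolding s_def diff_conv_add_uminus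
    by (intro smooth_on_bounded_bilinear[OF bounded_bilinear_inner] smooth_on_add smooth_on_id
        smooth_on_const open_UNIV)
  have sm: "smooth_on A UNIV" "smooth_on B UNIV"
    unfolding A_def B_def diff_conv_add_uminus
    by (intro smooth_on_compose[OF open_UNIV open_UNIV _ smooth_on_flat] subset_UNIV smooth_on_add
        smooth_on_const open_UNIV sm_s
        smooth_on_bounded_linear[OF bounded_linear_minus[OF bounded_linear_ident]])+
  have r2: "r\<^sup>2 > 0"
    using assms by simp
  have pos: "A y + B y > 0" for y
  proof (cases "s y < 4 * r\<^sup>2")
    case True
    then show ?thesis
      using flat_1_pos[of "4 * r\<^sup>2 - s y"] flat_nonneg[of "s y - r\<^sup>2"] by (simp add: A_def B_def)
  next
    case False
    then show ?thesis
      using flat_1_pos[of "s y - r\<^sup>2"] flat_nonneg[of "4 * r\<^sup>2 - s y"] r2 by (simp add: A_def B_def)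
  qed
  show ?thesis
  proof (rule that[of "\<lambda>y. A y * inverse (A y + B y)"])
    show "smooth_on (\<lambda>y. A y * inverse (A y + B y)) UNIV"
      using pos by (intro smooth_on_bounded_bilinear[OF bounded_bilinear_mult] smooth_on_inverse
        smooth_on_add sm open_UNIV) (metis less_irrefl)
    show "A y * inverse (A y + B y) = 1" if "dist y x \<le> r" for y
    proof -
      have "s y \<le> r\<^sup>2"
        using that by (simp add: s power_mono)
      then have "B y = 0"
        by (simp add: B_def flat_def)
      then show ?thesis
        using pos[of y] by simp
    qed
    show "A y * inverse (A y + B y) = 0" if "dist y x \<ge> 2 * r" for y
    proof -
      have "(2 * r)\<^sup>2 \<le> s y"
        unfolding s using that assms by (intro power_mono) auto
      then have "A y = 0"
        by (simp add: A_def flat_def power2_eq_square)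
      then show ?thesis
        by simp
    qed
  qed
qed

section \<open>Smooth functions and vector fields on manifolds\<close>

text \<open>Coordinate maps and components of fields live on chart domains and have vector values,
  hence the set \<open>S\<close> and the general target. Vector fields themselves are not tested
  this way, since their values refer to charts that change with the point.\<close>

definition msmooth ::
  "('m, 'e::euclidean_space) chart set \<Rightarrow> ('m \<Rightarrow> 'b::real_normed_vector) \<Rightarrow> 'm set \<Rightarrow> bool" where
  "msmooth M f S \<longleftrightarrow> (\<forall>c\<in>M. smooth_on (f \<circ> chart_inv c) (snd c ` (fst c \<inter> S)))"

lemma smooth_functions_iff: "f \<in> smooth_functions M \<longleftrightarrow> msmooth M f UNIV"
  by (simp add: smooth_functions_def msmooth_def)

lemma msmooth_subset: "msmooth M f S \<Longrightarrow> T \<subseteq> S \<Longrightarrow> msmooth M f T"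
  unfolding msmooth_def
proof
  fix c
  assume *: "\<forall>c\<in>M. smooth_on (f \<circ> chart_inv c) (snd c ` (fst c \<inter> S))" "T \<subseteq> S" "c \<in> M"
  then have "smooth_on (f \<circ> chart_inv c) (snd c ` (fst c \<inter> S))"
    by simp
  then show "smooth_on (f \<circ> chart_inv c) (snd c ` (fst c \<inter> T))"
    by (rule smooth_on_subset) (use *(2) in blast)
qed

text \<open>The tangent vector at \<open>p\<close> with given components in the chart \<open>c\<close>.\<close>

definition chart_vec :: "('m, 'e::euclidean_space) chart set \<Rightarrow> ('m, 'e) chart \<Rightarrow> 'm \<Rightarrow> 'e \<Rightarrow> 'e" where
  "chart_vec M c p = frechet_derivative (snd (chart_at M p) \<circ> chart_inv c) (at (snd c p))"

text \<open>
  Global fields \<open>Y i\<close> and functions \<open>y i\<close>, coordinate fields and coordinates near \<open>p\<close> cut off by bump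
  functions: every tangent vector, multiplied by \<open>\<phi>\<close>, is expanded in the fields \<open>Y i\<close>.
\<close>

definition local_frame ::
  "('m::topological_space, 'e::euclidean_space) chart set \<Rightarrow> 'm \<Rightarrow> ('m \<Rightarrow> real) \<Rightarrow>
   ('e \<Rightarrow> 'm \<Rightarrow> real) \<Rightarrow> ('e \<Rightarrow> 'm \<Rightarrow> 'e) \<Rightarrow> bool" where
  "local_frame M p \<phi> y Y \<longleftrightarrow>
     (\<exists>T. open T \<and> p \<in> T \<and> (\<forall>q\<in>T. \<phi> q = 1)) \<and>
     (\<forall>i. y i \<in> smooth_functions M) \<and> (\<forall>i. Y i \<in> vector_fields M) \<and>
     (\<forall>q v. \<phi> q *\<^sub>R v = (\<Sum>i\<in>Basis. mderiv M (y i) q v *\<^sub>R Y i q)) \<and>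
     (\<forall>q. \<forall>i\<in>Basis. \<forall>j\<in>Basis. mderiv M (y i) q (Y j q) = (if i = j then \<phi> q else 0))"

lemma local_frameD:
  assumes "local_frame M p \<phi> y Y"
  shows "\<exists>T. open T \<and> p \<in> T \<and> (\<forall>q\<in>T. \<phi> q = 1)" "y i \<in> smooth_functions M" "Y i \<in> vector_fields M"
    "\<phi> q *\<^sub>R v = (\<Sum>i\<in>Basis. mderiv M (y i) q v *\<^sub>R Y i q)" "\<phi> p = 1"
    "i \<in> Basis \<Longrightarrow> j \<in> Basis \<Longrightarrow> mderiv M (y i) q (Y j q) = (if i = j then \<phi> q else 0)"
proof -
  note fr = assms[unfolded local_frame_def]
  show T: "\<exists>T. open T \<and> p \<in> T \<and> (\<forall>q\<in>T. \<phi> q = 1)"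
    by (rule fr[THEN conjunct1])
  show "y i \<in> smooth_functions M"
    by (rule fr[THEN conjunct2, THEN conjunct1, THEN spec])
  show "Y i \<in> vector_fields M"
    by (rule fr[THEN conjunct2, THEN conjunct2, THEN conjunct1, THEN spec])
  show "\<phi> q *\<^sub>R v = (\<Sum>i\<in>Basis. mderiv M (y i) q v *\<^sub>R Y i q)"
    by (rule fr[THEN conjunct2, THEN conjunct2, THEN conjunct2, THEN conjunct1, THEN spec, THEN spec])
  show "\<phi> p = 1"
    using T by blast
  show "mderiv M (y i) q (Y j q) = (if i = j then \<phi> q else 0)" if "i \<in> Basis" "j \<in> Basis"
    by (rule fr[THEN conjunct2, THEN conjunct2, THEN conjunct2, THEN conjunct2, THEN spec,
          THEN bspec[OF _ that(1)], THEN bspec[OF _ that(2)]])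
qed

locale smooth_manifold =
  fixes M :: "('m::{t2_space, second_countable_topology}, 'e::euclidean_space) chart set"
  assumes atlas: "smooth_atlas M"
begin

section \<open>Charts and smooth functions on open subsets\<close>

lemma chart: "c \<in> M \<Longrightarrow> is_chart c"
  using atlas by (simp add: smooth_atlas_def)

lemma open_chart: "c \<in> M \<Longrightarrow> open (fst c)"
  using chart by (simp add: is_chart_def)

lemma chart_homeo: "c \<in> M \<Longrightarrow> homeomorphism (fst c) (snd c ` fst c) (snd c) (chart_inv c)"
  using chart by (simp add: is_chart_def)

lemma chart_inv_chart: "c \<in> M \<Longrightarrow> p \<in> fst c \<Longrightarrow> chart_inv c (snd c p) = p"
  using homeomorphism_apply1[OF chart_homeo] by blast

lemma chart_at: "chart_at M p \<in> M" "p \<in> fst (chart_at M p)"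
proof -
  have "\<exists>c. c \<in> M \<and> p \<in> fst c"
    using atlas unfolding smooth_atlas_def by blast
  then have "chart_at M p \<in> M \<and> p \<in> fst (chart_at M p)"
    unfolding chart_at_def by (rule someI_ex)
  then show "chart_at M p \<in> M" "p \<in> fst (chart_at M p)"
    by auto
qed

lemma open_chart_image: "c \<in> M \<Longrightarrow> open S \<Longrightarrow> open (snd c ` (fst c \<inter> S))"
proof -
  assume c: "c \<in> M" and S: "open S"
  have "openin (top_of_set (snd c ` fst c)) (snd c ` (fst c \<inter> S))"
    using homeomorphism_imp_open_map[OF chart_homeo[OF c]] S by (simp add: openin_open_Int)
  then show ?thesis
    using chart[OF c] unfolding is_chart_def by (metis openin_open_trans)
qed

lemma msmooth_cong:
  assumes "open S" "\<And>p. p \<in> S \<Longrightarrow> f p = g p" "msmooth M f S"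
  shows "msmooth M g S"
  unfolding msmooth_def
proof
  fix c assume c: "c \<in> M"
  have f: "smooth_on (f \<circ> chart_inv c) (snd c ` (fst c \<inter> S))"
    using assms(3) c by (simp add: msmooth_def)
  show "smooth_on (g \<circ> chart_inv c) (snd c ` (fst c \<inter> S))"
    by (rule smooth_on_cong[OF open_chart_image[OF c assms(1)] _ f])
      (auto simp: chart_inv_chart[OF c] assms(2))
qed

lemma msmooth_local:
  assumes "\<And>p. p \<in> S \<Longrightarrow> \<exists>T. open T \<and> p \<in> T \<and> msmooth M f T"
  shows "msmooth M f S"
  unfolding msmooth_def
proof
  fix c assume c: "c \<in> M"
  show "smooth_on (f \<circ> chart_inv c) (snd c ` (fst c \<inter> S))"
  proof (rule smooth_on_local)
    fix x assume "x \<in> snd c ` (fst c \<inter> S)"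
    then obtain p where p: "p \<in> fst c" "p \<in> S" "x = snd c p"
      by blast
    obtain T where T: "open T" "p \<in> T" "msmooth M f T"
      using assms[OF p(2)] by blast
    show "\<exists>T. open T \<and> x \<in> T \<and> smooth_on (f \<circ> chart_inv c) T"
      using open_chart_image[OF c T(1)] T(2,3) p c unfolding msmooth_def
      by (intro exI[of _ "snd c ` (fst c \<inter> T)"]) auto
  qed
qed

text \<open>One chart suffices because transition maps are smooth: in a chart \<open>c\<close> the
  function is its expression in \<open>d\<close> composed with the transition from \<open>c\<close>
  to \<open>d\<close>.\<close>

lemma msmooth_if_chart:
  assumes d: "d \<in> M" and S: "open S" "S \<subseteq> fst d" and f: "smooth_on (f \<circ> chart_inv d) (snd d ` S)"
  shows "msmooth M f S"
  unfolding msmooth_def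
proof
  fix c assume c: "c \<in> M"
  have "smooth_on (snd d \<circ> chart_inv c) (snd c ` (fst c \<inter> fst d))"
    using atlas c d by (simp add: smooth_atlas_def)
  then have tr: "smooth_on (snd d \<circ> chart_inv c) (snd c ` (fst c \<inter> S))"
    by (rule smooth_on_subset) (use S in auto)
  have "open (snd d ` S)"
    using open_chart_image[OF d S(1)] S(2) by (simp add: inf.absorb2)
  moreover have "(snd d \<circ> chart_inv c) ` (snd c ` (fst c \<inter> S)) \<subseteq> snd d ` S"
    by (auto simp: chart_inv_chart[OF c])
  ultimately have "smooth_on (\<lambda>x. (f \<circ> chart_inv d) ((snd d \<circ> chart_inv c) x)) (snd c ` (fst c \<inter> S))"
    using smooth_on_compose[OF _ open_chart_image[OF c S(1)] _ f tr] by blast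
  then show "smooth_on (f \<circ> chart_inv c) (snd c ` (fst c \<inter> S))"
    by (rule smooth_on_cong[OF open_chart_image[OF c S(1)], rotated])
      (use S(2) in \<open>auto simp: chart_inv_chart[OF c] chart_inv_chart[OF d]\<close>)
qed

lemma msmooth_const: "msmooth M (\<lambda>p. a) S"
  by (simp add: msmooth_def o_def smooth_on_const)

lemma msmooth_add: "open S \<Longrightarrow> msmooth M f S \<Longrightarrow> msmooth M g S \<Longrightarrow> msmooth M (\<lambda>p. f p + g p) S"
  by (simp add: msmooth_def o_def smooth_on_add open_chart_image)

lemma msmooth_bounded_linear:
  "bounded_linear L \<Longrightarrow> open S \<Longrightarrow> msmooth M f S \<Longrightarrow> msmooth M (\<lambda>p. L (f p)) S"
  unfolding msmooth_def o_def by (intro ballI smooth_on_bounded_linear[of L] open_chart_image) auto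

lemma msmooth_bounded_bilinear:
  "bounded_bilinear B \<Longrightarrow> open S \<Longrightarrow> msmooth M f S \<Longrightarrow> msmooth M g S \<Longrightarrow>
    msmooth M (\<lambda>p. B (f p) (g p)) S"
  unfolding msmooth_def o_def by (intro ballI smooth_on_bounded_bilinear[of B] open_chart_image) auto

lemma msmooth_sum:
  assumes "open S" "finite A" "\<And>a. a \<in> A \<Longrightarrow> msmooth M (f a) S"
  shows "msmooth M (\<lambda>p. \<Sum>a\<in>A. f a p) S"
  using assms(2,3) by (induction A rule: finite_induct) (simp_all add: msmooth_const msmooth_add assms(1))

lemma msmooth_inverse:
  fixes f :: "'m \<Rightarrow> real"
  assumes "open S" "\<And>p. p \<in> S \<Longrightarrow> f p \<noteq> 0" "msmooth M f S"
  shows "msmooth M (\<lambda>p. inverse (f p)) S"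
  unfolding msmooth_def o_def
proof
  fix c assume c: "c \<in> M"
  show "smooth_on (\<lambda>x. inverse (f (chart_inv c x))) (snd c ` (fst c \<inter> S))"
    using assms c
    by (intro smooth_on_inverse open_chart_image[OF c]) (auto simp: chart_inv_chart msmooth_def o_def)
qed

lemma msmooth_chart: "c \<in> M \<Longrightarrow> msmooth M (snd c) (fst c)"
  using atlas by (simp add: smooth_atlas_def msmooth_def)

lemma msmooth_imp_continuous_on:
  assumes "open S" "msmooth M f S"
  shows "continuous_on S f"
  unfolding continuous_on_eq_continuous_at[OF assms(1)]
proof
  fix p assume p: "p \<in> S"
  define c where "c = chart_at M p"
  have c: "c \<in> M" "p \<in> fst c"
    using chart_at by (auto simp: c_def)
  have "continuous_on (snd c ` (fst c \<inter> S)) (f \<circ> chart_inv c)"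
    by (rule smooth_on_imp_continuous_on) (use assms(2) c(1) in \<open>auto simp: msmooth_def\<close>)
  moreover have "continuous_on (fst c \<inter> S) (snd c)"
    using homeomorphism_cont1[OF chart_homeo[OF c(1)]] by (rule continuous_on_subset) blast
  ultimately have "continuous_on (fst c \<inter> S) (\<lambda>q. (f \<circ> chart_inv c) (snd c q))"
    by (rule continuous_on_compose2) simp
  then have "continuous_on (fst c \<inter> S) f"
    by (rule continuous_on_eq) (simp add: chart_inv_chart[OF c(1)])
  then show "isCont f p"
    using c p continuous_on_eq_continuous_at[OF open_Int[OF open_chart[OF c(1)] assms(1)]] by auto
qed

section \<open>Differentials and components of tangent vectors\<close>

lemma chart_has_derivative:
  assumes "c \<in> M" "p \<in> fst c" "open S" "p \<in> S" "msmooth M f S"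
  shows "((f \<circ> chart_inv c) has_derivative frechet_derivative (f \<circ> chart_inv c) (at (snd c p)))
    (at (snd c p))"
  by (rule smooth_on_has_derivative[of _ "snd c ` (fst c \<inter> S)"]) (use assms in \<open>auto simp: msmooth_def\<close>)

lemma has_derivative_mderiv:
  assumes "open S" "p \<in> S" "msmooth M f S"
  shows "((f \<circ> chart_inv (chart_at M p)) has_derivative mderiv M f p) (at (snd (chart_at M p) p))"
  unfolding mderiv_def by (rule chart_has_derivative[OF chart_at assms])

lemma mderiv_eqI:
  "((f \<circ> chart_inv (chart_at M p)) has_derivative L) (at (snd (chart_at M p) p)) \<Longrightarrow> mderiv M f p = L"
  unfolding mderiv_def by (rule frechet_derivative_at[symmetric])

lemma bounded_linear_mderiv:
  "open S \<Longrightarrow> p \<in> S \<Longrightarrow> msmooth M f S \<Longrightarrow> bounded_linear (mderiv M f p)"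
  using has_derivative_mderiv has_derivative_bounded_linear by blast

lemma linear_mderiv:
  "open S \<Longrightarrow> p \<in> S \<Longrightarrow> msmooth M f S \<Longrightarrow> linear (mderiv M f p)"
  using bounded_linear_mderiv bounded_linear.linear by blast

lemma linear_mderiv_chart: "c \<in> M \<Longrightarrow> p \<in> fst c \<Longrightarrow> linear (mderiv M (snd c) p)"
  using linear_mderiv[OF open_chart _ msmooth_chart] by blast

lemma mderiv_cong:
  assumes "open S" "p \<in> S" "\<And>q. q \<in> S \<Longrightarrow> f q = g q"
  shows "mderiv M f p = mderiv M g p"
  unfolding mderiv_def
  by (rule frechet_derivative_cong_open[OF open_chart_image[OF chart_at(1)[of p] assms(1)]])
    (use assms chart_at[of p] in \<open>auto simp: chart_inv_chart\<close>)

lemma mderiv_const: "mderiv M (\<lambda>q. a) p v = 0"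
  by (simp add: mderiv_def o_def)

lemma mderiv_add:
  assumes "open S" "p \<in> S" "msmooth M f S" "msmooth M g S"
  shows "mderiv M (\<lambda>q. f q + g q) p v = mderiv M f p v + mderiv M g p v"
proof -
  have "mderiv M (\<lambda>q. f q + g q) p = (\<lambda>v. mderiv M f p v + mderiv M g p v)"
    using has_derivative_add[OF has_derivative_mderiv[OF assms(1-3)] has_derivative_mderiv[OF assms(1,2,4)]]
    by (intro mderiv_eqI) (simp add: o_def)
  then show ?thesis
    by simp
qed

lemma mderiv_sum:
  assumes "open S" "p \<in> S" "finite A" "\<And>a. a \<in> A \<Longrightarrow> msmooth M (f a) S"
  shows "mderiv M (\<lambda>q. \<Sum>a\<in>A. f a q) p v = (\<Sum>a\<in>A. mderiv M (f a) p v)"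
  using assms(3,4)
  by (induction A rule: finite_induct)
    (simp_all add: mderiv_const mderiv_add[OF assms(1,2)] msmooth_sum[OF assms(1)])

lemma mderiv_bounded_linear:
  assumes "bounded_linear L" "open S" "p \<in> S" "msmooth M f S"
  shows "mderiv M (\<lambda>q. L (f q)) p v = L (mderiv M f p v)"
proof -
  have "mderiv M (\<lambda>q. L (f q)) p = (\<lambda>v. L (mderiv M f p v))"
    using bounded_linear.has_derivative[OF assms(1) has_derivative_mderiv[OF assms(2-4)]]
    by (intro mderiv_eqI) (simp add: o_def)
  then show ?thesis
    by simp
qed

lemma mderiv_mult:
  fixes f g :: "'m \<Rightarrow> real"
  assumes "open S" "p \<in> S" "msmooth M f S" "msmooth M g S"
  shows "mderiv M (\<lambda>q. f q * g q) p v = f p * mderiv M g p v + mderiv M f p v * g p"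
proof -
  have "mderiv M (\<lambda>q. f q * g q) p = (\<lambda>v. f p * mderiv M g p v + mderiv M f p v * g p)"
    using has_derivative_mult[OF has_derivative_mderiv[OF assms(1-3)] has_derivative_mderiv[OF assms(1,2,4)]]
    by (intro mderiv_eqI) (simp add: o_def chart_inv_chart chart_at)
  then show ?thesis
    by simp
qed

text \<open>The chain rule for the change from the preferred chart at \<open>p\<close> to
  \<open>c\<close>. The preferred chart varies with \<open>p\<close> in an uncontrolled way, while
  \<open>c\<close> can be kept fixed on a neighbourhood; this form makes smooth dependence on
  \<open>p\<close> visible.\<close>

lemma mderiv_in_chart:
  assumes c: "c \<in> M" "p \<in> fst c" and S: "open S" "p \<in> S" and f: "msmooth M f S"
  shows "mderiv M f p v = frechet_derivative (f \<circ> chart_inv c) (at (snd c p)) (mderiv M (snd c) p v)"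
proof -
  let ?d = "chart_at M p"
  have x: "(snd c \<circ> chart_inv ?d) (snd ?d p) = snd c p"
    by (simp add: chart_inv_chart chart_at)
  have "((\<lambda>x. (f \<circ> chart_inv c) ((snd c \<circ> chart_inv ?d) x)) has_derivative
      (\<lambda>v. frechet_derivative (f \<circ> chart_inv c) (at (snd c p)) (mderiv M (snd c) p v))) (at (snd ?d p))"
    by (rule has_derivative_compose[OF has_derivative_mderiv[OF open_chart[OF c(1)] c(2) msmooth_chart[OF c(1)]]])
      (simp only: x chart_has_derivative[OF c S f])
  then have "((f \<circ> chart_inv ?d) has_derivative
      (\<lambda>v. frechet_derivative (f \<circ> chart_inv c) (at (snd c p)) (mderiv M (snd c) p v))) (at (snd ?d p))"
  proof (rule has_derivative_transform_within_open)
    show "open (snd ?d ` (fst ?d \<inter> fst c))"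
      using open_chart_image chart_at open_chart c by blast
    show "snd ?d p \<in> snd ?d ` (fst ?d \<inter> fst c)"
      using chart_at c by blast
  qed (auto simp: chart_inv_chart chart_at c)
  then show ?thesis
    using mderiv_eqI by metis
qed

lemma mderiv_chart_at: "mderiv M (snd (chart_at M p)) p v = v"
proof -
  let ?d = "chart_at M p"
  have "((snd ?d \<circ> chart_inv ?d) has_derivative (\<lambda>v. v)) (at (snd ?d p))"
  proof (rule has_derivative_transform_within_open)
    show "open (snd ?d ` (fst ?d \<inter> UNIV))"
      using open_chart_image chart_at by blast
    show "snd ?d p \<in> snd ?d ` (fst ?d \<inter> UNIV)"
      using chart_at by blast
    show "((\<lambda>x. x) has_derivative (\<lambda>v. v)) (at (snd ?d p))"
      by (rule has_derivative_ident)
  qed (auto simp: chart_inv_chart chart_at)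
  then show ?thesis
    by (simp add: mderiv_eqI)
qed

lemma chart_vec_mderiv:
  assumes "c \<in> M" "p \<in> fst c"
  shows "chart_vec M c p (mderiv M (snd c) p v) = v"
  using mderiv_in_chart[OF assms open_chart _ msmooth_chart, of "chart_at M p" v]
  by (simp add: chart_at chart_vec_def mderiv_chart_at)

lemma linear_chart_vec:
  assumes "c \<in> M" "p \<in> fst c"
  shows "linear (chart_vec M c p)"
  unfolding chart_vec_def
  by (rule has_derivative_linear[OF chart_has_derivative[OF assms open_chart _ msmooth_chart]])
    (simp_all add: chart_at)

text \<open>The differential of the coordinate map is injective by \<open>chart_vec_mderiv\<close>,
  hence surjective by equality of dimensions, so its left inverse is also a right inverse.\<close>

lemma mderiv_chart_vec:
  assumes "c \<in> M" "p \<in> fst c"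
  shows "mderiv M (snd c) p (chart_vec M c p w) = w"
proof -
  have lin: "linear (mderiv M (snd c) p)"
    using linear_mderiv_chart[OF assms] .
  have "inj (mderiv M (snd c) p)"
    using chart_vec_mderiv[OF assms] by (metis injI)
  then obtain v where "w = mderiv M (snd c) p v"
    using linear_injective_imp_surjective[OF lin] by (metis surjD)
  then show ?thesis
    by (simp add: chart_vec_mderiv[OF assms])
qed

section \<open>Smooth vector fields\<close>

lemma vector_fields_iff:
  "U \<in> vector_fields M \<longleftrightarrow> (\<forall>c\<in>M. msmooth M (\<lambda>p. mderiv M (snd c) p (U p)) (fst c))" (is "?L \<longleftrightarrow> ?R")
proof
  assume ?L
  then show ?R
    by (auto simp: vector_fields_def intro!: msmooth_if_chart open_chart)
next
  assume ?R
  then have "smooth_on ((\<lambda>p. mderiv M (snd c) p (U p)) \<circ> chart_inv c) (snd c ` (fst c \<inter> fst c))"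
    if "c \<in> M" for c
    using that unfolding msmooth_def by blast
  then show ?L
    by (simp add: vector_fields_def)
qed

lemma msmooth_mderiv_chart:
  assumes c: "c \<in> M" and S: "open S" "S \<subseteq> fst c" and f: "msmooth M f S"
    and U: "msmooth M (\<lambda>p. mderiv M (snd c) p (U p)) S"
  shows "msmooth M (\<lambda>p. mderiv M f p (U p)) S"
proof (rule msmooth_if_chart[OF c S])
  have op: "open (snd c ` S)"
    using open_chart_image[OF c S(1)] S(2) by (simp add: inf.absorb2)
  have "smooth_on (f \<circ> chart_inv c) (snd c ` (fst c \<inter> S))"
    "smooth_on ((\<lambda>p. mderiv M (snd c) p (U p)) \<circ> chart_inv c) (snd c ` (fst c \<inter> S))"
    using f U c unfolding msmooth_def by blast+
  then have "smooth_on (\<lambda>x. frechet_derivative (f \<circ> chart_inv c) (at x)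
      (((\<lambda>p. mderiv M (snd c) p (U p)) \<circ> chart_inv c) x)) (snd c ` S)"
    unfolding inf.absorb2[OF S(2)] by (rule smooth_on_frechet_derivative[OF op])
  then show "smooth_on ((\<lambda>p. mderiv M f p (U p)) \<circ> chart_inv c) (snd c ` S)"
  proof (rule smooth_on_cong[OF op, rotated])
    fix x assume "x \<in> snd c ` S"
    then obtain p where p: "p \<in> S" "x = snd c p"
      by blast
    then show "frechet_derivative (f \<circ> chart_inv c) (at x)
        (((\<lambda>p. mderiv M (snd c) p (U p)) \<circ> chart_inv c) x) =
        ((\<lambda>p. mderiv M f p (U p)) \<circ> chart_inv c) x"
      using mderiv_in_chart[OF c _ S(1) p(1) f, of "U p"] S(2) by (auto simp: chart_inv_chart[OF c])
  qed
qed

text \<open>Membership in \<open>vector_fields\<close> asks for smooth components in every chart of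
  the atlas. One chart near each point is enough, because the components in \<open>d\<close> are the
  derivative of \<open>snd d\<close> along \<open>U\<close>.\<close>

lemma vector_fieldsI:
  assumes "\<And>p. \<exists>c S. c \<in> M \<and> open S \<and> p \<in> S \<and> S \<subseteq> fst c \<and>
    msmooth M (\<lambda>q. mderiv M (snd c) q (U q)) S"
  shows "U \<in> vector_fields M"
  unfolding vector_fields_iff
proof
  fix d assume d: "d \<in> M"
  show "msmooth M (\<lambda>p. mderiv M (snd d) p (U p)) (fst d)"
  proof (rule msmooth_local)
    fix p assume p: "p \<in> fst d"
    obtain c S where c: "c \<in> M" "open S" "p \<in> S" "S \<subseteq> fst c"
      and U: "msmooth M (\<lambda>q. mderiv M (snd c) q (U q)) S"
      using assms[of p] by blast
    have "msmooth M (\<lambda>p. mderiv M (snd d) p (U p)) (S \<inter> fst d)"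
      by (rule msmooth_mderiv_chart[OF c(1)])
        (use c open_chart[OF d] msmooth_subset[OF msmooth_chart[OF d]] msmooth_subset[OF U] in auto)
    then show "\<exists>T. open T \<and> p \<in> T \<and> msmooth M (\<lambda>p. mderiv M (snd d) p (U p)) T"
      using c p open_chart[OF d] by (intro exI[of _ "S \<inter> fst d"]) auto
  qed
qed

lemma msmooth_mderiv:
  assumes S: "open S" and f: "msmooth M f S" and U: "U \<in> vector_fields M"
  shows "msmooth M (\<lambda>p. mderiv M f p (U p)) S"
proof (rule msmooth_local)
  fix p assume p: "p \<in> S"
  define c where "c = chart_at M p"
  have c: "c \<in> M" "p \<in> fst c"
    using chart_at by (auto simp: c_def)
  have "msmooth M (\<lambda>p. mderiv M (snd c) p (U p)) (S \<inter> fst c)"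
    using U c(1) by (auto simp: vector_fields_iff intro: msmooth_subset)
  then have "msmooth M (\<lambda>p. mderiv M f p (U p)) (S \<inter> fst c)"
    by (rule msmooth_mderiv_chart[OF c(1) _ _ msmooth_subset[OF f], rotated 3])
      (simp_all add: S open_chart[OF c(1)] open_Int)
  then show "\<exists>T. open T \<and> p \<in> T \<and> msmooth M (\<lambda>p. mderiv M f p (U p)) T"
    using S p c open_chart[OF c(1)] by (intro exI[of _ "S \<inter> fst c"]) auto
qed

lemma smooth_functions_mderiv:
  "f \<in> smooth_functions M \<Longrightarrow> U \<in> vector_fields M \<Longrightarrow> (\<lambda>p. mderiv M f p (U p)) \<in> smooth_functions M"
  by (simp add: smooth_functions_iff msmooth_mderiv)

lemma vector_fields_add:
  assumes "U \<in> vector_fields M" "W \<in> vector_fields M"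
  shows "(\<lambda>p. U p + W p) \<in> vector_fields M"
  unfolding vector_fields_iff
proof
  fix c assume c: "c \<in> M"
  show "msmooth M (\<lambda>p. mderiv M (snd c) p (U p + W p)) (fst c)"
    by (rule msmooth_cong[OF open_chart[OF c] _ msmooth_add[OF open_chart[OF c]]])
      (use assms c linear_mderiv_chart[OF c] in \<open>auto simp: vector_fields_iff linear_add\<close>)
qed

lemma vector_fields_scaleR:
  assumes "f \<in> smooth_functions M" "U \<in> vector_fields M"
  shows "(\<lambda>p. f p *\<^sub>R U p) \<in> vector_fields M"
  unfolding vector_fields_iff
proof
  fix c assume c: "c \<in> M"
  have f: "msmooth M f (fst c)"
    using assms(1) by (auto simp: smooth_functions_iff intro: msmooth_subset)
  show "msmooth M (\<lambda>p. mderiv M (snd c) p (f p *\<^sub>R U p)) (fst c)"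
    by (rule msmooth_cong[OF open_chart[OF c] _
          msmooth_bounded_bilinear[OF bounded_bilinear_scaleR open_chart[OF c] f]])
      (use assms c linear_mderiv_chart[OF c] in \<open>auto simp: vector_fields_iff linear_scale\<close>)
qed

lemma smooth_functions_const: "(\<lambda>p. a) \<in> smooth_functions M"
  by (simp add: smooth_functions_iff msmooth_const)

lemma smooth_functions_mult:
  "f \<in> smooth_functions M \<Longrightarrow> g \<in> smooth_functions M \<Longrightarrow> (\<lambda>p. f p * g p) \<in> smooth_functions M"
  by (simp add: smooth_functions_iff msmooth_bounded_bilinear[OF bounded_bilinear_mult])

lemma smooth_functions_sum:
  "finite A \<Longrightarrow> (\<And>a. a \<in> A \<Longrightarrow> f a \<in> smooth_functions M) \<Longrightarrow>
    (\<lambda>p. \<Sum>a\<in>A. f a p) \<in> smooth_functions M"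
  by (simp add: smooth_functions_iff msmooth_sum)

lemma vector_fields_0: "(\<lambda>p. 0) \<in> vector_fields M"
  unfolding vector_fields_iff
proof
  fix c assume c: "c \<in> M"
  show "msmooth M (\<lambda>p. mderiv M (snd c) p 0) (fst c)"
    by (rule msmooth_cong[OF open_chart[OF c] _ msmooth_const[of 0]])
      (simp add: linear_0 linear_mderiv_chart[OF c])
qed

lemma vector_fields_diff:
  assumes "U \<in> vector_fields M" "W \<in> vector_fields M"
  shows "(\<lambda>p. U p - W p) \<in> vector_fields M"
  using vector_fields_add[OF assms(1) vector_fields_scaleR[OF smooth_functions_const[of "-1"] assms(2)]]
  by simp

lemma vector_fields_sum:
  assumes "finite A" "\<And>a. a \<in> A \<Longrightarrow> U a \<in> vector_fields M"
  shows "(\<lambda>p. \<Sum>a\<in>A. U a p) \<in> vector_fields M"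
  using assms by (induction A rule: finite_induct) (simp_all add: vector_fields_0 vector_fields_add)

lemma vector_fields_local:
  assumes "\<And>p. \<exists>S W. open S \<and> p \<in> S \<and> W \<in> vector_fields M \<and> (\<forall>q\<in>S. U q = W q)"
  shows "U \<in> vector_fields M"
proof (rule vector_fieldsI)
  fix p
  obtain S W where S: "open S" "p \<in> S" and W: "W \<in> vector_fields M" "\<And>q. q \<in> S \<Longrightarrow> U q = W q"
    using assms by metis
  define c where "c = chart_at M p"
  have c: "c \<in> M" "p \<in> fst c"
    using chart_at by (auto simp: c_def)
  have "msmooth M (\<lambda>q. mderiv M (snd c) q (W q)) (S \<inter> fst c)"
    using W(1) c(1) by (auto simp: vector_fields_iff intro: msmooth_subset)
  then have "msmooth M (\<lambda>q. mderiv M (snd c) q (U q)) (S \<inter> fst c)"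
    by (rule msmooth_cong[rotated 2]) (use S W open_chart[OF c(1)] in auto)
  then show "\<exists>c S. c \<in> M \<and> open S \<and> p \<in> S \<and> S \<subseteq> fst c \<and>
      msmooth M (\<lambda>q. mderiv M (snd c) q (U q)) S"
    using c S open_chart[OF c(1)] by (intro exI[of _ c] exI[of _ "S \<inter> fst c"]) auto
qed

text \<open>\<open>lie_bracket\<close> is built from the coordinate functions of one chart. For
  general \<open>f\<close> the product rule produces second derivatives of \<open>f\<close> in the
  directions \<open>U p\<close> and \<open>W p\<close>, which cancel by symmetry, and the
  differential of \<open>f\<close> applied to the bracket.\<close>

lemma mderiv_lie_bracket:
  assumes f: "f \<in> smooth_functions M" and U: "U \<in> vector_fields M" and W: "W \<in> vector_fields M"
  shows "mderiv M f p (lie_bracket M U W p) =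
    mderiv M (\<lambda>q. mderiv M f q (W q)) p (U p) - mderiv M (\<lambda>q. mderiv M f q (U q)) p (W p)"
proof -
  define c where "c = chart_at M p"
  have c: "c \<in> M" "p \<in> fst c"
    using chart_at by (auto simp: c_def)
  let ?S = "snd c ` fst c" and ?x = "snd c p"
  define F where "F = f \<circ> chart_inv c"
  define comp where "comp V = (\<lambda>q. mderiv M (snd c) q (V q)) \<circ> chart_inv c" for V
  have S: "open ?S" "?x \<in> ?S"
    using open_chart_image[OF c(1) open_UNIV] c by auto
  have F: "smooth_on F ?S"
    using f c by (simp add: F_def smooth_functions_def)
  \<comment> \<open>At \<open>p\<close> the components of \<open>V p\<close> in \<open>c\<close> are
    \<open>V p\<close> itself, because \<open>c\<close> is the preferred chart there.\<close>
  have comp: "smooth_on (comp V) ?S" "comp V ?x = V p" if "V \<in> vector_fields M" for V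
    using that c mderiv_chart_at[of p] by (auto simp: comp_def vector_fields_def chart_inv_chart c_def)
  have d: "mderiv M h p = frechet_derivative (h \<circ> chart_inv c) (at ?x)" for h :: "'m \<Rightarrow> 'z::real_normed_vector"
    by (simp add: mderiv_def c_def)
  have VF: "mderiv M (\<lambda>q. mderiv M f q (V q)) p v =
      frechet_derivative (\<lambda>y. frechet_derivative F (at y) (V p)) (at ?x) v +
      frechet_derivative F (at ?x) (frechet_derivative (comp V) (at ?x) v)"
    if V: "V \<in> vector_fields M" for V v
  proof -
    have "frechet_derivative ((\<lambda>q. mderiv M f q (V q)) \<circ> chart_inv c) (at ?x) =
        frechet_derivative (\<lambda>y. frechet_derivative F (at y) (comp V y)) (at ?x)"
    proof (rule frechet_derivative_cong_open[OF S])
      fix y assume "y \<in> ?S"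
      then obtain q where q: "q \<in> fst c" "y = snd c q"
        by blast
      then show "((\<lambda>q. mderiv M f q (V q)) \<circ> chart_inv c) y = frechet_derivative F (at y) (comp V y)"
        using mderiv_in_chart[OF c(1) q(1) open_UNIV UNIV_I, of f "V q"] f
        by (simp add: F_def comp_def chart_inv_chart[OF c(1)] smooth_functions_iff)
    qed
    then show ?thesis
      unfolding d using frechet_derivative_frechet_derivative[OF S(1) F comp(1)[OF V] S(2)]
      by (simp add: comp(2)[OF V])
  qed
  have lin: "linear (frechet_derivative F (at ?x))"
    using smooth_on_has_derivative[OF F S(2)] by (rule has_derivative_linear)
  have "lie_bracket M U W p =
      frechet_derivative (comp W) (at ?x) (U p) - frechet_derivative (comp U) (at ?x) (W p)"
    unfolding lie_bracket_def Let_def d comp_def by (simp add: c_def)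
  then show ?thesis
    unfolding VF[OF U] VF[OF W] frechet_derivative_symmetric[OF S(1) F S(2), of "W p" "U p"]
    by (simp add: d F_def[symmetric] linear_diff[OF lin])
qed

subsection \<open>Bump functions and local frames\<close>

text \<open>A Euclidean bump in the coordinates of one chart, extended by zero. The closed set
  \<open>C\<close>, outside which \<open>\<phi>\<close> vanishes, is recorded so that products with
  \<open>\<phi>\<close> can be extended by zero from \<open>S\<close>.\<close>

lemma bump_exists:
  assumes "open S" "p \<in> S"
  obtains \<phi> C T where "\<phi> \<in> smooth_functions M" "closed C" "C \<subseteq> S" "open T" "p \<in> T" "T \<subseteq> S"
    "\<And>q. q \<in> T \<Longrightarrow> \<phi> q = (1::real)" "\<And>q. q \<notin> C \<Longrightarrow> \<phi> q = 0"
proof -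
  define c where "c = chart_at M p"
  have c: "c \<in> M" "p \<in> fst c"
    using chart_at by (auto simp: c_def)
  let ?x = "snd c p"
  have "open (snd c ` (fst c \<inter> S))" "?x \<in> snd c ` (fst c \<inter> S)"
    using open_chart_image c assms by auto
  then obtain e where e: "e > 0" "cball ?x e \<subseteq> snd c ` (fst c \<inter> S)"
    using open_contains_cball by metis
  define r where "r = e / 2"
  have r: "r > 0" "cball ?x (2 * r) \<subseteq> snd c ` (fst c \<inter> S)"
    using e by (auto simp: r_def)
  obtain b where b: "smooth_on b UNIV" "\<And>y. dist y ?x \<le> r \<Longrightarrow> b y = (1::real)"
    "\<And>y. dist y ?x \<ge> 2 * r \<Longrightarrow> b y = 0"
    using smooth_bump_exists[OF r(1), of ?x] by metis
  define C where "C = chart_inv c ` cball ?x (2 * r)"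
  define T where "T = fst c \<inter> S \<inter> snd c -` ball ?x r"
  define \<phi> where "\<phi> q = (if q \<in> fst c then b (snd c q) else 0)" for q
  have "continuous_on (cball ?x (2 * r)) (chart_inv c)"
    using homeomorphism_cont2[OF chart_homeo[OF c(1)]] by (rule continuous_on_subset) (use r(2) in blast)
  \<comment> \<open>Compactness in a Hausdorff space gives closedness in the whole manifold and not
    merely in the chart domain.\<close>
  then have C: "closed C"
    unfolding C_def by (intro compact_imp_closed compact_continuous_image compact_cball)
  have CS: "C \<subseteq> fst c \<inter> S"
    using r(2) chart_inv_chart[OF c(1)] by (fastforce simp: C_def)
  have T: "open T"
    unfolding T_def
    using continuous_open_preimage[OF continuous_on_subset[OF homeomorphism_cont1[OF chart_homeo[OF c(1)]]],
      of "fst c \<inter> S" "ball ?x r"] open_chart[OF c(1)] assms(1) by auto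
  have 0: "\<phi> q = 0" if "q \<notin> C" for q
  proof (cases "q \<in> fst c")
    case True
    have "snd c q \<notin> cball ?x (2 * r)"
      using that chart_inv_chart[OF c(1) True] by (metis C_def imageI)
    then show ?thesis
      using b(3)[of "snd c q"] True by (simp add: \<phi>_def dist_commute)
  qed (simp add: \<phi>_def)
  have "msmooth M \<phi> UNIV"
  proof (rule msmooth_local)
    fix q :: 'm
    have "smooth_on (\<phi> \<circ> chart_inv c) (snd c ` fst c)"
      by (rule smooth_on_cong[OF _ _ smooth_on_subset[OF b(1)]])
        (use open_chart_image[OF c(1) open_UNIV] in \<open>auto simp: \<phi>_def chart_inv_chart[OF c(1)]\<close>)
    then have 1: "msmooth M \<phi> (fst c)"
      by (intro msmooth_if_chart[OF c(1) open_chart[OF c(1)]]) auto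
    have 2: "msmooth M \<phi> (- C)"
      by (rule msmooth_cong[OF _ _ msmooth_const[of 0]]) (use C 0 in auto)
    show "\<exists>T. open T \<and> q \<in> T \<and> msmooth M \<phi> T"
    proof (cases "q \<in> fst c")
      case True
      then show ?thesis
        using 1 open_chart[OF c(1)] by blast
    next
      case False
      then show ?thesis
        using 2 C CS by (intro exI[of _ "- C"]) auto
    qed
  qed
  then show ?thesis
    using that[of \<phi> C T] C CS T 0 c assms r(1) b(2)
    by (auto simp: smooth_functions_iff T_def \<phi>_def dist_commute)
qed

text \<open>\<open>S\<close> and the complement of \<open>C\<close> form an open cover since
  \<open>C \<subseteq> S\<close>; the function is a smooth product on the former and zero on the
  latter.\<close>

lemma msmooth_extend_0:
  assumes "\<phi> \<in> smooth_functions M" "closed C" "C \<subseteq> S" "open S" "\<And>q. q \<notin> C \<Longrightarrow> \<phi> q = 0"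
    and "msmooth M f S"
  shows "msmooth M (\<lambda>q. if q \<in> S then \<phi> q *\<^sub>R f q else 0) UNIV"
proof (rule msmooth_local)
  fix q :: 'm
  have "msmooth M \<phi> S"
    using assms(1) by (auto simp: smooth_functions_iff intro: msmooth_subset)
  then have "msmooth M (\<lambda>q. \<phi> q *\<^sub>R f q) S"
    using msmooth_bounded_bilinear[OF bounded_bilinear_scaleR assms(4) _ assms(6)] by blast
  then have 1: "msmooth M (\<lambda>q. if q \<in> S then \<phi> q *\<^sub>R f q else 0) S"
    by (rule msmooth_cong[OF assms(4), rotated]) simp
  have 2: "msmooth M (\<lambda>q. if q \<in> S then \<phi> q *\<^sub>R f q else 0) (- C)"
    by (rule msmooth_cong[OF _ _ msmooth_const[of 0]]) (use assms(2,5) in auto)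
  show "\<exists>T. open T \<and> q \<in> T \<and> msmooth M (\<lambda>q. if q \<in> S then \<phi> q *\<^sub>R f q else 0) T"
  proof (cases "q \<in> S")
    case True
    then show ?thesis
      using 1 assms(4) by blast
  next
    case False
    then show ?thesis
      using 2 assms(2,3) by (intro exI[of _ "- C"]) auto
  qed
qed

text \<open>Coefficients of fields have to be global smooth functions, so the reciprocal of
  \<open>f\<close> is cut off; it inverts \<open>f\<close> only near \<open>p\<close>.\<close>

lemma local_inverse_exists:
  assumes f: "f \<in> smooth_functions M" and "f p \<noteq> (0::real)"
  obtains r S where "r \<in> smooth_functions M" "open S" "p \<in> S" "\<And>q. q \<in> S \<Longrightarrow> r q * f q = 1"
proof -
  have "continuous_on UNIV f"
    using msmooth_imp_continuous_on f by (auto simp: smooth_functions_iff)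
  then have S: "open {q. f q \<noteq> 0}"
    by (intro open_Collect_neq continuous_on_const)
  have pS: "p \<in> {q. f q \<noteq> 0}"
    using assms(2) by simp
  obtain \<phi> C T where \<phi>: "\<phi> \<in> smooth_functions M" "closed C" "C \<subseteq> {q. f q \<noteq> 0}"
    and T: "open T" "p \<in> T" "T \<subseteq> {q. f q \<noteq> 0}" "\<And>q. q \<in> T \<Longrightarrow> \<phi> q = 1"
    and 0: "\<And>q. q \<notin> C \<Longrightarrow> \<phi> q = 0"
    by (rule bump_exists[OF S pS]) (rule that)
  have "msmooth M (\<lambda>q. inverse (f q)) {q. f q \<noteq> 0}"
    using f by (intro msmooth_inverse[OF S]) (auto simp: smooth_functions_iff intro: msmooth_subset)
  from msmooth_extend_0[OF \<phi> S 0 this] show ?thesis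
    using T by (intro that[of "\<lambda>q. if q \<in> {q. f q \<noteq> 0} then \<phi> q *\<^sub>R inverse (f q) else 0" T])
      (auto simp: smooth_functions_iff subset_iff)
qed

text \<open>Two nested cut-offs are used: \<open>\<phi>1\<close> equals 1 on \<open>T1\<close>, and
  \<open>T1\<close> contains the set \<open>C\<close> outside which \<open>\<phi>\<close> vanishes.
  Hence, wherever a frame field is nonzero, the differentials of the cut-off coordinates are the
  true coordinate differentials, and both frame identities hold on the whole manifold with the
  factor \<open>\<phi>\<close>.\<close>

lemma local_frame_exists: "\<exists>\<phi> y Y. local_frame M p \<phi> y Y"
proof -
  define c where "c = chart_at M p"
  have c: "c \<in> M" "p \<in> fst c"
    using chart_at by (auto simp: c_def)
  obtain \<phi>1 C1 T1 where \<phi>1: "\<phi>1 \<in> smooth_functions M" "closed C1" "C1 \<subseteq> fst c"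
    and T1: "open T1" "p \<in> T1" "T1 \<subseteq> fst c" "\<And>q. q \<in> T1 \<Longrightarrow> \<phi>1 q = (1::real)"
    and 01: "\<And>q. q \<notin> C1 \<Longrightarrow> \<phi>1 q = 0"
    by (rule bump_exists[OF open_chart[OF c(1)] c(2)]) (rule that)
  obtain \<phi> C T where \<phi>: "\<phi> \<in> smooth_functions M" "closed C" "C \<subseteq> T1"
    and T: "open T" "p \<in> T" "T \<subseteq> T1" "\<And>q. q \<in> T \<Longrightarrow> \<phi> q = (1::real)"
    and 0: "\<And>q. q \<notin> C \<Longrightarrow> \<phi> q = 0"
    by (rule bump_exists[OF T1(1,2)]) (rule that)
  define y where "y i q = (if q \<in> fst c then \<phi>1 q *\<^sub>R (snd c q \<bullet> i) else 0)" for i q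
  define Y where "Y i q = (if q \<in> fst c then \<phi> q *\<^sub>R chart_vec M c q i else 0)" for i q
  have y: "y i \<in> smooth_functions M" for i
    unfolding smooth_functions_iff y_def
    by (intro msmooth_extend_0[OF \<phi>1 open_chart[OF c(1)] 01] msmooth_chart[OF c(1)]
        msmooth_bounded_linear[OF bounded_linear_inner_left open_chart[OF c(1)]])
  have dy: "mderiv M (y i) q v = mderiv M (snd c) q v \<bullet> i" if "q \<in> T1" for i q v
  proof -
    have "mderiv M (y i) q = mderiv M (\<lambda>q. snd c q \<bullet> i) q"
      by (rule mderiv_cong[OF T1(1) that]) (use T1(3,4) in \<open>auto simp: y_def\<close>)
    moreover have "mderiv M (\<lambda>q. snd c q \<bullet> i) q v = mderiv M (snd c) q v \<bullet> i"
      by (rule mderiv_bounded_linear[OF bounded_linear_inner_left open_chart[OF c(1)] _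
            msmooth_chart[OF c(1)]]) (use T1(3) that in blast)
    ultimately show ?thesis
      by simp
  qed
  have Y0: "Y i q = 0" if "q \<notin> C" for i q
    using 0[OF that] by (simp add: Y_def)
  have dY: "mderiv M (snd c) q (Y i q) = \<phi> q *\<^sub>R i" if "q \<in> fst c" for i q
    using that by (simp add: Y_def linear_scale[OF linear_mderiv_chart[OF c(1)]] mderiv_chart_vec[OF c(1)])
  have Y: "Y i \<in> vector_fields M" for i
  proof (rule vector_fieldsI)
    fix q
    show "\<exists>c S. c \<in> M \<and> open S \<and> q \<in> S \<and> S \<subseteq> fst c \<and>
        msmooth M (\<lambda>p. mderiv M (snd c) p (Y i p)) S"
    proof (cases "q \<in> fst c")
      case True
      have "msmooth M \<phi> (fst c)"
        using \<phi>(1) by (auto simp: smooth_functions_iff intro: msmooth_subset)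
      then have "msmooth M (\<lambda>p. mderiv M (snd c) p (Y i p)) (fst c)"
        by (rule msmooth_cong[OF open_chart[OF c(1)] _
              msmooth_bounded_linear[OF bounded_linear_scaleR_left[of i] open_chart[OF c(1)]], rotated])
          (simp add: dY)
      then show ?thesis
        using True c open_chart by blast
    next
      case False
      let ?d = "chart_at M q"
      have "msmooth M (\<lambda>p. mderiv M (snd ?d) p (Y i p)) (- C \<inter> fst ?d)"
        by (rule msmooth_cong[OF _ _ msmooth_const[of 0]])
          (use \<phi>(2) open_chart[OF chart_at(1)] linear_mderiv_chart[OF chart_at(1)] in
            \<open>auto simp: Y0 linear_0\<close>)
      then show ?thesis
        using False \<phi>(2,3) T1(3) chart_at open_chart[OF chart_at(1)]
        by (intro exI[of _ ?d] exI[of _ "- C \<inter> fst ?d"]) auto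
    qed
  qed
  have expand: "\<phi> q *\<^sub>R v = (\<Sum>i\<in>Basis. mderiv M (y i) q v *\<^sub>R Y i q)" for q v
  proof (cases "q \<in> T1")
    case True
    then have q: "q \<in> fst c"
      using T1(3) by blast
    have "(\<Sum>i\<in>Basis. mderiv M (y i) q v *\<^sub>R Y i q) =
        \<phi> q *\<^sub>R chart_vec M c q (\<Sum>i\<in>Basis. (mderiv M (snd c) q v \<bullet> i) *\<^sub>R i)"
      using linear_chart_vec[OF c(1) q]
      by (simp add: dy[OF True] Y_def q linear_sum linear_scale scaleR_sum_right mult.commute)
    then show ?thesis
      by (simp add: euclidean_representation chart_vec_mderiv[OF c(1) q])
  next
    case False
    then have "q \<notin> C"
      using \<phi>(3) by blast
    then show ?thesis
      by (simp add: 0 Y0)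
  qed
  have dual: "mderiv M (y i) q (Y j q) = (if i = j then \<phi> q else 0)"
    if ij: "i \<in> Basis" "j \<in> Basis" for q i j
  proof (cases "q \<in> T1")
    case True
    then show ?thesis
      using T1(3) ij by (auto simp: dy dY subset_iff inner_Basis)
  next
    case False
    then have "q \<notin> C"
      using \<phi>(3) by blast
    moreover have "linear (mderiv M (y i) q)"
      by (rule linear_mderiv[OF open_UNIV UNIV_I y[unfolded smooth_functions_iff]])
    ultimately show ?thesis
      by (simp add: 0 Y0 linear_0)
  qed
  show ?thesis
    unfolding local_frame_def
    by (intro exI[of _ \<phi>] exI[of _ y] exI[of _ Y] conjI allI ballI y Y expand dual exI[of _ T])
      (use T in auto)
qed

text \<open>Duality with equal indices exhibits \<open>\<phi>\<close> as the derivative of a smooth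
  function along a smooth field.\<close>

lemma local_frame_smooth:
  assumes fr: "local_frame M p \<phi> y Y"
  shows "\<phi> \<in> smooth_functions M"
proof -
  obtain i :: 'e where "i \<in> Basis"
    using nonempty_Basis by blast
  then have "\<phi> = (\<lambda>q. mderiv M (y i) q (Y i q))"
    by (simp add: local_frameD(6)[OF fr])
  then show ?thesis
    using smooth_functions_mderiv[OF local_frameD(2)[OF fr] local_frameD(3)[OF fr]] by simp
qed

text \<open>Near \<open>p\<close> the functions \<open>mderiv M (y k) q (Y l q)\<close> are
  constant, so the differential of every \<open>y k\<close> annihilates the bracket; the expansion
  at \<open>p\<close>, where \<open>\<phi>\<close> is 1, then forces it to be zero.\<close>

lemma local_frame_lie_bracket:
  assumes fr: "local_frame M p \<phi> y Y" and ij: "i \<in> Basis" "j \<in> Basis"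
  shows "lie_bracket M (Y i) (Y j) p = 0"
proof -
  obtain T where T: "open T" "p \<in> T" "\<And>q. q \<in> T \<Longrightarrow> \<phi> q = 1"
    using local_frameD(1)[OF fr] by blast
  note y = local_frameD(2)[OF fr] and Y = local_frameD(3)[OF fr] and dual = local_frameD(6)[OF fr]
  have 0: "mderiv M (\<lambda>q. mderiv M (y k) q (Y l q)) p v = 0" if "k \<in> Basis" "l \<in> Basis" for k l v
  proof -
    have "mderiv M (\<lambda>q. mderiv M (y k) q (Y l q)) p = mderiv M (\<lambda>q. if k = l then 1 else 0) p"
      by (rule mderiv_cong[OF T(1,2)]) (simp add: dual[OF that] T(3))
    then show ?thesis
      by (simp add: mderiv_const)
  qed
  have "mderiv M (y k) p (lie_bracket M (Y i) (Y j) p) = 0" if "k \<in> Basis" for k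
    using that ij by (simp add: mderiv_lie_bracket[OF y Y Y] 0)
  then have "\<phi> p *\<^sub>R lie_bracket M (Y i) (Y j) p = 0"
    unfolding local_frameD(4)[OF fr] by simp
  then show ?thesis
    by (simp add: local_frameD(5)[OF fr])
qed

text \<open>A combination of frame fields with constant coefficients. The constant map with value
  \<open>v\<close> would not do, since it need not be smooth in charts.\<close>

lemma vector_field_through: "\<exists>V\<in>vector_fields M. V p = v"
proof -
  obtain \<phi> y Y where fr: "local_frame M p \<phi> y Y"
    using local_frame_exists by blast
  have "v = (\<Sum>i\<in>Basis. mderiv M (y i) p v *\<^sub>R Y i p)"
    using local_frameD(4)[OF fr, of p v] by (simp only: local_frameD(5)[OF fr] scaleR_one)
  moreover have "(\<lambda>q. \<Sum>i\<in>Basis. mderiv M (y i) p v *\<^sub>R Y i q) \<in> vector_fields M"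
    by (intro vector_fields_sum vector_fields_scaleR smooth_functions_const local_frameD(3)[OF fr]
        finite_Basis)
  ultimately show ?thesis
    by (intro bexI[of _ "\<lambda>q. \<Sum>i\<in>Basis. mderiv M (y i) p v *\<^sub>R Y i q"]) (simp only:)
qed

end

section \<open>Riemannian manifolds\<close>

locale riemannian_manifold = smooth_manifold M
  for M :: "('m::{t2_space, second_countable_topology}, 'e::euclidean_space) chart set" +
  fixes g :: "'m \<Rightarrow> 'e \<Rightarrow> 'e \<Rightarrow> real"
    and D :: "('m \<Rightarrow> 'e) \<Rightarrow> ('m \<Rightarrow> 'e) \<Rightarrow> 'm \<Rightarrow> 'e"
  assumes metric: "riemannian_metric M g"
    and levi_civita: "levi_civita M g D"
begin

lemmas
  bilinear_metric = metric[unfolded riemannian_metric_def, THEN conjunct1, rule_format] and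
  metric_sym = metric[unfolded riemannian_metric_def, THEN conjunct2, THEN conjunct1, rule_format] and
  metric_pos = metric[unfolded riemannian_metric_def, THEN conjunct2, THEN conjunct2, THEN conjunct1,
    rule_format] and
  smooth_metric = metric[unfolded riemannian_metric_def, THEN conjunct2, THEN conjunct2,
    THEN conjunct2, rule_format]

lemmas
  affine = levi_civita[unfolded levi_civita_def, THEN conjunct1] and
  D_metric = levi_civita[unfolded levi_civita_def, THEN conjunct2, THEN conjunct1, rule_format] and
  D_torsion = levi_civita[unfolded levi_civita_def, THEN conjunct2, THEN conjunct2, rule_format]

lemmas
  D_add_left = affine[unfolded affine_connection_def, THEN conjunct2, THEN conjunct1, rule_format] and
  D_scaleR_left = affine[unfolded affine_connection_def, THEN conjunct2, THEN conjunct2,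
    THEN conjunct1, rule_format] and
  D_add_right = affine[unfolded affine_connection_def, THEN conjunct2, THEN conjunct2,
    THEN conjunct2, THEN conjunct1, rule_format] and
  D_scaleR_right = affine[unfolded affine_connection_def, THEN conjunct2, THEN conjunct2,
    THEN conjunct2, THEN conjunct2, rule_format]

lemma linear_metric_left: "linear (\<lambda>v. g p v w)"
  using bilinear_metric by (simp add: bilinear_def)

lemma linear_metric_right: "linear (g p v)"
  using bilinear_metric by (simp add: bilinear_def)

lemmas metric_simps =
  linear_add[OF linear_metric_left] linear_add[OF linear_metric_right]
  linear_diff[OF linear_metric_left] linear_diff[OF linear_metric_right]
  linear_scale[OF linear_metric_left] linear_scale[OF linear_metric_right]
  linear_neg[OF linear_metric_left] linear_neg[OF linear_metric_right]
  linear_sum[OF linear_metric_left] linear_sum[OF linear_metric_right]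
  linear_0[OF linear_metric_left] linear_0[OF linear_metric_right]

lemma metric_self_eq_0: "g p v v = 0 \<longleftrightarrow> v = 0"
  using metric_pos[of v p] linear_0[OF linear_metric_right[of p v]] by force

lemma D_0_left: "W \<in> vector_fields M \<Longrightarrow> D (\<lambda>q. 0) W p = 0"
  using D_scaleR_left[OF smooth_functions_const[of 0] vector_fields_0, of W p] by simp

lemma D_sum_left:
  assumes "finite A" "\<And>a. a \<in> A \<Longrightarrow> U a \<in> vector_fields M" "W \<in> vector_fields M"
  shows "D (\<lambda>q. \<Sum>a\<in>A. U a q) W p = (\<Sum>a\<in>A. D (U a) W p)"
  using assms(1,2)
proof (induction A rule: finite_induct)
  case empty
  then show ?case
    by (simp add: D_0_left[OF assms(3)])
next
  case (insert a A)
  have "D (\<lambda>q. U a q + (\<Sum>a\<in>A. U a q)) W p = D (U a) W p + D (\<lambda>q. \<Sum>a\<in>A. U a q) W p"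
    by (rule D_add_left) (use insert assms(3) in \<open>auto intro!: vector_fields_sum\<close>)
  then show ?case
    using insert by simp
qed

text \<open>Nonzero orthogonal vectors, as many as the dimension, are independent and hence span.
  The defect \<open>d\<close> of the expansion is orthogonal to each of them, therefore to itself.
  The division by \<open>g p (e i) (e i)\<close> takes the place of normalisation.\<close>

lemma orthogonal_expansion:
  assumes ne: "\<And>i. i < DIM('e) \<Longrightarrow> e i \<noteq> 0"
    and orth: "\<And>i j. i < DIM('e) \<Longrightarrow> j < DIM('e) \<Longrightarrow> i \<noteq> j \<Longrightarrow> g p (e i) (e j) = 0"
  shows "v = (\<Sum>i<DIM('e). (g p v (e i) / g p (e i) (e i)) *\<^sub>R e i)"
proof -
  let ?n = "DIM('e)"
  let ?S = "e ` {..<?n}"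
  have ne': "g p (e i) (e i) \<noteq> 0" if "i < ?n" for i
    using ne[OF that] by (simp add: metric_self_eq_0)
  have inj: "inj_on e {..<?n}"
  proof (rule inj_onI)
    fix i j assume ij: "i \<in> {..<?n}" "j \<in> {..<?n}" "e i = e j"
    show "i = j"
    proof (rule ccontr)
      assume "i \<noteq> j"
      then have "g p (e i) (e j) = 0"
        using orth[of i j] ij(1,2) by simp
      then show False
        using ne'[of j] ij by simp
    qed
  qed
  have "independent ?S"
  proof
    assume "dependent ?S"
    then obtain u where u: "\<exists>v\<in>?S. u v \<noteq> 0" "(\<Sum>v\<in>?S. u v *\<^sub>R v) = 0"
      using dependent_finite[of ?S] by auto
    then obtain j where j: "j < ?n" "u (e j) \<noteq> 0"
      by auto
    have "g p (\<Sum>i<?n. u (e i) *\<^sub>R e i) (e j) = 0"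
      using u(2) by (simp add: sum.reindex[OF inj] metric_simps)
    moreover have "g p (\<Sum>i<?n. u (e i) *\<^sub>R e i) (e j) = (\<Sum>i<?n. if i = j then u (e j) * g p (e j) (e j) else 0)"
      unfolding metric_simps by (rule sum.cong) (use orth j in auto)
    ultimately show False
      using j ne'[of j] by simp
  qed
  then have span: "span ?S = UNIV"
    using card_ge_dim_independent[of ?S UNIV] card_image[OF inj] by auto
  define d where "d = v - (\<Sum>i<?n. (g p v (e i) / g p (e i) (e i)) *\<^sub>R e i)"
  have "g p d (e j) = 0" if "j < ?n" for j
  proof -
    have "(\<Sum>i<?n. (g p v (e i) / g p (e i) (e i)) * g p (e i) (e j)) =
        (\<Sum>i<?n. if i = j then g p v (e j) else 0)"
      by (rule sum.cong) (use orth that ne'[OF that] in auto)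
    then show ?thesis
      using that by (simp add: d_def metric_simps)
  qed
  then have "?S \<subseteq> {x. g p d x = 0}"
    by auto
  moreover have "subspace {x. g p d x = 0}"
    by (rule linear_subspace_kernel[OF linear_metric_right])
  ultimately have "span ?S \<subseteq> {x. g p d x = 0}"
    by (rule span_minimal)
  then have "g p d d = 0"
    unfolding span by blast
  then show ?thesis
    by (simp add: metric_self_eq_0 d_def)
qed

text \<open>Gram-Schmidt without normalisation. The quotients in the projection are formed with
  global functions \<open>r i\<close> that invert \<open>g q (E i q) (E i q)\<close> only near
  \<open>p\<close>, so the neighbourhood shrinks at every stage.\<close>

lemma orthogonal_fields_exist:
  assumes "k \<le> DIM('e)"
  shows "\<exists>E T. open T \<and> p \<in> T \<and> (\<forall>i<k. E i \<in> vector_fields M) \<and>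
    (\<forall>q\<in>T. (\<forall>i<k. E i q \<noteq> 0) \<and> (\<forall>i<k. \<forall>j<k. i \<noteq> j \<longrightarrow> g q (E i q) (E j q) = 0))"
  using assms
proof (induction k)
  case 0
  show ?case
    by (intro exI[of _ "\<lambda>_ _. 0"] exI[of _ UNIV]) simp
next
  case (Suc k)
  have "k \<le> DIM('e)"
    using Suc.prems by simp
  from Suc.IH[OF this] obtain E T where T: "open T" "p \<in> T" and E: "\<And>i. i < k \<Longrightarrow> E i \<in> vector_fields M"
    and ne: "\<And>q i. q \<in> T \<Longrightarrow> i < k \<Longrightarrow> E i q \<noteq> 0"
    and orth: "\<And>q i j. q \<in> T \<Longrightarrow> i < k \<Longrightarrow> j < k \<Longrightarrow> i \<noteq> j \<Longrightarrow> g q (E i q) (E j q) = 0"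
    by metis
  let ?S = "(\<lambda>i. E i p) ` {..<k}"
  have "dim ?S \<le> card ?S"
    by (rule dim_le_card') simp
  also have "\<dots> \<le> k"
    using card_image_le[of "{..<k}" "\<lambda>i. E i p"] by simp
  finally have "dim ?S < DIM('e)"
    using Suc.prems by simp
  then have "span ?S \<noteq> UNIV"
    using dim_span[of ?S] by (metis dim_UNIV less_irrefl)
  \<comment> \<open>Subtracting a combination of the \<open>E i p\<close> from a vector outside
    their span cannot give zero, so the new field will be nonzero at \<open>p\<close>.\<close>
  then obtain w where w: "w \<notin> span ?S"
    by blast
  obtain W where W: "W \<in> vector_fields M" "W p = w"
    using vector_field_through by blast
  have "\<exists>r S. r \<in> smooth_functions M \<and> open S \<and> p \<in> S \<and> (\<forall>q\<in>S. r q * g q (E i q) (E i q) = 1)"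
    if i: "i < k" for i
  proof -
    have "g p (E i p) (E i p) \<noteq> 0"
      using ne[OF T(2) i] by (simp add: metric_self_eq_0)
    then obtain r S where "r \<in> smooth_functions M" "open S" "p \<in> S"
      "\<And>q. q \<in> S \<Longrightarrow> r q * g q (E i q) (E i q) = 1"
      by (rule local_inverse_exists[OF smooth_metric[OF E[OF i] E[OF i]], where p = p]) (rule that)
    then show ?thesis
      by blast
  qed
  then obtain r S where r: "\<And>i. i < k \<Longrightarrow> r i \<in> smooth_functions M"
    and S: "\<And>i. i < k \<Longrightarrow> open (S i)" "\<And>i. i < k \<Longrightarrow> p \<in> S i"
      "\<And>i q. i < k \<Longrightarrow> q \<in> S i \<Longrightarrow> r i q * g q (E i q) (E i q) = 1"
    by metis
  define e where "e q = W q - (\<Sum>i<k. (r i q * g q (W q) (E i q)) *\<^sub>R E i q)" for q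
  have e: "e \<in> vector_fields M"
    unfolding e_def
    by (intro vector_fields_diff W vector_fields_sum vector_fields_scaleR smooth_functions_mult
        smooth_metric finite_lessThan) (auto intro: E r)
  have "e p \<noteq> 0"
  proof
    assume "e p = 0"
    then have "w = (\<Sum>i<k. (r i p * g p (W p) (E i p)) *\<^sub>R E i p)"
      by (simp add: e_def W(2))
    also have "\<dots> \<in> span ?S"
      by (intro span_sum span_scale span_base) auto
    finally show False
      using w by blast
  qed
  \<comment> \<open>On \<open>T'\<close> all reciprocals are valid and the new field has no
    zero.\<close>
  define T' where "T' = T \<inter> (\<Inter>i<k. S i) \<inter> {q. g q (e q) (e q) \<noteq> 0}"
  have "continuous_on UNIV (\<lambda>q. g q (e q) (e q))"
    using msmooth_imp_continuous_on[OF open_UNIV] smooth_metric[OF e e] by (simp add: smooth_functions_iff)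
  then have "open {q. g q (e q) (e q) \<noteq> 0}"
    by (intro open_Collect_neq continuous_on_const)
  then have T': "open T'" "p \<in> T'"
    using T S(1,2) \<open>e p \<noteq> 0\<close> by (auto simp: T'_def metric_self_eq_0 intro!: open_Int open_INT)
  have e_orth: "g q (e q) (E j q) = 0" if "q \<in> T'" "j < k" for q j
  proof -
    have q: "q \<in> T" "q \<in> S j"
      using that by (auto simp: T'_def)
    have "(\<Sum>i<k. r i q * g q (W q) (E i q) * g q (E i q) (E j q)) =
        (\<Sum>i<k. if i = j then g q (W q) (E j q) else 0)"
    proof (rule sum.cong)
      fix i assume "i \<in> {..<k}"
      then show "r i q * g q (W q) (E i q) * g q (E i q) (E j q) =
          (if i = j then g q (W q) (E j q) else 0)"
        using orth[OF q(1), of i j] S(3)[OF that(2) q(2)] that(2)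
        by (auto simp: mult.commute mult.left_commute)
    qed simp
    then show ?thesis
      using that(2) by (simp add: e_def metric_simps)
  qed
  define E' where "E' i = (if i = k then e else E i)" for i
  have "\<forall>i<Suc k. E' i \<in> vector_fields M"
    using E e by (auto simp: E'_def less_Suc_eq)
  moreover have "\<forall>q\<in>T'. (\<forall>i<Suc k. E' i q \<noteq> 0) \<and>
      (\<forall>i<Suc k. \<forall>j<Suc k. i \<noteq> j \<longrightarrow> g q (E' i q) (E' j q) = 0)"
  proof
    fix q assume q: "q \<in> T'"
    then have qT: "q \<in> T" and "e q \<noteq> 0"
      by (auto simp: T'_def metric_self_eq_0)
    then show "(\<forall>i<Suc k. E' i q \<noteq> 0) \<and>
        (\<forall>i<Suc k. \<forall>j<Suc k. i \<noteq> j \<longrightarrow> g q (E' i q) (E' j q) = 0)"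
      using ne[OF qT] orth[OF qT] e_orth[OF q] metric_sym[of q "e q"]
      by (auto simp: E'_def less_Suc_eq)
  qed
  ultimately show ?case
    using T' by (intro exI[of _ E'] exI[of _ T']) blast
qed

end

section \<open>Pullback connections\<close>

locale smooth_manifold_map = M: smooth_manifold M + N: smooth_manifold N
  for M :: "('m::{t2_space, second_countable_topology}, 'e::euclidean_space) chart set"
    and N :: "('n::{t2_space, second_countable_topology}, 'f::euclidean_space) chart set" +
  fixes F :: "'m \<Rightarrow> 'n"
  assumes smooth: "smooth_map M N F"
begin

lemma open_vimage_map: "open T \<Longrightarrow> open (F -` T)"
  using smooth by (auto simp: smooth_map_def intro: open_vimage)

lemma msmooth_compose:
  assumes T: "open T" and f: "msmooth N f T"
  shows "msmooth M (\<lambda>p. f (F p)) (F -` T)"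
proof (rule M.msmooth_local)
  fix p assume p: "p \<in> F -` T"
  define c d where "c = chart_at M p" and "d = chart_at N (F p)"
  have c: "c \<in> M" "p \<in> fst c" and d: "d \<in> N" "F p \<in> fst d"
    using M.chart_at N.chart_at by (auto simp: c_def d_def)
  define S where "S = fst c \<inter> F -` (fst d \<inter> T)"
  have S: "open S" "p \<in> S" "S \<subseteq> fst c"
    using open_vimage_map[OF open_Int[OF N.open_chart[OF d(1)] T]] M.open_chart[OF c(1)] c d p
    by (auto simp: S_def)
  have op: "open (snd c ` S)" "open (snd d ` (fst d \<inter> T))"
    using M.open_chart_image[OF c(1) S(1)] N.open_chart_image[OF d(1) T] S(3) by (auto simp: inf.absorb2)
  have "smooth_on (snd d \<circ> F \<circ> chart_inv c) (snd c ` (fst c \<inter> F -` fst d))"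
    using smooth c d by (simp add: smooth_map_def)
  then have sF: "smooth_on (snd d \<circ> F \<circ> chart_inv c) (snd c ` S)"
    by (rule smooth_on_subset) (auto simp: S_def)
  have sf: "smooth_on (f \<circ> chart_inv d) (snd d ` (fst d \<inter> T))"
    using f d by (simp add: msmooth_def)
  have "smooth_on (\<lambda>x. (f \<circ> chart_inv d) ((snd d \<circ> F \<circ> chart_inv c) x)) (snd c ` S)"
    by (rule smooth_on_compose[OF op(2,1) _ sf sF])
      (auto simp: S_def M.chart_inv_chart[OF c(1)])
  then have "smooth_on ((\<lambda>p. f (F p)) \<circ> chart_inv c) (snd c ` S)"
    by (rule smooth_on_cong[OF op(1), rotated])
      (auto simp: S_def M.chart_inv_chart[OF c(1)] N.chart_inv_chart[OF d(1)])
  then show "\<exists>S. open S \<and> p \<in> S \<and> msmooth M (\<lambda>p. f (F p)) S"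
    using M.msmooth_if_chart[OF c(1) S(1,3)] S by blast
qed

lemma smooth_functions_compose: "f \<in> smooth_functions N \<Longrightarrow> (\<lambda>p. f (F p)) \<in> smooth_functions M"
  using msmooth_compose[OF open_UNIV] by (simp add: smooth_functions_iff)

text \<open>The chain rule. The pushforward is expressed in the preferred chart at
  \<open>F p\<close>, the same chart that \<open>mderiv N f (F p)\<close> uses, so no transition map
  enters.\<close>

lemma mderiv_compose:
  assumes T: "open T" "F p \<in> T" and f: "msmooth N f T"
  shows "mderiv M (\<lambda>q. f (F q)) p v = mderiv N f (F p) (pushforward M N F p v)"
proof -
  define c d where "c = chart_at M p" and "d = chart_at N (F p)"
  have c: "c \<in> M" "p \<in> fst c" and d: "d \<in> N" "F p \<in> fst d"
    using M.chart_at N.chart_at by (auto simp: c_def d_def)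
  have "msmooth M (\<lambda>q. snd d (F q)) (F -` fst d)"
    by (rule msmooth_compose[OF N.open_chart[OF d(1)] N.msmooth_chart[OF d(1)]])
  then have dF: "((\<lambda>x. snd d (F (chart_inv c x))) has_derivative pushforward M N F p) (at (snd c p))"
    using M.has_derivative_mderiv[OF open_vimage_map[OF N.open_chart[OF d(1)]], of p "\<lambda>q. snd d (F q)"] d(2)
    by (simp add: pushforward_def c_def d_def o_def)
  have df: "((f \<circ> chart_inv d) has_derivative mderiv N f (F p)) (at (snd d (F p)))"
    using N.has_derivative_mderiv[OF T f] by (simp add: d_def)
  have "((\<lambda>x. (f \<circ> chart_inv d) (snd d (F (chart_inv c x)))) has_derivative
      (\<lambda>v. mderiv N f (F p) (pushforward M N F p v))) (at (snd c p))"
    by (rule has_derivative_compose[OF dF]) (simp only: M.chart_inv_chart[OF c] df)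
  then have "(((\<lambda>q. f (F q)) \<circ> chart_inv c) has_derivative
      (\<lambda>v. mderiv N f (F p) (pushforward M N F p v))) (at (snd c p))"
  proof (rule has_derivative_transform_within_open)
    show "open (snd c ` (fst c \<inter> F -` fst d))"
      by (rule M.open_chart_image[OF c(1) open_vimage_map[OF N.open_chart[OF d(1)]]])
    show "snd c p \<in> snd c ` (fst c \<inter> F -` fst d)"
      using c d by blast
  qed (auto simp: M.chart_inv_chart[OF c(1)] N.chart_inv_chart[OF d(1)])
  then have "mderiv M (\<lambda>q. f (F q)) p = (\<lambda>v. mderiv N f (F p) (pushforward M N F p v))"
    unfolding c_def by (rule M.mderiv_eqI)
  then show ?thesis
    by simp
qed

lemma linear_pushforward: "linear (pushforward M N F p)"
proof -
  define d where "d = chart_at N (F p)"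
  have d: "d \<in> N" "F p \<in> fst d"
    using N.chart_at by (auto simp: d_def)
  have "msmooth M (\<lambda>q. snd d (F q)) (F -` fst d)"
    by (rule msmooth_compose[OF N.open_chart[OF d(1)] N.msmooth_chart[OF d(1)]])
  then have "linear (mderiv M (\<lambda>q. snd d (F q)) p)"
    using M.linear_mderiv[OF open_vimage_map[OF N.open_chart[OF d(1)]]] d(2) by blast
  then show ?thesis
    by (simp add: pushforward_def d_def o_def)
qed

section \<open>Sections along a smooth map\<close>

lemma sections_along_iff:
  "s \<in> sections_along M N F \<longleftrightarrow> (\<forall>d\<in>N. msmooth M (\<lambda>p. mderiv N (snd d) (F p) (s p)) (F -` fst d))"
  unfolding sections_along_def msmooth_def by blast

lemma pushforward_section:
  assumes U: "U \<in> vector_fields M"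
  shows "(\<lambda>p. pushforward M N F p (U p)) \<in> sections_along M N F"
  unfolding sections_along_iff
proof
  fix d assume d: "d \<in> N"
  note od = N.open_chart[OF d] and md = N.msmooth_chart[OF d]
  have "msmooth M (\<lambda>p. mderiv M (\<lambda>q. snd d (F q)) p (U p)) (F -` fst d)"
    by (rule M.msmooth_mderiv[OF open_vimage_map[OF od] msmooth_compose[OF od md] U])
  then show "msmooth M (\<lambda>p. mderiv N (snd d) (F p) (pushforward M N F p (U p))) (F -` fst d)"
    by (rule M.msmooth_cong[OF open_vimage_map[OF od], rotated]) (simp add: mderiv_compose[OF od _ md])
qed

lemma sections_add:
  assumes "s \<in> sections_along M N F" "s' \<in> sections_along M N F"
  shows "(\<lambda>p. s p + s' p) \<in> sections_along M N F"
  unfolding sections_along_iff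
proof
  fix d assume d: "d \<in> N"
  note od = open_vimage_map[OF N.open_chart[OF d]]
  have "msmooth M (\<lambda>p. mderiv N (snd d) (F p) (s p) + mderiv N (snd d) (F p) (s' p)) (F -` fst d)"
    by (rule M.msmooth_add[OF od]) (use assms d in \<open>auto simp: sections_along_iff\<close>)
  then show "msmooth M (\<lambda>p. mderiv N (snd d) (F p) (s p + s' p)) (F -` fst d)"
    by (rule M.msmooth_cong[OF od, rotated]) (simp add: linear_add[OF N.linear_mderiv_chart[OF d]])
qed

lemma sections_scaleR:
  assumes "f \<in> smooth_functions M" "s \<in> sections_along M N F"
  shows "(\<lambda>p. f p *\<^sub>R s p) \<in> sections_along M N F"
  unfolding sections_along_iff
proof
  fix d assume d: "d \<in> N"
  note od = open_vimage_map[OF N.open_chart[OF d]]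
  have "msmooth M f (F -` fst d)" "msmooth M (\<lambda>p. mderiv N (snd d) (F p) (s p)) (F -` fst d)"
    using assms d by (auto simp: smooth_functions_iff sections_along_iff intro: msmooth_subset)
  then have "msmooth M (\<lambda>p. f p *\<^sub>R mderiv N (snd d) (F p) (s p)) (F -` fst d)"
    by (rule M.msmooth_bounded_bilinear[OF bounded_bilinear_scaleR od])
  then show "msmooth M (\<lambda>p. mderiv N (snd d) (F p) (f p *\<^sub>R s p)) (F -` fst d)"
    by (rule M.msmooth_cong[OF od, rotated]) (simp add: linear_scale[OF N.linear_mderiv_chart[OF d]])
qed

lemma sections_compose:
  assumes "Y \<in> vector_fields N"
  shows "Y \<circ> F \<in> sections_along M N F"
  unfolding sections_along_iff
proof
  fix d assume d: "d \<in> N"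
  have "msmooth N (\<lambda>q. mderiv N (snd d) q (Y q)) (fst d)"
    using assms d by (simp add: N.vector_fields_iff)
  from msmooth_compose[OF N.open_chart[OF d] this]
  show "msmooth M (\<lambda>p. mderiv N (snd d) (F p) ((Y \<circ> F) p)) (F -` fst d)"
    by simp
qed

lemma sections_0: "(\<lambda>p. 0) \<in> sections_along M N F"
  using sections_scaleR[OF M.smooth_functions_const[of 0] sections_compose[OF N.vector_fields_0]] by simp

lemma sections_sum:
  assumes "finite A" "\<And>a. a \<in> A \<Longrightarrow> s a \<in> sections_along M N F"
  shows "(\<lambda>p. \<Sum>a\<in>A. s a p) \<in> sections_along M N F"
  using assms by (induction A rule: finite_induct) (simp_all add: sections_0 sections_add)

text \<open>Up to the factor \<open>\<phi> (F q)\<close>, pushforwards become combinations of the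
  sections \<open>Y i \<circ> F\<close>, and on compositions of this kind the pullback connection is
  prescribed through \<open>DN\<close>.\<close>

lemma pushforward_expand:
  assumes fr: "local_frame N r \<phi> y Y"
  shows "\<phi> (F q) *\<^sub>R pushforward M N F q v = (\<Sum>i\<in>Basis. mderiv M (\<lambda>q. y i (F q)) q v *\<^sub>R Y i (F q))"
  unfolding local_frameD(4)[OF fr]
  using mderiv_compose[OF open_UNIV UNIV_I local_frameD(2)[OF fr, unfolded smooth_functions_iff]]
  by simp

end

locale pullback_geometry = smooth_manifold_map M N F + N: riemannian_manifold N h DN
  for M :: "('m::{t2_space, second_countable_topology}, 'e::euclidean_space) chart set"
    and N :: "('n::{t2_space, second_countable_topology}, 'f::euclidean_space) chart set"
    and F :: "'m \<Rightarrow> 'n" and h DN +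
  fixes DF :: "('m \<Rightarrow> 'e) \<Rightarrow> ('m \<Rightarrow> 'f) \<Rightarrow> 'm \<Rightarrow> 'f"
  assumes pullback: "pullback_connection M N F DN DF"
begin

lemmas
  DF_add_left = pullback[unfolded pullback_connection_def, THEN conjunct2, THEN conjunct1, rule_format] and
  DF_add = pullback[unfolded pullback_connection_def, THEN conjunct2, THEN conjunct2, THEN conjunct2,
    THEN conjunct1, rule_format] and
  DF_scaleR = pullback[unfolded pullback_connection_def, THEN conjunct2, THEN conjunct2,
    THEN conjunct2, THEN conjunct2, THEN conjunct1, rule_format] and
  DF_compose = pullback[unfolded pullback_connection_def, THEN conjunct2, THEN conjunct2,
    THEN conjunct2, THEN conjunct2, THEN conjunct2, rule_format]

lemma DF_0: "U \<in> vector_fields M \<Longrightarrow> DF U (\<lambda>q. 0) p = 0"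
  using DF_scaleR[OF M.smooth_functions_const[of 0] _ sections_0, of U p] by (simp add: M.mderiv_const)

lemma DF_sum:
  assumes "U \<in> vector_fields M" "finite A" "\<And>a. a \<in> A \<Longrightarrow> s a \<in> sections_along M N F"
  shows "DF U (\<lambda>q. \<Sum>a\<in>A. s a q) p = (\<Sum>a\<in>A. DF U (s a) p)"
  using assms(2,3)
proof (induction A rule: finite_induct)
  case empty
  then show ?case
    by (simp add: DF_0[OF assms(1)])
next
  case (insert a A)
  have "DF U (\<lambda>q. s a q + (\<Sum>a\<in>A. s a q)) p = DF U (s a) p + DF U (\<lambda>q. \<Sum>a\<in>A. s a q) p"
    by (rule DF_add) (use insert assms(1) in \<open>auto intro!: sections_sum\<close>)
  then show ?case
    using insert by simp
qed

text \<open>The coordinate formula for the covariant derivative of a pushforward, with the fields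
  \<open>DN Z (Y i)\<close> in the role of Christoffel terms.\<close>

lemma DF_pushforward:
  assumes fr: "local_frame N (F p) \<phi> y Y"
    and U: "U \<in> vector_fields M" and W: "W \<in> vector_fields M"
    and Z: "Z \<in> vector_fields N" "Z (F p) = pushforward M N F p (U p)"
  shows "DF U (\<lambda>q. pushforward M N F q (W q)) p =
    (\<Sum>i\<in>Basis. mderiv M (\<lambda>q. mderiv M (\<lambda>q. y i (F q)) q (W q)) p (U p) *\<^sub>R Y i (F p) +
      mderiv M (\<lambda>q. y i (F q)) p (W p) *\<^sub>R DN Z (Y i) (F p))"
proof -
  obtain T where T: "open T" "F p \<in> T" "\<And>q. q \<in> T \<Longrightarrow> \<phi> q = 1"
    using local_frameD(1)[OF fr] by blast
  let ?s = "\<lambda>q. pushforward M N F q (W q)"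
  let ?a = "\<lambda>i q. mderiv M (\<lambda>q. y i (F q)) q (W q)"
  have a: "?a i \<in> smooth_functions M" for i
    by (rule M.smooth_functions_mderiv[OF smooth_functions_compose[OF local_frameD(2)[OF fr]] W])
  have sec: "(\<lambda>q. ?a i q *\<^sub>R (Y i \<circ> F) q) \<in> sections_along M N F" for i
    by (rule sections_scaleR[OF a sections_compose[OF local_frameD(3)[OF fr]]])
  \<comment> \<open>The cut-off is 1 near \<open>p\<close>, so its derivative drops out of the
    Leibniz rule and multiplying the section by it does not affect the covariant derivative at
    \<open>p\<close>.\<close>
  have dphi: "mderiv M (\<lambda>q. \<phi> (F q)) p = mderiv M (\<lambda>q. 1 :: real) p"
    by (rule M.mderiv_cong[OF open_vimage_map[OF T(1)]]) (use T in auto)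
  have "DF U (\<lambda>q. \<phi> (F q) *\<^sub>R ?s q) p = DF U ?s p"
    using DF_scaleR[OF smooth_functions_compose[OF N.local_frame_smooth[OF fr]] U pushforward_section[OF W], of p]
    by (simp add: dphi M.mderiv_const local_frameD(5)[OF fr])
  moreover have "(\<lambda>q. \<phi> (F q) *\<^sub>R ?s q) = (\<lambda>q. \<Sum>i\<in>Basis. ?a i q *\<^sub>R (Y i \<circ> F) q)"
    by (simp add: pushforward_expand[OF fr])
  ultimately have "DF U ?s p = DF U (\<lambda>q. \<Sum>i\<in>Basis. ?a i q *\<^sub>R (Y i \<circ> F) q) p"
    by simp
  also have "\<dots> = (\<Sum>i\<in>Basis. DF U (\<lambda>q. ?a i q *\<^sub>R (Y i \<circ> F) q) p)"
    by (rule DF_sum[OF U finite_Basis sec])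
  also have "\<dots> = (\<Sum>i\<in>Basis. mderiv M (?a i) p (U p) *\<^sub>R (Y i \<circ> F) p + ?a i p *\<^sub>R DF U (Y i \<circ> F) p)"
    by (intro sum.cong refl DF_scaleR[OF a U sections_compose[OF local_frameD(3)[OF fr]]])
  finally show ?thesis
    by (simp add: DF_compose[OF U local_frameD(3)[OF fr] Z])
qed

text \<open>\<open>DF_compose\<close> asks for a global field on \<open>N\<close> extending a
  pushed-forward vector; one with constant coefficients in the frame also lets \<open>DN\<close>
  expand by linearity in its direction.\<close>

lemma frame_field:
  fixes v :: 'e
  assumes fr: "local_frame N (F p) \<phi> y Y"
  defines "Z \<equiv> \<lambda>r. \<Sum>j\<in>Basis. mderiv M (\<lambda>q. y j (F q)) p v *\<^sub>R Y j r"
  shows "Z \<in> vector_fields N" "Z (F p) = pushforward M N F p v"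
    "W \<in> vector_fields N \<Longrightarrow>
      DN Z W (F p) = (\<Sum>j\<in>Basis. mderiv M (\<lambda>q. y j (F q)) p v *\<^sub>R DN (Y j) W (F p))"
proof -
  have Y: "(\<lambda>r. mderiv M (\<lambda>q. y j (F q)) p v *\<^sub>R Y j r) \<in> vector_fields N" for j
    by (rule N.vector_fields_scaleR[OF N.smooth_functions_const local_frameD(3)[OF fr]])
  show "Z \<in> vector_fields N"
    unfolding Z_def by (rule N.vector_fields_sum[OF finite_Basis Y])
  show "Z (F p) = pushforward M N F p v"
    unfolding Z_def pushforward_expand[OF fr, symmetric] by (simp add: local_frameD(5)[OF fr])
  show "DN Z W (F p) = (\<Sum>j\<in>Basis. mderiv M (\<lambda>q. y j (F q)) p v *\<^sub>R DN (Y j) W (F p))"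
    if "W \<in> vector_fields N"
    unfolding Z_def N.D_sum_left[OF finite_Basis Y that]
    by (intro sum.cong refl N.D_scaleR_left[OF N.smooth_functions_const local_frameD(3)[OF fr] that])
qed

text \<open>The terms with \<open>DN (Y j) (Y i)\<close> form a symmetric double sum, since
  \<open>DN\<close> is torsion-free and the frame fields commute at \<open>F p\<close>. They cancel
  in the difference, and what remains are second derivatives of the functions
  \<open>y i (F q)\<close>, whose commutator is the action of the bracket.\<close>

lemma pullback_torsion_free:
  assumes U: "U \<in> vector_fields M" and W: "W \<in> vector_fields M"
  shows "DF U (\<lambda>q. pushforward M N F q (W q)) p - DF W (\<lambda>q. pushforward M N F q (U q)) p =
    pushforward M N F p (lie_bracket M U W p)"
proof -
  obtain \<phi> y Y where fr: "local_frame N (F p) \<phi> y Y"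
    using N.local_frame_exists by blast
  let ?y = "\<lambda>i q. y i (F q)"
  let ?d = "\<lambda>i V. mderiv M (?y i) p (V p)"
  let ?dd = "\<lambda>i V V'. mderiv M (\<lambda>q. mderiv M (?y i) q (V' q)) p (V p)"
  let ?q = "F p"
  have DF: "DF V (\<lambda>q. pushforward M N F q (V' q)) p =
      (\<Sum>i\<in>Basis. ?dd i V V' *\<^sub>R Y i ?q) + (\<Sum>i\<in>Basis. \<Sum>j\<in>Basis. (?d i V' * ?d j V) *\<^sub>R DN (Y j) (Y i) ?q)"
    if V: "V \<in> vector_fields M" "V' \<in> vector_fields M" for V V'
    unfolding DF_pushforward[OF fr V frame_field(1,2)[OF fr]]
      frame_field(3)[OF fr local_frameD(3)[OF fr]]
    by (simp add: sum.distrib scaleR_sum_right)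
  have "DN (Y i) (Y j) ?q - DN (Y j) (Y i) ?q = 0" if "i \<in> Basis" "j \<in> Basis" for i j
    using N.D_torsion[OF local_frameD(3)[OF fr] local_frameD(3)[OF fr], of i j ?q] N.local_frame_lie_bracket[OF fr that]
    by simp
  then have sym: "DN (Y i) (Y j) ?q = DN (Y j) (Y i) ?q" if "i \<in> Basis" "j \<in> Basis" for i j
    using that by simp
  have "(\<Sum>i\<in>Basis. \<Sum>j\<in>Basis. (?d i W * ?d j U) *\<^sub>R DN (Y j) (Y i) ?q) =
      (\<Sum>j\<in>Basis. \<Sum>i\<in>Basis. (?d i W * ?d j U) *\<^sub>R DN (Y j) (Y i) ?q)"
    by (rule sum.swap)
  also have "\<dots> = (\<Sum>i\<in>Basis. \<Sum>j\<in>Basis. (?d i U * ?d j W) *\<^sub>R DN (Y j) (Y i) ?q)"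
    by (intro sum.cong refl) (simp add: sym mult.commute)
  finally have "DF U (\<lambda>q. pushforward M N F q (W q)) p - DF W (\<lambda>q. pushforward M N F q (U q)) p =
      (\<Sum>i\<in>Basis. ?dd i U W *\<^sub>R Y i ?q) - (\<Sum>i\<in>Basis. ?dd i W U *\<^sub>R Y i ?q)"
    unfolding DF[OF U W] DF[OF W U] by simp
  also have "\<dots> = (\<Sum>i\<in>Basis. (?dd i U W - ?dd i W U) *\<^sub>R Y i ?q)"
    by (simp add: sum_subtractf scaleR_diff_left)
  also have "\<dots> = (\<Sum>i\<in>Basis. mderiv M (?y i) p (lie_bracket M U W p) *\<^sub>R Y i ?q)"
    unfolding M.mderiv_lie_bracket[OF smooth_functions_compose[OF local_frameD(2)[OF fr]] U W] ..
  also have "\<dots> = pushforward M N F p (lie_bracket M U W p)"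
    unfolding pushforward_expand[OF fr, symmetric] by (simp add: local_frameD(5)[OF fr])
  finally show ?thesis .
qed

lemma pushforward_metric_frame:
  assumes fr: "local_frame N (F p) \<phi> y Y" and "\<phi> (F q) = 1"
  shows "h (F q) (pushforward M N F q v) (pushforward M N F q w) = (\<Sum>i\<in>Basis. \<Sum>j\<in>Basis.
    mderiv M (\<lambda>q. y i (F q)) q v * (mderiv M (\<lambda>q. y j (F q)) q w * h (F q) (Y i (F q)) (Y j (F q))))"
proof -
  have e: "pushforward M N F q v = (\<Sum>i\<in>Basis. mderiv M (\<lambda>q. y i (F q)) q v *\<^sub>R Y i (F q))" for v
    using pushforward_expand[OF fr, of q v] by (simp only: assms(2) scaleR_one)
  show ?thesis
    unfolding e linear_sum[OF N.linear_metric_left]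
    unfolding linear_sum[OF N.linear_metric_right]
    by (simp add: N.metric_simps mult.assoc mult.left_commute)
qed

text \<open>Smoothness of \<open>h\<close> concerns fields on \<open>N\<close>, but a pushforward is
  only a section along \<open>F\<close>; the frame reduces the claim to the functions
  \<open>h(Y i, Y j)\<close> composed with \<open>F\<close>.\<close>

lemma smooth_pushforward_metric:
  assumes U: "U \<in> vector_fields M" and W: "W \<in> vector_fields M"
  shows "(\<lambda>q. h (F q) (pushforward M N F q (U q)) (pushforward M N F q (W q))) \<in> smooth_functions M"
  unfolding smooth_functions_iff
proof (rule M.msmooth_local)
  fix p
  obtain \<phi> y Y where fr: "local_frame N (F p) \<phi> y Y"
    using N.local_frame_exists by blast
  obtain T where T: "open T" "F p \<in> T" "\<And>q. q \<in> T \<Longrightarrow> \<phi> q = 1"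
    using local_frameD(1)[OF fr] by blast
  have d: "(\<lambda>q. mderiv M (\<lambda>q. y i (F q)) q (V q)) \<in> smooth_functions M" if "V \<in> vector_fields M" for V i
    by (rule M.smooth_functions_mderiv[OF smooth_functions_compose[OF local_frameD(2)[OF fr]] that])
  have hY: "(\<lambda>q. h (F q) (Y i (F q)) (Y j (F q))) \<in> smooth_functions M" for i j
    by (rule smooth_functions_compose[OF N.smooth_metric[OF local_frameD(3)[OF fr] local_frameD(3)[OF fr]]])
  have "(\<lambda>q. \<Sum>i\<in>Basis. \<Sum>j\<in>Basis. mderiv M (\<lambda>q. y i (F q)) q (U q) *
      (mderiv M (\<lambda>q. y j (F q)) q (W q) * h (F q) (Y i (F q)) (Y j (F q)))) \<in> smooth_functions M"
    by (intro M.smooth_functions_sum finite_Basis M.smooth_functions_mult d U W hY)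
  then have "msmooth M (\<lambda>q. \<Sum>i\<in>Basis. \<Sum>j\<in>Basis. mderiv M (\<lambda>q. y i (F q)) q (U q) *
      (mderiv M (\<lambda>q. y j (F q)) q (W q) * h (F q) (Y i (F q)) (Y j (F q)))) (F -` T)"
    unfolding smooth_functions_iff by (rule msmooth_subset) simp
  then have "msmooth M (\<lambda>q. h (F q) (pushforward M N F q (U q)) (pushforward M N F q (W q))) (F -` T)"
    by (rule M.msmooth_cong[OF open_vimage_map[OF T(1)], rotated])
      (rule pushforward_metric_frame[OF fr, symmetric], simp add: T(3))
  then show "\<exists>S. open S \<and> p \<in> S \<and>
      msmooth M (\<lambda>q. h (F q) (pushforward M N F q (U q)) (pushforward M N F q (W q))) S"
    using open_vimage_map[OF T(1)] T(2) by blast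
qed

text \<open>In the frame the claim becomes the Leibniz rule for three factors, where compatibility
  of \<open>DN\<close> with \<open>h\<close> supplies the derivative of
  \<open>h(Y i, Y j)\<close>.\<close>

lemma pullback_metric:
  assumes U: "U \<in> vector_fields M" and V: "V \<in> vector_fields M" and W: "W \<in> vector_fields M"
  shows "mderiv M (\<lambda>q. h (F q) (pushforward M N F q (V q)) (pushforward M N F q (W q))) p (U p) =
    h (F p) (DF U (\<lambda>q. pushforward M N F q (V q)) p) (pushforward M N F p (W p)) +
    h (F p) (pushforward M N F p (V p)) (DF U (\<lambda>q. pushforward M N F q (W q)) p)"
proof -
  obtain \<phi> y Y where fr: "local_frame N (F p) \<phi> y Y"
    using N.local_frame_exists by blast
  obtain T where T: "open T" "F p \<in> T" "\<And>q. q \<in> T \<Longrightarrow> \<phi> q = 1"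
    using local_frameD(1)[OF fr] by blast
  note Y = local_frameD(3)[OF fr]
  let ?a = "\<lambda>V i q. mderiv M (\<lambda>q. y i (F q)) q (V q)"
  let ?h = "\<lambda>i j r. h r (Y i r) (Y j r)"
  let ?q = "F p"
  have a: "msmooth M (?a V i) UNIV" if "V \<in> vector_fields M" for V i
    using M.smooth_functions_mderiv[OF smooth_functions_compose[OF local_frameD(2)[OF fr]] that]
    by (simp only: smooth_functions_iff)
  have sh: "msmooth N (?h i j) UNIV" for i j
    using N.smooth_metric[OF Y Y] by (simp only: smooth_functions_iff)
  have hF: "msmooth M (\<lambda>q. ?h i j (F q)) UNIV" for i j
    using msmooth_compose[OF open_UNIV sh] by simp
  have ah: "msmooth M (\<lambda>q. ?a W j q * ?h i j (F q)) UNIV" for i j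
    by (rule M.msmooth_bounded_bilinear[OF bounded_bilinear_mult open_UNIV a[OF W] hF])
  have aah: "msmooth M (\<lambda>q. ?a V i q * (?a W j q * ?h i j (F q))) UNIV" for i j
    by (rule M.msmooth_bounded_bilinear[OF bounded_bilinear_mult open_UNIV a[OF V] ah])
  define Z where "Z r = (\<Sum>j\<in>Basis. mderiv M (\<lambda>q. y j (F q)) p (U p) *\<^sub>R Y j r)" for r
  have Z: "Z \<in> vector_fields N" "Z ?q = pushforward M N F p (U p)"
    unfolding Z_def using frame_field(1,2)[OF fr] by blast+
  \<comment> \<open>By the chain rule the derivative along \<open>U p\<close> of a function composed
    with \<open>F\<close> is its derivative along \<open>Z\<close> at \<open>F p\<close>, so the
    metric property of \<open>DN\<close> applies.\<close>
  have dh: "mderiv M (\<lambda>q. ?h i j (F q)) p (U p) =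
      h ?q (DN Z (Y i) ?q) (Y j ?q) + h ?q (Y i ?q) (DN Z (Y j) ?q)" for i j
    using mderiv_compose[OF open_UNIV UNIV_I sh, where p = p and v = "U p"] N.D_metric[OF Z(1) Y Y]
    by (simp add: Z(2)[symmetric])
  let ?V = "\<lambda>i. mderiv M (?a V i) p (U p)" and ?W = "\<lambda>i. mderiv M (?a W i) p (U p)"
  have "mderiv M (\<lambda>q. h (F q) (pushforward M N F q (V q)) (pushforward M N F q (W q))) p =
      mderiv M (\<lambda>q. \<Sum>i\<in>Basis. \<Sum>j\<in>Basis. ?a V i q * (?a W j q * ?h i j (F q))) p"
    by (rule M.mderiv_cong[OF open_vimage_map[OF T(1)]])
      (use T in \<open>auto intro!: pushforward_metric_frame[OF fr]\<close>)
  then have "mderiv M (\<lambda>q. h (F q) (pushforward M N F q (V q)) (pushforward M N F q (W q))) p (U p) =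
      (\<Sum>i\<in>Basis. \<Sum>j\<in>Basis. mderiv M (\<lambda>q. ?a V i q * (?a W j q * ?h i j (F q))) p (U p))"
    by (simp add: M.mderiv_sum[OF open_UNIV UNIV_I finite_Basis] M.msmooth_sum[OF open_UNIV finite_Basis] aah)
  also have "\<dots> = (\<Sum>i\<in>Basis. \<Sum>j\<in>Basis. ?a V i p * ?a W j p *
        (h ?q (DN Z (Y i) ?q) (Y j ?q) + h ?q (Y i ?q) (DN Z (Y j) ?q)) +
      ?a V i p * ?W j * ?h i j ?q + ?V i * ?a W j p * ?h i j ?q)"
    unfolding M.mderiv_mult[OF open_UNIV UNIV_I a[OF V] ah] M.mderiv_mult[OF open_UNIV UNIV_I a[OF W] hF] dh
    by (simp add: algebra_simps)
  also have "\<dots> =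
      h ?q (\<Sum>i\<in>Basis. ?V i *\<^sub>R Y i ?q + ?a V i p *\<^sub>R DN Z (Y i) ?q) (\<Sum>j\<in>Basis. ?a W j p *\<^sub>R Y j ?q) +
      h ?q (\<Sum>i\<in>Basis. ?a V i p *\<^sub>R Y i ?q) (\<Sum>j\<in>Basis. ?W j *\<^sub>R Y j ?q + ?a W j p *\<^sub>R DN Z (Y j) ?q)"
    unfolding linear_sum[OF N.linear_metric_left]
    unfolding linear_sum[OF N.linear_metric_right] sum.distrib[symmetric]
    by (intro sum.cong refl) (simp add: N.metric_simps algebra_simps)
  finally show ?thesis
    unfolding DF_pushforward[OF fr U V Z] DF_pushforward[OF fr U W Z]
      pushforward_expand[OF fr, symmetric] local_frameD(5)[OF fr] by simp
qed

end

section \<open>Riemannian submersions\<close>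

locale riemannian_submersion_geometry =
  M: riemannian_manifold M g D + pullback_geometry M N F h DN DF
  for M :: "('m::{t2_space, second_countable_topology}, 'e::euclidean_space) chart set"
    and g D
    and N :: "('n::{t2_space, second_countable_topology}, 'f::euclidean_space) chart set"
    and F h DN DF +
  assumes submersion: "riemannian_submersion M N g h F"
begin

abbreviation "pf \<equiv> pushforward M N F"
abbreviation "vert \<equiv> vertical M N F"
abbreviation "horiz \<equiv> horizontal M N g F"
abbreviation "vproj \<equiv> ver M N g F"
abbreviation "hproj \<equiv> hor M N g F"
abbreviation "sff \<equiv> second_fundamental_form M N D DF F"

lemmas pf_simps =
  linear_add[OF linear_pushforward] linear_diff[OF linear_pushforward]
  linear_scale[OF linear_pushforward] linear_neg[OF linear_pushforward]
  linear_0[OF linear_pushforward]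

section \<open>Horizontal and vertical projections\<close>

lemma vertical_iff: "v \<in> vert p \<longleftrightarrow> pf p v = 0"
  by (simp add: vertical_def)

lemma subspace_vertical: "subspace (vert p)"
  unfolding vertical_def by (rule linear_subspace_kernel[OF linear_pushforward])

lemma subspace_horizontal: "subspace (horiz p)"
  by (auto simp: subspace_def horizontal_def M.metric_simps)

lemma metric_horizontal_vertical: "v \<in> horiz p \<Longrightarrow> w \<in> vert p \<Longrightarrow> g p v w = 0"
  by (simp add: horizontal_def)

lemma vertical_horizontal_0: "v \<in> vert p \<Longrightarrow> v \<in> horiz p \<Longrightarrow> v = 0"
  using metric_horizontal_vertical M.metric_self_eq_0 by blast

lemma metric_pushforward: "v \<in> horiz p \<Longrightarrow> w \<in> horiz p \<Longrightarrow> h (F p) (pf p v) (pf p w) = g p v w"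
  using submersion by (simp add: riemannian_submersion_def)

lemma horizontal_lift: "\<exists>v\<in>horiz p. pf p v = w"
proof -
  have "pf p ` horiz p = UNIV"
    using submersion by (simp add: riemannian_submersion_def)
  then show ?thesis
    by (metis UNIV_I imageE)
qed

lemma vproj_eqI:
  assumes "v \<in> vert p" "U p - v \<in> horiz p"
  shows "vproj U p = v"
  unfolding ver_def
proof (rule the_equality)
  fix w assume w: "w \<in> vert p \<and> U p - w \<in> horiz p"
  have "w - v \<in> vert p"
    using subspace_diff[OF subspace_vertical] w assms by blast
  moreover have "(U p - v) - (U p - w) \<in> horiz p"
    by (rule subspace_diff[OF subspace_horizontal]) (use w assms in auto)
  ultimately have "w - v = 0"
    by (intro vertical_horizontal_0) simp_all
  then show "w = v"
    by simp
qed (use assms in blast)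

text \<open>The horizontal lift of the pushforward of \<open>U p\<close> yields the existence half
  of the definite description in \<open>ver\<close>: subtracting it from \<open>U p\<close> leaves a
  vertical vector.\<close>

lemma
  shows vproj_vertical: "vproj U p \<in> vert p" and hproj_horizontal: "hproj U p \<in> horiz p"
proof -
  obtain x where x: "x \<in> horiz p" "pf p x = pf p (U p)"
    using horizontal_lift by blast
  then have v: "U p - x \<in> vert p" "U p - (U p - x) \<in> horiz p"
    by (simp_all add: vertical_iff pf_simps)
  then have "vproj U p = U p - x"
    by (rule vproj_eqI)
  then show "vproj U p \<in> vert p" "hproj U p \<in> horiz p"
    using v by (simp_all add: hor_def)
qed

lemma hproj_add_vproj: "U p = hproj U p + vproj U p"
  by (simp add: hor_def)

lemma pf_hproj: "pf p (hproj U p) = pf p (U p)"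
  using vproj_vertical[of U p] by (simp add: hor_def pf_simps vertical_iff)

lemma vproj_of_vertical: "U p \<in> vert p \<Longrightarrow> vproj U p = U p"
  by (rule vproj_eqI) (simp_all add: subspace_0[OF subspace_horizontal])

lemma vproj_of_horizontal: "U p \<in> horiz p \<Longrightarrow> vproj U p = 0"
  by (rule vproj_eqI) (simp_all add: subspace_0[OF subspace_vertical])

lemma hproj_of_vertical: "U p \<in> vert p \<Longrightarrow> hproj U p = 0"
  by (simp add: hor_def vproj_of_vertical)

lemma hproj_of_horizontal: "U p \<in> horiz p \<Longrightarrow> hproj U p = U p"
  by (simp add: hor_def vproj_of_horizontal)

lemma hproj_eq_0_iff: "hproj U p = 0 \<longleftrightarrow> U p \<in> vert p"
  by (metis hproj_of_vertical pf_hproj vertical_iff linear_0[OF linear_pushforward])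

lemma vproj_eq_0_iff: "vproj U p = 0 \<longleftrightarrow> U p \<in> horiz p"
  using vproj_of_horizontal hproj_horizontal[of U p] by (auto simp: hor_def)

text \<open>The vertical part of \<open>v\<close> is orthogonal to \<open>x\<close> and is killed by
  the pushforward, so the isometry formula needs just one horizontal argument.\<close>

lemma metric_horizontal_pf:
  assumes "x \<in> horiz p"
  shows "g p v x = h (F p) (pf p v) (pf p x)"
proof -
  let ?U = "\<lambda>_. v"
  have "g p v x = g p (hproj ?U p) x + g p (vproj ?U p) x"
    by (simp add: hor_def M.metric_simps)
  also have "g p (vproj ?U p) x = 0"
    using metric_horizontal_vertical[OF assms vproj_vertical] M.metric_sym by metis
  also have "g p (hproj ?U p) x = h (F p) (pf p v) (pf p x)"
    using metric_pushforward[OF hproj_horizontal assms, of ?U] by (simp add: pf_hproj)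
  finally show ?thesis
    by simp
qed

text \<open>
  In a local orthogonal frame \<open>E\<close> the coefficients of the horizontal part \<open>X\<close> of \<open>U\<close> are
  \<open>g(X, E i) / g(E i, E i)\<close>, and \<open>g(X, E i) = h(F\<^sub>* U, F\<^sub>* (E i))\<close> is smooth.
\<close>

lemma hproj_vector_field:
  assumes U: "U \<in> vector_fields M"
  shows "hproj U \<in> vector_fields M"
proof (rule M.vector_fields_local)
  fix p
  let ?n = "DIM('e)"
  obtain E T where T: "open T" "p \<in> T" and E: "\<And>i. i < ?n \<Longrightarrow> E i \<in> vector_fields M"
    and ne: "\<And>q i. q \<in> T \<Longrightarrow> i < ?n \<Longrightarrow> E i q \<noteq> 0"
    and orth: "\<And>q i j. q \<in> T \<Longrightarrow> i < ?n \<Longrightarrow> j < ?n \<Longrightarrow> i \<noteq> j \<Longrightarrow> g q (E i q) (E j q) = 0"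
    using M.orthogonal_fields_exist[OF order_refl, of p] by metis
  have "\<exists>r S. r \<in> smooth_functions M \<and> open S \<and> p \<in> S \<and> (\<forall>q\<in>S. r q * g q (E i q) (E i q) = 1)"
    if i: "i < ?n" for i
  proof -
    have "g p (E i p) (E i p) \<noteq> 0"
      using ne[OF T(2) i] by (simp add: M.metric_self_eq_0)
    then obtain r S where "r \<in> smooth_functions M" "open S" "p \<in> S"
      "\<And>q. q \<in> S \<Longrightarrow> r q * g q (E i q) (E i q) = 1"
      by (rule M.local_inverse_exists[OF M.smooth_metric[OF E[OF i] E[OF i]], where p = p]) (rule that)
    then show ?thesis
      by blast
  qed
  then obtain r S where r: "\<And>i. i < ?n \<Longrightarrow> r i \<in> smooth_functions M"
    and S: "\<And>i. i < ?n \<Longrightarrow> open (S i)" "\<And>i. i < ?n \<Longrightarrow> p \<in> S i"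
      "\<And>i q. i < ?n \<Longrightarrow> q \<in> S i \<Longrightarrow> r i q * g q (E i q) (E i q) = 1"
    by metis
  define W where "W q = (\<Sum>i<?n. (h (F q) (pf q (U q)) (pf q (E i q)) * r i q) *\<^sub>R E i q)" for q
  have W: "W \<in> vector_fields M"
    unfolding W_def
    by (intro M.vector_fields_sum M.vector_fields_scaleR M.smooth_functions_mult
        smooth_pushforward_metric U finite_lessThan) (auto intro: E r)
  define T' where "T' = T \<inter> (\<Inter>i<?n. S i)"
  have "hproj U q = W q" if q: "q \<in> T'" for q
  proof -
    have qT: "q \<in> T" and qS: "\<And>i. i < ?n \<Longrightarrow> q \<in> S i"
      using q by (auto simp: T'_def)
    have "hproj U q = (\<Sum>i<?n. (g q (hproj U q) (E i q) / g q (E i q) (E i q)) *\<^sub>R E i q)"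
      by (rule M.orthogonal_expansion) (use ne[OF qT] orth[OF qT] in auto)
    also have "\<dots> = W q"
      unfolding W_def
    proof (rule sum.cong)
      fix i assume "i \<in> {..<?n}"
      then have i: "i < ?n"
        by simp
      have "g q (hproj U q) (E i q) = h (F q) (pf q (U q)) (pf q (E i q))"
        using metric_horizontal_pf[OF hproj_horizontal, of q "E i q" U]
          M.metric_sym[of q "E i q"] N.metric_sym[of "F q" "pf q (E i q)"] by (simp add: pf_hproj)
      moreover have "inverse (g q (E i q) (E i q)) = r i q"
        using S(3)[OF i qS[OF i]] by (metis inverse_unique mult.commute)
      ultimately show "(g q (hproj U q) (E i q) / g q (E i q) (E i q)) *\<^sub>R E i q =
          (h (F q) (pf q (U q)) (pf q (E i q)) * r i q) *\<^sub>R E i q"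
        by (simp add: divide_inverse)
    qed simp
    finally show ?thesis .
  qed
  moreover have "open T'" "p \<in> T'"
    using T S(1,2) by (auto simp: T'_def intro!: open_Int open_INT)
  ultimately show "\<exists>S W. open S \<and> p \<in> S \<and> W \<in> vector_fields M \<and> (\<forall>q\<in>S. hproj U q = W q)"
    using W by blast
qed

lemma vproj_vector_field: "U \<in> vector_fields M \<Longrightarrow> vproj U \<in> vector_fields M"
  using M.vector_fields_diff[OF _ hproj_vector_field, of U U] by (simp add: hor_def)

lemma hproj_horizontal_field: "U \<in> vector_fields M \<Longrightarrow> hproj U \<in> horizontal_fields M N g F"
  by (simp add: horizontal_fields_def hproj_vector_field hproj_horizontal)

lemma vproj_vertical_field: "U \<in> vector_fields M \<Longrightarrow> vproj U \<in> vertical_fields M N F"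
  by (simp add: vertical_fields_def vproj_vector_field vproj_vertical)

section \<open>The second fundamental form of a Riemannian submersion\<close>

lemma sff_add_left:
  "U \<in> vector_fields M \<Longrightarrow> U' \<in> vector_fields M \<Longrightarrow> W \<in> vector_fields M \<Longrightarrow>
    sff (\<lambda>q. U q + U' q) W p = sff U W p + sff U' W p"
  by (simp add: second_fundamental_form_def DF_add_left[OF _ _ pushforward_section] M.D_add_left pf_simps)

lemma sff_add_right:
  "U \<in> vector_fields M \<Longrightarrow> W \<in> vector_fields M \<Longrightarrow> W' \<in> vector_fields M \<Longrightarrow>
    sff U (\<lambda>q. W q + W' q) p = sff U W p + sff U W' p"
  by (simp add: second_fundamental_form_def pf_simps M.D_add_right
      DF_add[OF _ pushforward_section pushforward_section])

text \<open>Exchanging the arguments changes the \<open>DF\<close> term and the pushed-forward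
  \<open>D\<close> term by the same amount, the pushforward of the bracket.\<close>

lemma sff_sym:
  assumes "U \<in> vector_fields M" "W \<in> vector_fields M"
  shows "sff U W p = sff W U p"
  using pullback_torsion_free[OF assms, of p] M.D_torsion[OF assms, of p, symmetric]
  by (simp add: second_fundamental_form_def pf_simps algebra_simps)

lemma sff_vertical:
  assumes "U \<in> vector_fields M" "V \<in> vertical_fields M N F"
  shows "sff U V p = - pf p (D U V p)"
  using assms DF_0[OF assms(1)] by (simp add: second_fundamental_form_def vertical_fields_def vertical_iff)

text \<open>On horizontal fields \<open>h\<close> of the pushforwards equals \<open>g\<close>.
  Differentiating this identity along \<open>X\<close>, with \<open>DF\<close> on one side and
  \<open>D\<close> on the other, leaves exactly the two terms in the second fundamental
  form.\<close>

lemma sff_horizontal_skew: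
  assumes X: "X \<in> vector_fields M" and Y: "Y \<in> horizontal_fields M N g F"
    and Z: "Z \<in> horizontal_fields M N g F"
  shows "h (F p) (sff X Y p) (pf p (Z p)) = - h (F p) (sff X Z p) (pf p (Y p))"
proof -
  have YZ: "Y \<in> vector_fields M" "Z \<in> vector_fields M"
    and Yh: "Y q \<in> horiz q" and Zh: "Z q \<in> horiz q" for q
    using Y Z by (auto simp: horizontal_fields_def)
  have "(\<lambda>q. h (F q) (pf q (Y q)) (pf q (Z q))) = (\<lambda>q. g q (Y q) (Z q))"
    by (simp add: metric_pushforward Yh Zh)
  then have "h (F p) (DF X (\<lambda>q. pf q (Y q)) p) (pf p (Z p)) + h (F p) (pf p (Y p)) (DF X (\<lambda>q. pf q (Z q)) p) =
      g p (D X Y p) (Z p) + g p (Y p) (D X Z p)"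
    using pullback_metric[OF X YZ, of p] M.D_metric[OF X YZ, of p] by simp
  moreover have "g p (Y p) (D X Z p) = h (F p) (pf p (D X Z p)) (pf p (Y p))"
    using metric_horizontal_pf[OF Yh] M.metric_sym by metis
  ultimately show ?thesis
    using N.metric_sym[of "F p" "pf p (Y p)"] metric_horizontal_pf[OF Zh, of p "D X Y p"]
    by (simp add: second_fundamental_form_def N.metric_simps)
qed

text \<open>
  The trilinear form \<open>h(sff X Y, F\<^sub>* Z)\<close> is symmetric in \<open>X, Y\<close> and skew in \<open>Y, Z\<close>, hence zero.
\<close>

lemma sff_horizontal:
  assumes X: "X \<in> horizontal_fields M N g F" and Y: "Y \<in> horizontal_fields M N g F"
  shows "sff X Y p = 0"
proof -
  have vf: "V \<in> vector_fields M" if "V \<in> horizontal_fields M N g F" for V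
    using that by (simp add: horizontal_fields_def)
  let ?S = "\<lambda>X Y Z. h (F p) (sff X Y p) (pf p (Z p))"
  have 0: "?S X Y Z = 0" if Z: "Z \<in> horizontal_fields M N g F" for Z
  proof -
    have "?S X Y Z = - ?S X Z Y"
      by (rule sff_horizontal_skew[OF vf[OF X] Y Z])
    also have "\<dots> = - ?S Z X Y"
      by (simp add: sff_sym[OF vf[OF X] vf[OF Z]])
    also have "\<dots> = ?S Z Y X"
      using sff_horizontal_skew[OF vf[OF Z] X Y, of p] by simp
    also have "\<dots> = ?S Y Z X"
      by (simp add: sff_sym[OF vf[OF Z] vf[OF Y]])
    also have "\<dots> = - ?S Y X Z"
      by (rule sff_horizontal_skew[OF vf[OF Y] Z X])
    also have "\<dots> = - ?S X Y Z"
      by (simp add: sff_sym[OF vf[OF Y] vf[OF X]])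
    finally show ?thesis
      by simp
  qed
  \<comment> \<open>The test vector is a horizontal lift of \<open>sff X Y p\<close> itself, so that
    positive definiteness of \<open>h\<close> finishes; the horizontal projection of any field
    through it is a horizontal field with the same pushforward at \<open>p\<close>.\<close>
  obtain z where z: "z \<in> horiz p" "pf p z = sff X Y p"
    using horizontal_lift by blast
  obtain Z where Z: "Z \<in> vector_fields M" "Z p = z"
    using M.vector_field_through by blast
  have "h (F p) (sff X Y p) (sff X Y p) = 0"
    using 0[OF hproj_horizontal_field[OF Z(1)]] by (simp add: pf_hproj Z(2) z(2))
  then show ?thesis
    by (simp add: N.metric_self_eq_0)
qed

text \<open>From right to left both arguments are split. The horizontal pair contributes nothing,
  and any other pair has a vertical entry, which symmetry can move to the second slot, where the
  assumption applies.\<close>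

lemma totally_geodesic_iff:
  "totally_geodesic M N D DF F \<longleftrightarrow>
    (\<forall>U\<in>vector_fields M. \<forall>V\<in>vertical_fields M N F. \<forall>p. pf p (D U V p) = 0)" (is "?L \<longleftrightarrow> ?R")
proof
  assume L: ?L
  show ?R
  proof (intro ballI allI)
    fix U V p assume U: "U \<in> vector_fields M" and V: "V \<in> vertical_fields M N F"
    then have "sff U V p = 0"
      using L by (simp add: totally_geodesic_def vertical_fields_def)
    then show "pf p (D U V p) = 0"
      by (simp add: sff_vertical[OF U V])
  qed
next
  assume R: ?R
  have 0: "sff U V p = 0" if "U \<in> vector_fields M" "V \<in> vertical_fields M N F" for U V p
    using R that by (simp add: sff_vertical)
  show ?L
    unfolding totally_geodesic_def
  proof (intro ballI allI)
    fix U W p assume U: "U \<in> vector_fields M" and W: "W \<in> vector_fields M"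
    note hU = hproj_vector_field[OF U] and vU = vproj_vector_field[OF U]
      and hW = hproj_vector_field[OF W] and vW = vproj_vector_field[OF W]
    have "sff U (\<lambda>q. hproj W q + vproj W q) p = sff U (hproj W) p + sff U (vproj W) p"
      by (rule sff_add_right[OF U hW vW])
    then have "sff U W p = sff U (hproj W) p"
      by (simp add: hproj_add_vproj[symmetric] 0[OF U vproj_vertical_field[OF W]])
    also have "sff (\<lambda>q. hproj U q + vproj U q) (hproj W) p =
        sff (hproj U) (hproj W) p + sff (vproj U) (hproj W) p"
      by (rule sff_add_left[OF hU vU hW])
    then have "sff U (hproj W) p = sff (hproj U) (hproj W) p + sff (hproj W) (vproj U) p"
      by (simp add: hproj_add_vproj[symmetric] sff_sym[OF vU hW])
    also have "\<dots> = 0"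
      by (simp add: 0[OF hW vproj_vertical_field[OF U]]
          sff_horizontal[OF hproj_horizontal_field[OF U] hproj_horizontal_field[OF W]])
    finally show "sff U W p = 0" .
  qed
qed

text \<open>The direction of differentiation is split as well, matching the separate conditions on
  \<open>oneill_A\<close> and \<open>oneill_T\<close>.\<close>

lemma totally_geodesic_iff_horizontal_vertical:
  "totally_geodesic M N D DF F \<longleftrightarrow>
    (\<forall>V\<in>vertical_fields M N F. \<forall>W\<in>vertical_fields M N F. \<forall>X\<in>horizontal_fields M N g F. \<forall>p.
      pf p (D X V p) = 0 \<and> pf p (D V W p) = 0)" (is "_ \<longleftrightarrow> ?R")
  unfolding totally_geodesic_iff
proof
  assume "\<forall>U\<in>vector_fields M. \<forall>V\<in>vertical_fields M N F. \<forall>p. pf p (D U V p) = 0"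
  then show ?R
    by (simp add: vertical_fields_def horizontal_fields_def)
next
  assume R: ?R
  show "\<forall>U\<in>vector_fields M. \<forall>V\<in>vertical_fields M N F. \<forall>p. pf p (D U V p) = 0"
  proof (intro ballI allI)
    fix U V p assume U: "U \<in> vector_fields M" and V: "V \<in> vertical_fields M N F"
    have "D (\<lambda>q. hproj U q + vproj U q) V p = D (hproj U) V p + D (vproj U) V p"
      by (rule M.D_add_left[OF hproj_vector_field[OF U] vproj_vector_field[OF U]])
        (use V in \<open>simp add: vertical_fields_def\<close>)
    then have "pf p (D U V p) = pf p (D (hproj U) V p) + pf p (D (vproj U) V p)"
      by (simp add: hproj_add_vproj[symmetric] pf_simps)
    then show "pf p (D U V p) = 0"
      using R hproj_horizontal_field[OF U] vproj_vertical_field[OF U] V by simp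
  qed
qed

section \<open>Parallel endomorphisms and the O'Neill tensors\<close>

lemma D_0_right: "U \<in> vector_fields M \<Longrightarrow> D U (\<lambda>q. 0) p = 0"
  using M.D_scaleR_right[OF M.smooth_functions_const[of 0] _ M.vector_fields_0, of U p]
  by (simp add: M.mderiv_const)

text \<open>The left side is the common shape of \<open>oneill_A\<close> and \<open>oneill_T\<close>
  once the first argument has been projected. One summand comes from the derivative of the zero
  field. As \<open>R\<close> is parallel, the other vanishes exactly if \<open>R p (D U W p)\<close>
  lies in the image of the vertical space under \<open>R p\<close>, and injectivity cancels
  \<open>R p\<close>.\<close>

lemma parallel_endomorphism_projections:
  assumes par: "parallel_endomorphism M D R"
    and inj: "\<And>p. inj (R p)"
    and R: "(\<forall>p. R p ` vert p = vert p) \<or> (\<forall>p. R p ` vert p = horiz p)"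
    and U: "U \<in> vector_fields M" and W: "W \<in> vertical_fields M N F"
  shows "hproj (D U (vproj (\<lambda>q. R q (W q)))) p + vproj (D U (hproj (\<lambda>q. R q (W q)))) p = 0 \<longleftrightarrow>
    pf p (D U W p) = 0"
proof -
  let ?RW = "\<lambda>q. R q (W q)"
  have Wv: "W \<in> vector_fields M" "W q \<in> vert q" for q
    using W by (auto simp: vertical_fields_def)
  have DR: "D U ?RW p = R p (D U W p)"
    using par U Wv(1) by (simp add: parallel_endomorphism_def)
  have D0: "D U (\<lambda>q. 0) q = 0" for q
    by (rule D_0_right[OF U])
  have mem: "R p v \<in> R p ` vert p \<longleftrightarrow> pf p v = 0" for v
    by (simp add: inj_image_mem_iff[OF inj] vertical_iff)
  from R show ?thesis
  proof
    assume R: "\<forall>p. R p ` vert p = vert p"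
    then have "?RW q \<in> vert q" for q
      using Wv(2) by blast
    then have "vproj ?RW = ?RW" "hproj ?RW = (\<lambda>q. 0)"
      by (auto simp: vproj_of_vertical hproj_of_vertical)
    moreover have "vproj (D U (\<lambda>q. 0)) p = 0"
      by (simp add: vproj_eq_0_iff D0 subspace_0[OF subspace_horizontal])
    ultimately show ?thesis
      using mem[of "D U W p"] R by (simp add: hproj_eq_0_iff DR)
  next
    assume R: "\<forall>p. R p ` vert p = horiz p"
    then have "?RW q \<in> horiz q" for q
      using Wv(2) by blast
    then have "vproj ?RW = (\<lambda>q. 0)" "hproj ?RW = ?RW"
      by (auto simp: vproj_of_horizontal hproj_of_horizontal)
    moreover have "hproj (D U (\<lambda>q. 0)) p = 0"
      by (simp add: hproj_eq_0_iff D0 subspace_0[OF subspace_vertical])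
    ultimately show ?thesis
      using mem[of "D U W p"] R by (simp add: vproj_eq_0_iff DR)
  qed
qed

text \<open>\<open>X\<close> is its own horizontal part and \<open>V\<close> its own vertical part,
  so \<open>parallel_endomorphism_projections\<close> matches the two conditions one by one for
  fixed fields and a fixed point.\<close>

lemma totally_geodesic_iff_oneill:
  assumes "parallel_endomorphism M D R" "\<And>p. inj (R p)"
    "(\<forall>p. R p ` vert p = vert p) \<or> (\<forall>p. R p ` vert p = horiz p)"
  shows "totally_geodesic M N D DF F \<longleftrightarrow>
    (\<forall>V\<in>vertical_fields M N F. \<forall>W\<in>vertical_fields M N F. \<forall>X\<in>horizontal_fields M N g F. \<forall>p.
      oneill_A M N g D F X (\<lambda>q. R q (V q)) p = 0 \<and> oneill_T M N g D F V (\<lambda>q. R q (W q)) p = 0)"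
  unfolding totally_geodesic_iff_horizontal_vertical
proof (intro ball_cong all_cong1 refl arg_cong2[of _ _ _ _ "(\<and>)"])
  fix V W X p
  assume V: "V \<in> vertical_fields M N F" and W: "W \<in> vertical_fields M N F"
    and X: "X \<in> horizontal_fields M N g F"
  have vf: "V \<in> vector_fields M" "X \<in> vector_fields M"
    and "hproj X = X" "vproj V = V"
    using V X by (auto simp: vertical_fields_def horizontal_fields_def hproj_of_horizontal vproj_of_vertical)
  then show "(pf p (D X V p) = 0) = (oneill_A M N g D F X (\<lambda>q. R q (V q)) p = 0)"
    "(pf p (D V W p) = 0) = (oneill_T M N g D F V (\<lambda>q. R q (W q)) p = 0)"
    unfolding oneill_A_def oneill_T_def
    using parallel_endomorphism_projections[OF assms vf(2) V, of p]
      parallel_endomorphism_projections[OF assms vf(1) W, of p] by simp_all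
qed

end

theorem lemma3p16:
  fixes M :: "('m::{t2_space, second_countable_topology}, 'e::euclidean_space) chart set"
    and N :: "('n::{t2_space, second_countable_topology}, 'f::euclidean_space) chart set"
    and I J K :: "'m \<Rightarrow> 'e \<Rightarrow> 'e"
    and g :: "'m \<Rightarrow> 'e \<Rightarrow> 'e \<Rightarrow> real"
    and h :: "'n \<Rightarrow> 'f \<Rightarrow> 'f \<Rightarrow> real"
    and F :: "'m \<Rightarrow> 'n"
    and D :: "('m \<Rightarrow> 'e) \<Rightarrow> ('m \<Rightarrow> 'e) \<Rightarrow> 'm \<Rightarrow> 'e"
    and DN :: "('n \<Rightarrow> 'f) \<Rightarrow> ('n \<Rightarrow> 'f) \<Rightarrow> 'n \<Rightarrow> 'f"
    and DF :: "('m \<Rightarrow> 'e) \<Rightarrow> ('m \<Rightarrow> 'f) \<Rightarrow> 'm \<Rightarrow> 'f"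
  assumes "hyperkaehler M I J K g D"
    and "smooth_atlas N" and "riemannian_metric N h" and "levi_civita N h DN"
    and "h_lagrangian_submersion M N I J K g h F"
    and "pullback_connection M N F DN DF"
  shows
   "(totally_geodesic M N D DF F \<longleftrightarrow>
      (\<forall>V\<in>vertical_fields M N F. \<forall>W\<in>vertical_fields M N F.
        \<forall>X\<in>horizontal_fields M N g F. \<forall>p.
          oneill_A M N g D F X (\<lambda>q. I q (V q)) p = 0 \<and>
          oneill_T M N g D F V (\<lambda>q. I q (W q)) p = 0)) \<and>
    (totally_geodesic M N D DF F \<longleftrightarrow>
      (\<forall>V\<in>vertical_fields M N F. \<forall>W\<in>vertical_fields M N F.
        \<forall>X\<in>horizontal_fields M N g F. \<forall>p.
          oneill_A M N g D F X (\<lambda>q. K q (V q)) p = 0 \<and>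
          oneill_T M N g D F V (\<lambda>q. K q (W q)) p = 0)) \<and>
    (totally_geodesic M N D DF F \<longleftrightarrow>
      (\<forall>V\<in>vertical_fields M N F. \<forall>W\<in>vertical_fields M N F.
        \<forall>X\<in>horizontal_fields M N g F. \<forall>p.
          oneill_A M N g D F X (\<lambda>q. J q (V q)) p = 0 \<and>
          oneill_T M N g D F V (\<lambda>q. J q (W q)) p = 0))"
proof -
  have sub: "riemannian_submersion M N g h F"
    and R: "\<forall>p. I p ` vertical M N F p = horizontal M N g F p"
      "\<forall>p. J p ` vertical M N F p = vertical M N F p"
      "\<forall>p. K p ` vertical M N F p = horizontal M N g F p"
    using assms(5) by (simp_all add: h_lagrangian_submersion_def)
  have "smooth_atlas M" "riemannian_metric M g" "levi_civita M g D" "smooth_map M N F"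
    using assms(1) sub by (simp_all add: hyperkaehler_def riemannian_submersion_def)
  then interpret riemannian_submersion_geometry M g D N F h DN DF
    using assms sub by unfold_locales
  have par: "parallel_endomorphism M D S" and sq: "\<And>p v. S p (S p v) = - v" if "S \<in> {I, J, K}" for S
    using assms(1) that unfolding hyperkaehler_def by blast+
  \<comment> \<open>Applying \<open>S p\<close> twice gives the negative of the identity, whence
    injectivity.\<close>
  have inj: "inj (S p)" if "S \<in> {I, J, K}" for S p
    by (rule injI) (metis sq[OF that] neg_equal_iff_equal)
  show ?thesis
    \<comment> \<open>\<open>I\<close> and \<open>K\<close> fall under the alternative with
      horizontal image, \<open>J\<close> under the one with vertical image.\<close>
    by (intro conjI totally_geodesic_iff_oneill par inj) (simp_all add: R)
qed

end
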